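(* Let $\alpha\in\mathbb{R}\setminus\mathbb{Q}$. Then there exists a dense $G_\delta$ subset $\mathcal{G}$ of the space of absolutely continuous functions $f:\mathbb{T}\to\mathbb{R}$ with $\int_{\mathbb{T}}f(x)\,dx=0$, equipped with the topology of the norm $\|\cdot\|_{BV}$, such that for each $f\in\mathcal{G}$ the Markov process on $\mathbb{T}$ with transition kernel $$p(x,\cdot)=\mathfrak{p}(x)\delta_{x+\alpha}+(1-\mathfrak{p}(x))\delta_{x-\alpha},\qquad \mathfrak{p}(x)=\frac{\exp f(x)}{1+\exp f(x)},$$ is mixing.
   Context: $\mathbb{T}=\mathbb{R}/\mathbb{Z}$ is the circle and $dx$ is Lebesgue measure. $\|\cdot\|_{BV}$ is the usual bounded variation norm, e.g. $\|f\|_{BV}=\sup_{\mathbb{T}}|f|+\mathrm{var}(f)$, with $\mathrm{var}(f)$ the total variation of $f$ over $\mathbb{T}$. A Markov process $(X_n)$ on $\mathbb{T}$ is called mixing if there exists a Borel probability measure $\mu_\ast$ on $\mathbb{T}$ such that $\mathbb{E}_x\varphi(X_n)\to\int_{\mathbb{T}}\varphi\,d\mu_\ast$ as $n\to\infty$ for every $x\in\mathbb{T}$ and every continuous $\varphi:\mathbb{T}\to\mathbb{R}$, where $\mathbb{E}_x$ denotes expectation when $X_0=x$. *)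

theory Defs
  imports "HOL-Probability.Probability"
begin

section \<open>The circle\<close>

quotient_type circle = real / "\<lambda>x y :: real. x - y \<in> \<int>"
  morphisms rep_circle abs_circle
proof (rule equivpI)
  show "reflp (\<lambda>x y :: real. x - y \<in> \<int>)"
    by (simp add: reflp_def)
  show "symp (\<lambda>x y :: real. x - y \<in> \<int>)"
    unfolding symp_def by (metis Ints_minus minus_diff_eq)
  show "transp (\<lambda>x y :: real. x - y \<in> \<int>)"
    unfolding transp_def by (metis Ints_add diff_add_cancel add_diff_eq)
qed

lift_definition to_circle :: "real \<Rightarrow> circle" is "\<lambda>x. x" .

lemma to_circle_eq_iff: "to_circle x = to_circle y \<longleftrightarrow> x - y \<in> \<int>"
  by transfer simp

lemma surj_to_circle: "surj to_circle"
proof -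
  have "\<exists>x. y = to_circle x" for y
    by transfer (metis Ints_0 diff_self)
  then show ?thesis by (auto simp: surj_def)
qed

instantiation circle :: ab_group_add
begin

lift_definition zero_circle :: circle is 0 .
lift_definition plus_circle :: "circle \<Rightarrow> circle \<Rightarrow> circle" is "(+)"
  by (metis Ints_add add_diff_add)
lift_definition uminus_circle :: "circle \<Rightarrow> circle" is uminus
  by (metis Ints_minus minus_diff_minus)
definition minus_circle :: "circle \<Rightarrow> circle \<Rightarrow> circle" where
  "minus_circle x y = x + - y"

instance
proof
  fix a b c :: circle
  show "a + b + c = a + (b + c)" by transfer (simp add: add.assoc)
  show "a + b = b + a" by transfer (simp add: add.commute)
  show "0 + a = a" by transfer simp
  show "- a + a = 0" by transfer simp
qed (simp add: minus_circle_def)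

end

text \<open>The quotient topology of \<open>\<real>/\<int>\<close>.\<close>

instantiation circle :: topological_space
begin

definition open_circle :: "circle set \<Rightarrow> bool" where
  "open_circle U \<longleftrightarrow> open (to_circle -` U)"

instance
proof
  show "open (UNIV :: circle set)" by (simp add: open_circle_def)
  show "open (S \<inter> T)" if "open S" "open T" for S T :: "circle set"
    using that by (simp add: open_circle_def vimage_Int open_Int)
  show "open (\<Union>K)" if "\<forall>S\<in>K. open S" for K :: "circle set set"
    using that by (auto simp: open_circle_def vimage_Union)
qed

end

lemma continuous_on_to_circle: "continuous_on S to_circle"
proof -
  have "continuous_on UNIV to_circle"
    by (rule continuous_on_open_vimage[THEN iffD2]) (auto simp: open_circle_def)
  then show ?thesis by (rule continuous_on_subset) simp
qed

lemma measurable_to_circle [measurable]: "to_circle \<in> borel_measurable borel"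
  by (rule borel_measurable_continuous_onI) (rule continuous_on_to_circle)

definition circle_lebesgue :: "circle measure" where
  "circle_lebesgue = distr (restrict_space lborel {0..<1}) borel to_circle"

section \<open>Absolutely continuous functions and the BV norm\<close>

definition absolutely_continuous_on :: "real set \<Rightarrow> (real \<Rightarrow> real) \<Rightarrow> bool" where
  "absolutely_continuous_on S g \<longleftrightarrow>
     (\<forall>\<epsilon>>0. \<exists>\<delta>>0. \<forall>n::nat. \<forall>a b :: nat \<Rightarrow> real.
        (\<forall>i<n. a i \<le> b i \<and> {a i..b i} \<subseteq> S) \<and>
        disjoint_family_on (\<lambda>i. {a i<..<b i}) {..<n} \<and>
        (\<Sum>i<n. b i - a i) < \<delta> \<longrightarrow>
        (\<Sum>i<n. \<bar>g (b i) - g (a i)\<bar>) < \<epsilon>)"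

definition variation_sums :: "real \<Rightarrow> real \<Rightarrow> (real \<Rightarrow> real) \<Rightarrow> real set" where
  "variation_sums u v g =
     {\<Sum>i<n. \<bar>g (t (Suc i)) - g (t i)\<bar> | (n::nat) (t :: nat \<Rightarrow> real).
        (\<forall>i<n. t i \<le> t (Suc i)) \<and> (\<forall>i\<le>n. u \<le> t i \<and> t i \<le> v)}"

text \<open>
  Functions on the circle are pulled back to the fundamental domain \<open>[0, 1]\<close>; both endpoints
  represent the same point, so that jumps at \<open>0\<close> are taken into account.
\<close>

definition abs_cont_circle :: "(circle \<Rightarrow> real) \<Rightarrow> bool" where
  "abs_cont_circle f \<longleftrightarrow> absolutely_continuous_on {0..1} (f \<circ> to_circle)"

text \<open>
  The suprema below are suprema of reals, hence meaningful only for functions of bounded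
  variation; absolutely continuous functions are of that kind
  (see \<open>abs_cont_circle_bdd_above\<close> below).
\<close>

definition var_circle :: "(circle \<Rightarrow> real) \<Rightarrow> real" where
  "var_circle f = Sup (variation_sums 0 1 (f \<circ> to_circle))"

definition bv_norm :: "(circle \<Rightarrow> real) \<Rightarrow> real" where
  "bv_norm f = (SUP x. \<bar>f x\<bar>) + var_circle f"

definition AC0 :: "(circle \<Rightarrow> real) set" where
  "AC0 = {f. abs_cont_circle f \<and> (\<integral>x. f x \<partial>circle_lebesgue) = 0}"

text \<open>
  The locale \<open>Metric_space\<close> requires the distance to be nonnegative outside of the carrier as
  well, hence the case distinction.
\<close>

definition bv_dist :: "(circle \<Rightarrow> real) \<Rightarrow> (circle \<Rightarrow> real) \<Rightarrow> real" where
  "bv_dist f g = (if f \<in> AC0 \<and> g \<in> AC0 then bv_norm (\<lambda>x. f x - g x) else 0)"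

definition AC0_topology :: "(circle \<Rightarrow> real) topology" where
  "AC0_topology = Metric_space.mtopology AC0 bv_dist"

lemma bdd_above_variation_sums:
  assumes g: "absolutely_continuous_on {0..1} g"
  shows "bdd_above (variation_sums 0 1 g)"
proof -
  define P where "P u v \<longleftrightarrow> (0 \<le> u \<and> v \<le> 1 \<longrightarrow> bdd_above (variation_sums u v g))" for u v
  have "P 0 1"
  proof (rule Bolzano)
    fix a b c :: real
    assume P: "P a b" "P b c" and le: "a \<le> b" "b \<le> c"
    show "P a c"
      unfolding P_def
    proof
      assume ac: "0 \<le> a \<and> c \<le> 1"
      with P le obtain A B where
        A: "\<And>s. s \<in> variation_sums a b g \<Longrightarrow> s \<le> A" and
        B: "\<And>s. s \<in> variation_sums b c g \<Longrightarrow> s \<le> B"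
        unfolding P_def bdd_above_def by (metis order_trans)
      show "bdd_above (variation_sums a c g)"
      proof (rule bdd_aboveI)
        fix s assume "s \<in> variation_sums a c g"
        then obtain n t where s: "s = (\<Sum>i<n. \<bar>g (t (Suc i)) - g (t i)\<bar>)"
          and t: "\<forall>i<n. t i \<le> t (Suc i)" "\<forall>i\<le>n. a \<le> t i \<and> t i \<le> c"
          unfolding variation_sums_def by blast
        have split: "g r = g (min r b) + g (max r b) - g b" for r
          by (simp add: min_def max_def)
        have "s \<le> (\<Sum>i<n. \<bar>g (min (t (Suc i)) b) - g (min (t i) b)\<bar> +
                          \<bar>g (max (t (Suc i)) b) - g (max (t i) b)\<bar>)"
          unfolding s
          by (rule sum_mono) (use split in \<open>smt (verit, best)\<close>)
        also have "\<dots> = (\<Sum>i<n. \<bar>g (min (t (Suc i)) b) - g (min (t i) b)\<bar>) +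
                        (\<Sum>i<n. \<bar>g (max (t (Suc i)) b) - g (max (t i) b)\<bar>)"
          by (rule sum.distrib)
        also have "\<dots> \<le> A + B"
        proof (rule add_mono)
          show "(\<Sum>i<n. \<bar>g (min (t (Suc i)) b) - g (min (t i) b)\<bar>) \<le> A"
            by (rule A, unfold variation_sums_def, rule CollectI,
                rule exI[of _ n], rule exI[of _ "\<lambda>i. min (t i) b"])
               (use t le in \<open>auto simp: min_def intro: order_trans\<close>)
          show "(\<Sum>i<n. \<bar>g (max (t (Suc i)) b) - g (max (t i) b)\<bar>) \<le> B"
            by (rule B, unfold variation_sums_def, rule CollectI,
                rule exI[of _ n], rule exI[of _ "\<lambda>i. max (t i) b"])
               (use t le in \<open>auto simp: max_def intro: order_trans\<close>)
        qed
        finally show "s \<le> A + B" .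
      qed
    qed
  next
    fix x :: real
    obtain \<delta> where "\<delta> > 0" and \<delta>: "\<And>(n::nat) (a::nat \<Rightarrow> real) b.
        (\<forall>i<n. a i \<le> b i \<and> {a i..b i} \<subseteq> {0..1}) \<and>
        disjoint_family_on (\<lambda>i. {a i<..<b i}) {..<n} \<and>
        (\<Sum>i<n. b i - a i) < \<delta> \<Longrightarrow> (\<Sum>i<n. \<bar>g (b i) - g (a i)\<bar>) < 1"
      using g unfolding absolutely_continuous_on_def by (meson zero_less_one)
    have "P u v" if uv: "v - u < \<delta>" for u v
      unfolding P_def
    proof
      assume 01: "0 \<le> u \<and> v \<le> 1"
      show "bdd_above (variation_sums u v g)"
      proof (rule bdd_aboveI)
        fix s assume "s \<in> variation_sums u v g"
        then obtain n t where s: "s = (\<Sum>i<n. \<bar>g (t (Suc i)) - g (t i)\<bar>)"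
          and t: "\<forall>i<n. t i \<le> t (Suc i)" "\<forall>i\<le>n. u \<le> t i \<and> t i \<le> v"
          unfolding variation_sums_def by blast
        have mono: "t i \<le> t j" if "i \<le> j" "j \<le> n" for i j
          using that
        proof (induction j rule: dec_induct)
          case (step k)
          then show ?case using t(1)[rule_format, of k] by simp
        qed simp
        have "{t i<..<t (Suc i)} \<inter> {t j<..<t (Suc j)} = {}"
          if "i < n" "j < n" "i < j" for i j
          using mono[of "Suc i" j] that by auto
        then have "disjoint_family_on (\<lambda>i. {t i<..<t (Suc i)}) {..<n}"
          unfolding disjoint_family_on_def
          by (metis Int_commute lessThan_iff linorder_neqE_nat)
        moreover have "(\<Sum>i<n. t (Suc i) - t i) < \<delta>"
          unfolding sum_lessThan_telescope using t(2) uv by (smt (verit) le0 order_refl)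
        moreover have "\<forall>i<n. t i \<le> t (Suc i) \<and> {t i..t (Suc i)} \<subseteq> {0..1}"
        proof (intro allI impI conjI)
          fix i assume i: "i < n"
          then show "t i \<le> t (Suc i)" using t by blast
          have "0 \<le> t i" "t (Suc i) \<le> 1"
            using t(2)[rule_format, of i] t(2)[rule_format, of "Suc i"] i 01 by auto
          then show "{t i..t (Suc i)} \<subseteq> {0..1}" by auto
        qed
        ultimately show "s \<le> 1"
          unfolding s using \<delta>[of n t "\<lambda>i. t (Suc i)"] by simp
      qed
    qed
    with \<open>\<delta> > 0\<close> show "\<exists>d>0. \<forall>a b. a \<le> x \<and> x \<le> b \<and> b - a < d \<longrightarrow> P a b"
      by blast
  qed simp
  then show ?thesis by (simp add: P_def)
qed

lemma abs_le_variation_sums: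
  assumes "u \<le> x" "x \<le> v"
  shows "\<bar>g x - g u\<bar> \<in> variation_sums u v g"
  unfolding variation_sums_def
  by (rule CollectI, rule exI[of _ 1], rule exI[of _ "\<lambda>i. if i = 0 then u else x"])
     (use assms in auto)

lemma to_circle_cases:
  obtains x where "y = to_circle x" "0 \<le> x" "x \<le> 1"
proof -
  obtain r where "y = to_circle r" using surj_to_circle by blast
  also have "\<dots> = to_circle (frac r)"
    by (simp add: to_circle_eq_iff frac_def)
  finally show ?thesis
    using that[of "frac r"] frac_ge_0 frac_lt_1[of r] by force
qed

lemma abs_cont_circle_bdd_above:
  assumes "abs_cont_circle f"
  shows "bdd_above (variation_sums 0 1 (f \<circ> to_circle))" "bdd_above (range (\<lambda>x. \<bar>f x\<bar>))"
proof -
  show bdd: "bdd_above (variation_sums 0 1 (f \<circ> to_circle))"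
    using assms unfolding abs_cont_circle_def by (rule bdd_above_variation_sums)
  show "bdd_above (range (\<lambda>x. \<bar>f x\<bar>))"
  proof (rule bdd_aboveI, elim rangeE)
    fix s y assume s: "s = \<bar>f y\<bar>"
    obtain x where x: "y = to_circle x" "0 \<le> x" "x \<le> 1" by (rule to_circle_cases)
    have "\<bar>(f \<circ> to_circle) x - (f \<circ> to_circle) 0\<bar> \<le> var_circle f"
      unfolding var_circle_def by (rule cSup_upper[OF abs_le_variation_sums[OF x(2,3)] bdd])
    with x s show "s \<le> \<bar>f (to_circle 0)\<bar> + var_circle f" by simp
  qed
qed

lemma Metric_space_AC0: "Metric_space AC0 bv_dist"
proof -
  define W where "W f = variation_sums 0 1 (f \<circ> to_circle)" for f
  have W0: "0 \<in> W f" for f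
    using abs_le_variation_sums[of 0 0 1 "f \<circ> to_circle"] by (simp add: W_def)
  have sumsI: "\<exists>a\<in>W p. \<exists>b\<in>W q. s \<le> a + b"
    if s: "s \<in> W r" and r: "\<And>x y. \<bar>r x - r y\<bar> \<le> \<bar>p x - p y\<bar> + \<bar>q x - q y\<bar>"
    for s p q r
  proof -
    obtain n t where st: "s = (\<Sum>i<n. \<bar>(r \<circ> to_circle) (t (Suc i)) - (r \<circ> to_circle) (t i)\<bar>)"
      "(\<forall>i<n. t i \<le> t (Suc i)) \<and> (\<forall>i\<le>n. 0 \<le> t i \<and> t i \<le> 1)"
      using s unfolding W_def variation_sums_def by blast
    have "s \<le> (\<Sum>i<n. \<bar>(p \<circ> to_circle) (t (Suc i)) - (p \<circ> to_circle) (t i)\<bar>) +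
               (\<Sum>i<n. \<bar>(q \<circ> to_circle) (t (Suc i)) - (q \<circ> to_circle) (t i)\<bar>)"
      unfolding st(1) sum.distrib[symmetric] by (rule sum_mono) (simp add: r)
    with st(2) show ?thesis unfolding W_def variation_sums_def by blast
  qed
  have bddW: "bdd_above (W (\<lambda>x. f x - g x))" if "f \<in> AC0" "g \<in> AC0" for f g
  proof -
    have "bdd_above (W f)" "bdd_above (W g)"
      using that by (auto simp: AC0_def W_def abs_cont_circle_bdd_above)
    then obtain A B where "\<And>s. s \<in> W f \<Longrightarrow> s \<le> A" "\<And>s. s \<in> W g \<Longrightarrow> s \<le> B"
      unfolding bdd_above_def by blast
    with sumsI[of _ "\<lambda>x. f x - g x" f g] show ?thesis
      by (intro bdd_aboveI[of _ "A + B"]) (smt (verit))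
  qed
  have bddS: "bdd_above (range (\<lambda>x. \<bar>f x - g x\<bar>))" if "f \<in> AC0" "g \<in> AC0" for f g
  proof -
    have "bdd_above (range (\<lambda>x. \<bar>f x\<bar>))" "bdd_above (range (\<lambda>x. \<bar>g x\<bar>))"
      using that by (auto simp: AC0_def abs_cont_circle_bdd_above)
    then obtain A B where AB: "\<And>x. \<bar>f x\<bar> \<le> A" "\<And>x. \<bar>g x\<bar> \<le> B"
      unfolding bdd_above_def by blast
    have "\<bar>f x - g x\<bar> \<le> A + B" for x
      using AB(1)[of x] AB(2)[of x] by linarith
    then show ?thesis
      by (intro bdd_aboveI[of _ "A + B"]) auto
  qed
  have d: "bv_norm f = (SUP x. \<bar>f x\<bar>) + Sup (W f)" for f
    by (simp add: bv_norm_def var_circle_def W_def)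
  have S0: "0 \<le> (SUP x. \<bar>f x - g x\<bar>)" and V0: "0 \<le> Sup (W (\<lambda>x. f x - g x))"
    if fg: "f \<in> AC0" "g \<in> AC0" for f g
  proof -
    show "0 \<le> (SUP x. \<bar>f x - g x\<bar>)"
      using cSUP_upper[OF UNIV_I bddS[OF fg], of 0] by linarith
    show "0 \<le> Sup (W (\<lambda>x. f x - g x))"
      by (rule cSup_upper[OF W0 bddW[OF fg]])
  qed
  show ?thesis
  proof
    fix f g :: "circle \<Rightarrow> real"
    have "variation_sums 0 1 (\<lambda>x. - h x) = variation_sums 0 1 h" for h
      unfolding variation_sums_def by (simp add: abs_minus_commute)
    from this[of "\<lambda>x. g (to_circle x) - f (to_circle x)"]
    have "W (\<lambda>x. f x - g x) = W (\<lambda>x. g x - f x)"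
      by (simp add: W_def comp_def)
    then show "bv_dist f g = bv_dist g f"
      unfolding bv_dist_def d by (simp add: abs_minus_commute)
  next
    fix f g :: "circle \<Rightarrow> real" assume fg: "f \<in> AC0" "g \<in> AC0"
    show "bv_dist f g = 0 \<longleftrightarrow> f = g"
    proof
      assume "bv_dist f g = 0"
      then have 0: "bv_norm (\<lambda>x. f x - g x) = 0" using fg by (simp add: bv_dist_def)
      have "\<bar>f x - g x\<bar> \<le> 0" for x
        using cSUP_upper[OF UNIV_I bddS[OF fg], of x] S0[OF fg] V0[OF fg] 0
        unfolding d by linarith
      then show "f = g" by (auto simp: fun_eq_iff)
    next
      assume "f = g"
      moreover have "W (\<lambda>x. 0) = {0}"
        using W0[of "\<lambda>x. 0"] by (auto simp: W_def variation_sums_def)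
      ultimately show "bv_dist f g = 0"
        by (simp add: bv_dist_def d)
    qed
  next
    fix f g h :: "circle \<Rightarrow> real" assume mem: "f \<in> AC0" "g \<in> AC0" "h \<in> AC0"
    have "(SUP x. \<bar>f x - h x\<bar>) \<le> (SUP x. \<bar>f x - g x\<bar>) + (SUP x. \<bar>g x - h x\<bar>)"
    proof (rule cSUP_least)
      fix x
      show "\<bar>f x - h x\<bar> \<le> (SUP x. \<bar>f x - g x\<bar>) + (SUP x. \<bar>g x - h x\<bar>)"
        using cSUP_upper[OF UNIV_I bddS[OF mem(1,2)], of x]
          cSUP_upper[OF UNIV_I bddS[OF mem(2,3)], of x] by linarith
    qed simp
    moreover have "Sup (W (\<lambda>x. f x - h x)) \<le> Sup (W (\<lambda>x. f x - g x)) + Sup (W (\<lambda>x. g x - h x))"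
    proof (rule cSup_least)
      fix s assume "s \<in> W (\<lambda>x. f x - h x)"
      then obtain a b where ab: "a \<in> W (\<lambda>x. f x - g x)" "b \<in> W (\<lambda>x. g x - h x)" "s \<le> a + b"
        using sumsI[of s "\<lambda>x. f x - h x" "\<lambda>x. f x - g x" "\<lambda>x. g x - h x"] by force
      with cSup_upper[OF ab(1) bddW[OF mem(1,2)]] cSup_upper[OF ab(2) bddW[OF mem(2,3)]]
      show "s \<le> Sup (W (\<lambda>x. f x - g x)) + Sup (W (\<lambda>x. g x - h x))" by linarith
    qed (use W0 in blast)
    ultimately show "bv_dist f h \<le> bv_dist f g + bv_dist g h"
      using mem by (simp add: bv_dist_def d)
  next
    fix f g :: "circle \<Rightarrow> real"
    show "0 \<le> bv_dist f g"
      using S0[of f g] V0[of f g] by (simp add: bv_dist_def d)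
  qed
qed

lemma topspace_AC0_topology [simp]: "topspace AC0_topology = AC0"
  unfolding AC0_topology_def by (rule Metric_space.topspace_mtopology[OF Metric_space_AC0])

section \<open>Markov processes\<close>

text \<open>
  The law, on the space of trajectories, of the Markov process with transition kernel \<open>K\<close>
  started at \<open>x\<close>, given by the Ionescu-Tulcea theorem; \<open>X\<^sub>n\<close> is the coordinate \<open>\<omega> \<mapsto> \<omega> n\<close>.
\<close>

definition markov_step ::
  "('a::topological_space \<Rightarrow> 'a measure) \<Rightarrow> 'a \<Rightarrow> nat \<Rightarrow> (nat \<Rightarrow> 'a) \<Rightarrow> 'a measure" where
  "markov_step K x i \<omega> = (case i of 0 \<Rightarrow> return borel x | Suc j \<Rightarrow> K (\<omega> j))"

definition markov_law ::
  "('a::topological_space \<Rightarrow> 'a measure) \<Rightarrow> 'a \<Rightarrow> (nat \<Rightarrow> 'a) measure" where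
  "markov_law K x =
     projective_family.lim UNIV (Ionescu_Tulcea.CI (markov_step K x) (\<lambda>_. borel)) (\<lambda>_. borel)"

context
  fixes K :: "'a::topological_space \<Rightarrow> 'a measure"
  assumes K[measurable]: "K \<in> borel \<rightarrow>\<^sub>M subprob_algebra borel"
    and prob_K: "\<And>y. prob_space (K y)"
begin

lemma Ionescu_Tulcea_markov_step: "Ionescu_Tulcea (markov_step K x) (\<lambda>_. borel)"
proof (rule Ionescu_Tulcea.intro)
  fix i
  show "markov_step K x i \<in> PiM {0..<i} (\<lambda>_. borel) \<rightarrow>\<^sub>M subprob_algebra borel"
  proof (cases i)
    case 0
    then show ?thesis
      unfolding markov_step_def
      by (auto intro!: measurable_const simp: space_subprob_algebra prob_space_return prob_space_imp_subprob_space)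
  next
    case (Suc j)
    have "(\<lambda>\<omega>. \<omega> j) \<in> PiM {0..<i} (\<lambda>_. borel) \<rightarrow>\<^sub>M (borel :: 'a measure)"
      using Suc by (intro measurable_component_singleton) simp
    from measurable_compose[OF this K] Suc show ?thesis
      unfolding markov_step_def by simp
  qed
next
  fix i :: nat and \<omega> :: "nat \<Rightarrow> 'a"
  show "prob_space (markov_step K x i \<omega>)"
    by (cases i) (simp_all add: markov_step_def prob_space_return prob_K)
qed

lemma prob_space_markov_law: "prob_space (markov_law K x)"
  and sets_markov_law: "sets (markov_law K x) = sets (PiM UNIV (\<lambda>_. borel))"
  and distr_markov_law_0: "distr (markov_law K x) borel (\<lambda>\<omega>. \<omega> 0) = return borel x"
  and distr_markov_law_Suc:
    "distr (markov_law K x) borel (\<lambda>\<omega>. \<omega> (Suc n)) = distr (markov_law K x) borel (\<lambda>\<omega>. \<omega> n) \<bind> K"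
proof -
  interpret Ionescu_Tulcea "markov_step K x" "\<lambda>_. borel"
    by (rule Ionescu_Tulcea_markov_step)
  let ?L = "markov_law K x" and ?u = "\<lambda>_. undefined :: 'a"
  have L: "?L = PF.lim" by (simp add: markov_law_def)
  show sets: "sets ?L = sets (PiM UNIV (\<lambda>_. borel))"
    unfolding L by (rule PF.sets_lim)
  note [measurable_cong] = sets
  have upto: "up_to {0..<n} = n" for n
    using up_to_iff_Ico[of "{0..<n}" n] up_to_less[of "{0..<n}" "n - 1"]
    by (cases n) auto
  have u[simp]: "?u \<in> space (PiM {0..<0} (\<lambda>_. borel))"
    by (auto simp: space_PiM PiE_iff extensional_def)
  note setsC[measurable_cong] = sets_C[OF u, unfolded add_0]
  have fin: "distr ?L (PiM {0..<n} (\<lambda>_. borel)) (\<lambda>\<omega>. restrict \<omega> {0..<n}) = C 0 n ?u" for n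
  proof -
    have "CI {0..<n} = distr (C 0 n ?u) (C 0 n ?u) (\<lambda>\<omega>. \<omega>)"
      unfolding CI_def upto
    proof (rule distr_cong)
      fix \<omega> assume "\<omega> \<in> space (C 0 n ?u)"
      then have "\<omega> \<in> space (PiM {0..<n} (\<lambda>_. borel))" using space_C[OF u, of n] by simp
      then show "restrict \<omega> {0..<n} = \<omega>" by (auto simp: space_PiM PiE_iff extensional_restrict)
    qed (simp_all add: setsC)
    with distr_lim[of "{0..<n}"] show ?thesis by (simp add: L)
  qed
  have coord: "distr ?L borel (\<lambda>\<omega>. \<omega> n) = distr (C 0 (Suc n) ?u) borel (\<lambda>\<omega>. \<omega> n)" for n
    unfolding fin[symmetric] by (subst distr_distr) (simp_all add: comp_def)
  interpret L0: prob_space "distr ?L (PiM {0..<0} (\<lambda>_. borel)) (\<lambda>\<omega>. restrict \<omega> {0..<0})"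
    unfolding fin by (rule prob_space_C) (rule u)
  show "prob_space ?L"
    by (rule prob_space_distrD[OF _ L0.prob_space_axioms]) measurable
  have step: "emeasure (distr ?L borel (\<lambda>\<omega>. \<omega> n)) A =
      (\<integral>\<^sup>+\<omega>. emeasure (markov_step K x n \<omega>) A \<partial>C 0 n ?u)" if A[measurable]: "A \<in> sets borel" for A n
  proof -
    have "emeasure (distr ?L borel (\<lambda>\<omega>. \<omega> n)) A =
       emeasure (C 0 (Suc n) ?u) {\<omega> \<in> space (PiM {0..<Suc n} (\<lambda>_. borel)). \<omega> n \<in> A}"
      unfolding coord using space_C[OF u, of "Suc n"]
      by (subst emeasure_distr) (auto simp del: C.simps intro!: arg_cong2[where f=emeasure])
    also have "\<dots> = (\<integral>\<^sup>+\<omega>. emeasure (eP n \<omega>) {\<omega> \<in> space (PiM {0..<Suc n} (\<lambda>_. borel)). \<omega> n \<in> A} \<partial>C 0 n ?u)"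
      using measurable_eP[of n] prob_space_C[OF u, of n, THEN prob_space.not_empty]
      by (simp, subst emeasure_bind[where N="PiM {0..<Suc n} (\<lambda>_. borel)"]) auto
    also have "\<dots> = (\<integral>\<^sup>+\<omega>. emeasure (markov_step K x n \<omega>) A \<partial>C 0 n ?u)"
    proof (rule nn_integral_cong)
      fix \<omega> assume "\<omega> \<in> space (C 0 n ?u)"
      then have \<omega>: "\<omega> \<in> space (PiM {0..<n} (\<lambda>_. borel))" using space_C[OF u, of n] by simp
      have A': "{\<omega> \<in> space (PiM {0..<Suc n} (\<lambda>_. borel)). \<omega> n \<in> A} \<in> sets (PiM {0..<Suc n} (\<lambda>_. borel))"
        by measurable
      from \<omega> show "emeasure (eP n \<omega>) {\<omega> \<in> space (PiM {0..<Suc n} (\<lambda>_. borel)). \<omega> n \<in> A} =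
          emeasure (markov_step K x n \<omega>) A"
        by (subst emeasure_eP[OF \<omega> A']) (auto intro!: arg_cong2[where f=emeasure] simp: space_PiM PiE_iff extensional_def)
    qed
    finally show ?thesis .
  qed
  show "distr ?L borel (\<lambda>\<omega>. \<omega> 0) = return borel x"
  proof (rule measure_eqI)
    fix A assume "A \<in> sets (distr ?L borel (\<lambda>\<omega>. \<omega> 0))"
    then have "A \<in> sets borel" by simp
    then show "emeasure (distr ?L borel (\<lambda>\<omega>. \<omega> 0)) A = emeasure (return borel x) A"
      using prob_space_C[OF u, of 0, THEN prob_space.emeasure_space_1]
      by (subst step) (simp_all add: markov_step_def)
  qed simp
  have sK: "space (distr ?L borel (\<lambda>\<omega>. \<omega> n)) \<noteq> {}" by simp
  show "distr ?L borel (\<lambda>\<omega>. \<omega> (Suc n)) = distr ?L borel (\<lambda>\<omega>. \<omega> n) \<bind> K"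
  proof (rule measure_eqI)
    show "sets (distr ?L borel (\<lambda>\<omega>. \<omega> (Suc n))) = sets (distr ?L borel (\<lambda>\<omega>. \<omega> n) \<bind> K)"
      by (subst sets_bind[where N=borel]) (auto simp: subprob_measurableD(2)[OF K])
  next
    fix A assume "A \<in> sets (distr ?L borel (\<lambda>\<omega>. \<omega> (Suc n)))"
    then have A[measurable]: "A \<in> sets borel" by simp
    have "emeasure (distr ?L borel (\<lambda>\<omega>. \<omega> (Suc n))) A = (\<integral>\<^sup>+\<omega>. emeasure (K (\<omega> n)) A \<partial>C 0 (Suc n) ?u)"
      by (subst step[OF A]) (simp add: markov_step_def)
    also have "\<dots> = (\<integral>\<^sup>+y. emeasure (K y) A \<partial>distr ?L borel (\<lambda>\<omega>. \<omega> n))"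
      unfolding coord by (subst nn_integral_distr) (simp_all del: C.simps)
    also have "\<dots> = emeasure (distr ?L borel (\<lambda>\<omega>. \<omega> n) \<bind> K) A"
      by (subst emeasure_bind[where N=borel]) simp_all
    finally show "emeasure (distr ?L borel (\<lambda>\<omega>. \<omega> (Suc n))) A =
        emeasure (distr ?L borel (\<lambda>\<omega>. \<omega> n) \<bind> K) A" .
  qed
qed

end

definition mixing :: "('a::topological_space \<Rightarrow> 'a measure) \<Rightarrow> bool" where
  "mixing K \<longleftrightarrow>
     (\<exists>\<mu>. prob_space \<mu> \<and> sets \<mu> = sets borel \<and>
        (\<forall>x. \<forall>\<phi> :: 'a \<Rightarrow> real. continuous_on UNIV \<phi> \<longrightarrow>
           (\<lambda>n. \<integral>\<omega>. \<phi> (\<omega> n) \<partial>markov_law K x) \<longlonglongrightarrow> (\<integral>y. \<phi> y \<partial>\<mu>)))"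

definition step_prob :: "(circle \<Rightarrow> real) \<Rightarrow> circle \<Rightarrow> real" where
  "step_prob f x = exp (f x) / (1 + exp (f x))"

definition walk_kernel :: "real \<Rightarrow> (circle \<Rightarrow> real) \<Rightarrow> circle \<Rightarrow> circle measure" where
  "walk_kernel \<alpha> f x =
     measure_of UNIV (sets borel)
       (\<lambda>A. ennreal (step_prob f x) * emeasure (return borel (x + to_circle \<alpha>)) A +
            ennreal (1 - step_prob f x) * emeasure (return borel (x - to_circle \<alpha>)) A)"

lemma step_prob_bounds: "0 < step_prob f x" "step_prob f x < 1"
  by (simp_all add: step_prob_def add_pos_pos)

lemma sets_walk_kernel [simp, measurable_cong]: "sets (walk_kernel \<alpha> f x) = sets borel"
  unfolding walk_kernel_def
  by (metis sets.sigma_sets_eq sets_measure_of sets.space_closed space_borel)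

lemma walk_kernel_eq_distr:
  "walk_kernel \<alpha> f x =
     distr (measure_pmf (bernoulli_pmf (step_prob f x))) borel
       (\<lambda>b. if b then x + to_circle \<alpha> else x - to_circle \<alpha>)"
  (is "_ = ?D")
proof -
  have "emeasure ?D A = ennreal (step_prob f x) * emeasure (return borel (x + to_circle \<alpha>)) A +
            ennreal (1 - step_prob f x) * emeasure (return borel (x - to_circle \<alpha>)) A"
    if A: "A \<in> sets borel" for A
  proof -
    have "emeasure ?D A = (\<integral>\<^sup>+y. indicator A y \<partial>?D)"
      using A by simp
    also have "\<dots> = (\<integral>\<^sup>+b. indicator A (if b then x + to_circle \<alpha> else x - to_circle \<alpha>)
        \<partial>measure_pmf (bernoulli_pmf (step_prob f x)))"
      using A by (intro nn_integral_distr) auto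
    also have "\<dots> = ennreal (step_prob f x) * emeasure (return borel (x + to_circle \<alpha>)) A +
            ennreal (1 - step_prob f x) * emeasure (return borel (x - to_circle \<alpha>)) A"
      using A step_prob_bounds[of f x] by (simp add: mult.commute)
    finally show ?thesis .
  qed
  moreover have "sigma_sets UNIV (sets borel) = sets (borel :: circle measure)"
    by (metis sets.sigma_sets_eq space_borel)
  ultimately have "walk_kernel \<alpha> f x = measure_of UNIV (sets borel) (emeasure ?D)"
    unfolding walk_kernel_def by (intro measure_of_eq) auto
  also have "\<dots> = ?D"
    using measure_of_of_measure[of ?D] by simp
  finally show ?thesis .
qed

lemma emeasure_walk_kernel:
  assumes A: "A \<in> sets borel"
  shows "emeasure (walk_kernel \<alpha> f x) A =
     ennreal (step_prob f x) * indicator A (x + to_circle \<alpha>) +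
     ennreal (1 - step_prob f x) * indicator A (x - to_circle \<alpha>)"
proof -
  have "emeasure (walk_kernel \<alpha> f x) A = (\<integral>\<^sup>+y. indicator A y \<partial>walk_kernel \<alpha> f x)"
    using A by simp
  also have "\<dots> = (\<integral>\<^sup>+b. indicator A (if b then x + to_circle \<alpha> else x - to_circle \<alpha>)
      \<partial>measure_pmf (bernoulli_pmf (step_prob f x)))"
    unfolding walk_kernel_eq_distr using A by (intro nn_integral_distr) auto
  also have "\<dots> = ennreal (step_prob f x) * indicator A (x + to_circle \<alpha>) +
     ennreal (1 - step_prob f x) * indicator A (x - to_circle \<alpha>)"
    using A step_prob_bounds[of f x] by (simp add: mult.commute)
  finally show ?thesis .
qed

lemma prob_space_walk_kernel: "prob_space (walk_kernel \<alpha> f x)"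
  unfolding walk_kernel_eq_distr by (rule measure_pmf.prob_space_distr) simp

end

theory Submission
  imports Defs
begin

text \<open>
  Let \<open>P \<phi> x = E\<^sub>x \<phi>(X\<^sub>1)\<close> be the transition operator of the walk with drift \<open>f\<close> (\<open>walk_op\<close>).
  Averaging only narrows the range of a function, so the walk is mixing as soon as, for every
  continuous \<open>\<phi>\<close>, some \<open>P\<^sup>n \<phi>\<close> is uniformly close to a constant: then all later \<open>P\<^sup>m \<phi>\<close> stay close
  to that constant, and any weak limit point of the laws of \<open>X\<^sub>n\<close> is the limit measure
  (\<open>mixing_if_contracts\<close>). By linearity it suffices to check countably many \<open>\<phi>\<close> with dense span,
  for which periodised Bernstein polynomials serve (\<open>contracts_if_circle_Bernstein\<close>). For fixed
  \<open>\<phi>\<close> and \<open>\<epsilon>\<close>, the drifts \<open>f\<close> for which some \<open>P\<^sup>n \<phi>\<close> is \<open>\<epsilon>\<close>-close to a constant form an open set,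
  because \<open>P\<^sup>n \<phi>\<close> depends continuously on \<open>f\<close> already for the supremum norm. The countable
  intersection of these open sets is the set \<open>G\<close>, and it is dense because each of them contains
  the same dense set: the coboundaries \<open>f = u - u \<circ> T\<^sup>-\<^sup>1\<close>, where \<open>u\<close> is continuous and \<open>T\<close> is the
  rotation by \<open>\<alpha>\<close>.

  Coboundaries are dense (\<open>coboundaries_dense\<close>). An absolutely continuous \<open>f\<close> is the integral of an
  integrable density, and approximating the density by a continuous function in mean approximates
  \<open>f\<close> by a \<open>C\<^sup>1\<close> function \<open>H\<close> in bounded variation norm. The difference of \<open>H\<close> and its average over
  \<open>N\<close> steps of the rotation is a coboundary, and by unique ergodicity of the rotation, applied to
  \<open>H\<close> and to its derivative, the average is small together with its derivative.

  Coboundaries contract (\<open>coboundary_walk_contracts\<close>). If \<open>f = u - u \<circ> T\<^sup>-\<^sup>1\<close>, the walk is the random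
  walk with conductance \<open>c(x) = exp (u(x))\<close> on the edge from \<open>x\<close> to \<open>T x\<close>. Hence, with
  \<open>m = c + c \<circ> T\<^sup>-\<^sup>1\<close>, the function \<open>m (I - P) g\<close> is minus the second difference of \<open>g\<close> weighted by \<open>c\<close>,
  and the equation \<open>(I - P) g = \<psi> - const\<close> splits into two cohomological equations over the
  rotation, each of which is solvable up to a uniformly small error. The equation
  \<open>(I + P) g = \<psi>\<close> splits in the same way, with sums in place of differences. So every
  continuous \<open>\<phi>\<close> is uniformly close to \<open>const + (I - P\<^sup>2) h\<close>. Two steps of the walk return to the
  starting point with a probability bounded away from \<open>0\<close>, and for such an operator
  \<open>P\<^sup>2\<^sup>n (I - P\<^sup>2) h\<close> tends to \<open>0\<close> uniformly (\<open>asymptotic_regularity\<close>).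
\<close>

section \<open>Continuous functions on the circle and their means\<close>

lemma to_circle_add: "to_circle (x + y) = to_circle x + to_circle y"
  by transfer simp

lemma to_circle_diff: "to_circle (x - y) = to_circle x - to_circle y"
  unfolding minus_circle_def by transfer simp

lemma to_circle_of_int [simp]: "to_circle (of_int k) = 0"
  by transfer simp

lemma to_circle_frac: "to_circle (frac x) = to_circle x"
  by (simp add: to_circle_eq_iff frac_def)

lemma continuous_on_circle_iff:
  fixes \<phi> :: "circle \<Rightarrow> 'a::topological_space"
  shows "continuous_on UNIV \<phi> \<longleftrightarrow> continuous_on UNIV (\<lambda>x. \<phi> (to_circle x))"
  by (simp add: continuous_on_open_vimage open_circle_def vimage_def)

lemma continuous_on_circle_shift:
  fixes \<phi> :: "circle \<Rightarrow> 'a::topological_space"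
  assumes "continuous_on UNIV \<phi>"
  shows "continuous_on UNIV (\<lambda>x. \<phi> (x + c))" and "continuous_on UNIV (\<lambda>x. \<phi> (x - c))"
proof -
  have "continuous_on UNIV (\<lambda>x. \<phi> (x + to_circle s))" for s
    using continuous_on_compose2[OF assms[unfolded continuous_on_circle_iff]
        continuous_on_add[OF continuous_on_id continuous_on_const]]
    unfolding continuous_on_circle_iff[of "\<lambda>x. \<phi> (x + to_circle s)"]
    by (simp add: to_circle_add)
  then show shift: "continuous_on UNIV (\<lambda>x. \<phi> (x + c))" for c
    by (metis surjD[OF surj_to_circle])
  from shift[of "- c"] show "continuous_on UNIV (\<lambda>x. \<phi> (x - c))"
    by simp
qed

lemma continuous_circle_bounded:
  fixes \<phi> :: "circle \<Rightarrow> real"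
  assumes "continuous_on UNIV \<phi>"
  obtains C where "0 < C" "\<And>x. \<bar>\<phi> x\<bar> \<le> C"
proof -
  have "continuous_on {0..1} (\<lambda>x. \<phi> (to_circle x))"
    using assms continuous_on_circle_iff continuous_on_subset by blast
  then have "bounded ((\<lambda>x. \<phi> (to_circle x)) ` {0..1})"
    by (intro compact_imp_bounded compact_continuous_image) auto
  then obtain C where "0 < C" and C: "\<And>x. x \<in> {0..1} \<Longrightarrow> \<bar>\<phi> (to_circle x)\<bar> \<le> C"
    by (auto simp: bounded_pos)
  then have "\<bar>\<phi> x\<bar> \<le> C" for x
    by (cases x rule: to_circle_cases) auto
  with \<open>0 < C\<close> that show ?thesis by blast
qed

lemma continuous_circle_uniform:
  fixes \<phi> :: "circle \<Rightarrow> real"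
  assumes "continuous_on UNIV \<phi>" "0 < e"
  obtains d where "0 < d" "\<And>x s. \<bar>s\<bar> < d \<Longrightarrow> \<bar>\<phi> (x + to_circle s) - \<phi> x\<bar> < e"
proof -
  have "continuous_on {-1..2} (\<lambda>x. \<phi> (to_circle x))"
    using assms continuous_on_circle_iff continuous_on_subset by blast
  then have "uniformly_continuous_on {-1..2} (\<lambda>x. \<phi> (to_circle x))"
    by (intro compact_uniformly_continuous) auto
  then obtain d where "0 < d" and d: "\<And>x y. x \<in> {-1..2} \<Longrightarrow> y \<in> {-1..2} \<Longrightarrow> \<bar>y - x\<bar> < d \<Longrightarrow>
      \<bar>\<phi> (to_circle y) - \<phi> (to_circle x)\<bar> < e"
    using \<open>0 < e\<close> unfolding uniformly_continuous_on_def dist_real_def by metis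
  have "\<bar>\<phi> (x + to_circle s) - \<phi> x\<bar> < e" if s: "\<bar>s\<bar> < min d 1" for x s
  proof -
    obtain r where r: "x = to_circle r" "0 \<le> r" "r \<le> 1" by (rule to_circle_cases)
    with s have "\<bar>\<phi> (to_circle (r + s)) - \<phi> (to_circle r)\<bar> < e"
      by (intro d) auto
    with r(1) show ?thesis by (simp add: to_circle_add)
  qed
  with \<open>0 < d\<close> that[of "min d 1"] show ?thesis by simp
qed

text \<open>
  On each closed cell between consecutive integers the function is a translate of \<open>h\<close>, the
  right end point being covered by \<open>h 0 = h 1\<close>; two adjacent cells cover a neighbourhood of any
  point.
\<close>

lemma continuous_on_frac_periodic:
  fixes h :: "real \<Rightarrow> real"
  assumes h: "continuous_on {0..1} h" and eq: "h 0 = h 1"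
  shows "continuous_on UNIV (\<lambda>x. h (frac x))"
proof -
  have cell: "continuous_on {of_int k..of_int k + 1} (\<lambda>x. h (frac x))" for k :: int
  proof (rule continuous_on_eq)
    show "continuous_on {of_int k..of_int k + 1} (\<lambda>x. h (x - of_int k))"
      by (rule continuous_on_compose2[OF h]) (auto intro!: continuous_intros)
    fix x :: real assume x: "x \<in> {of_int k..of_int k + 1}"
    show "h (x - of_int k) = h (frac x)"
    proof (cases "x = of_int k + 1")
      case True
      then show ?thesis using eq by (simp add: frac_def)
    next
      case False
      with x have "\<lfloor>x\<rfloor> = k" by (intro floor_unique) auto
      then show ?thesis by (simp add: frac_def)
    qed
  qed
  have "isCont (\<lambda>x. h (frac x)) x" for x
  proof -
    have "continuous_on ({of_int (\<lfloor>x\<rfloor> - 1)..of_int (\<lfloor>x\<rfloor> - 1) + 1} \<union>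
        {of_int \<lfloor>x\<rfloor>..of_int \<lfloor>x\<rfloor> + 1}) (\<lambda>x. h (frac x))"
      using cell[of "\<lfloor>x\<rfloor> - 1"] cell[of "\<lfloor>x\<rfloor>"] by (rule continuous_on_closed_Un[rotated 2]) auto
    then have "continuous_on {of_int \<lfloor>x\<rfloor> - 1<..<of_int \<lfloor>x\<rfloor> + 1} (\<lambda>x. h (frac x))"
      by (rule continuous_on_subset) auto
    moreover have "x \<in> {of_int \<lfloor>x\<rfloor> - 1<..<of_int \<lfloor>x\<rfloor> + 1}"
      by simp linarith
    ultimately show ?thesis
      by (simp add: continuous_on_eq_continuous_at)
  qed
  then show ?thesis by (simp add: continuous_at_imp_continuous_on)
qed

text \<open>
  The choice of the representative \<open>rep_circle x\<close> is arbitrary; taking the fractional part makes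
  the value depend on the values of \<open>h\<close> on \<open>[0, 1)\<close> only.
\<close>

definition periodization :: "(real \<Rightarrow> real) \<Rightarrow> circle \<Rightarrow> real" where
  "periodization h x = h (frac (rep_circle x))"

lemma periodization_to_circle: "periodization h (to_circle x) = h (frac x)"
proof -
  have "to_circle (rep_circle (to_circle x)) = to_circle x"
    by (simp add: to_circle_def Quotient_abs_rep[OF Quotient_circle])
  then have "rep_circle (to_circle x) - x \<in> \<int>"
    by (simp add: to_circle_eq_iff)
  then obtain k where "rep_circle (to_circle x) = x + of_int k"
    by (metis Ints_cases add.commute diff_add_cancel)
  then show ?thesis
    by (simp add: periodization_def frac_def)
qed

lemma continuous_on_periodization:
  assumes "continuous_on {0..1} h" "h 0 = h 1"
  shows "continuous_on UNIV (periodization h)"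
  unfolding continuous_on_circle_iff periodization_to_circle
  by (rule continuous_on_frac_periodic[OF assms])

definition mean :: "(circle \<Rightarrow> real) \<Rightarrow> real" where
  "mean \<phi> = (\<integral>x. \<phi> x \<partial>circle_lebesgue)"

lemma prob_space_circle_lebesgue: "prob_space circle_lebesgue"
  unfolding circle_lebesgue_def
proof (rule prob_space.prob_space_distr)
  show "prob_space (restrict_space lborel {0..<1::real})"
    by (rule prob_spaceI) (simp add: emeasure_restrict_space space_restrict_space)
  show "to_circle \<in> restrict_space lborel {0..<1} \<rightarrow>\<^sub>M borel"
    by (rule measurable_restrict_space1) simp
qed

lemma borel_measurable_circle:
  fixes \<phi> :: "circle \<Rightarrow> real"
  assumes "continuous_on UNIV \<phi>"
  shows "\<phi> \<in> borel_measurable borel"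
  using assms by (rule borel_measurable_continuous_onI)

lemma integrable_circle_lebesgue:
  fixes \<phi> :: "circle \<Rightarrow> real"
  assumes "continuous_on UNIV \<phi>"
  shows "integrable circle_lebesgue \<phi>"
proof -
  interpret prob_space circle_lebesgue by (rule prob_space_circle_lebesgue)
  obtain C where "\<And>x. \<bar>\<phi> x\<bar> \<le> C" using continuous_circle_bounded[OF assms] by blast
  then show ?thesis
    by (intro integrable_const_bound[of _ C])
       (auto intro!: borel_measurable_circle[OF assms] simp: circle_lebesgue_def)
qed

lemma mean_const: "mean (\<lambda>x. c) = c"
  using prob_space.prob_space[OF prob_space_circle_lebesgue] by (simp add: mean_def)

lemma
  fixes \<phi> \<psi> :: "circle \<Rightarrow> real"
  assumes "continuous_on UNIV \<phi>" "continuous_on UNIV \<psi>"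
  shows mean_diff: "mean (\<lambda>x. \<phi> x - \<psi> x) = mean \<phi> - mean \<psi>"
    and mean_cmult: "mean (\<lambda>x. c * \<phi> x) = c * mean \<phi>"
proof -
  show "mean (\<lambda>x. \<phi> x - \<psi> x) = mean \<phi> - mean \<psi>"
    "mean (\<lambda>x. c * \<phi> x) = c * mean \<phi>"
    using assms by (simp_all add: mean_def integrable_circle_lebesgue)
qed

lemma mean_near_const:
  assumes "continuous_on UNIV \<phi>" and "\<And>x. \<bar>\<phi> x - v\<bar> \<le> e"
  shows "\<bar>mean \<phi> - v\<bar> \<le> e"
proof -
  interpret prob_space circle_lebesgue by (rule prob_space_circle_lebesgue)
  have "v - e \<le> \<phi> x" "\<phi> x \<le> v + e" for x
    using assms(2)[of x] by linarith+
  then have "v - e \<le> mean \<phi>" "mean \<phi> \<le> v + e"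
    unfolding mean_def using integrable_circle_lebesgue[OF assms(1)]
    by (auto intro!: integral_ge_const integral_le_const)
  then show ?thesis by linarith
qed

lemma mean_pos:
  assumes "continuous_on UNIV \<phi>" "0 < v" "\<And>x. v \<le> \<phi> x"
  shows "0 < mean \<phi>"
proof -
  interpret prob_space circle_lebesgue by (rule prob_space_circle_lebesgue)
  have "v \<le> mean \<phi>"
    unfolding mean_def using integrable_circle_lebesgue[OF assms(1)] assms(3)
    by (auto intro!: integral_ge_const)
  with assms(2) show ?thesis by simp
qed

lemma mean_eq_integral:
  assumes "continuous_on UNIV \<phi>"
  shows "mean \<phi> = integral {0..1} (\<lambda>x. \<phi> (to_circle x))"
proof -
  have cont: "continuous_on {0..1} (\<lambda>x. \<phi> (to_circle x))"
    using assms continuous_on_circle_iff continuous_on_subset by blast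
  have [measurable]: "(\<lambda>x. \<phi> (to_circle x)) \<in> borel_measurable borel"
    using assms by (intro borel_measurable_continuous_onI) (simp add: continuous_on_circle_iff)
  have "mean \<phi> = (LINT x:{0..<1}|lborel. \<phi> (to_circle x))"
    unfolding mean_def circle_lebesgue_def set_lebesgue_integral_def
    by (subst integral_distr)
       (auto simp: integral_restrict_space borel_measurable_circle[OF assms]
             intro!: measurable_restrict_space1)
  also have "\<dots> = (LINT x:{0..1}|lborel. \<phi> (to_circle x))"
    unfolding set_lebesgue_integral_def
  proof (rule integral_cong_AE)
    show "AE x in lborel. indicator {0..<1} x *\<^sub>R \<phi> (to_circle x) = indicator {0..1} x *\<^sub>R \<phi> (to_circle x)"
      using AE_lborel_singleton[of "1::real"] by eventually_elim (auto split: split_indicator)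
  qed auto
  also have "\<dots> = integral {0..1} (\<lambda>x. \<phi> (to_circle x))"
    by (rule set_borel_integral_eq_integral(2)[OF borel_integrable_atLeastAtMost'[OF cont]])
  finally show ?thesis .
qed

text \<open>
  A primitive on the real line grows by a constant over each period, since the derivative of
  \<open>H (x + 1) - H x\<close> vanishes; the constant is the integral over \<open>[0, 1]\<close>. This yields the
  translation invariance of the mean, and periodic primitives of functions of mean zero.
\<close>

lemma circle_antiderivative:
  fixes \<phi> :: "circle \<Rightarrow> real"
  assumes "continuous_on UNIV \<phi>"
  obtains H where "\<And>x. (H has_real_derivative \<phi> (to_circle x)) (at x)"
    and "\<And>x. H (x + 1) = H x + mean \<phi>"
proof -
  have "isCont (\<lambda>x. \<phi> (to_circle x)) x" for x
    using assms by (simp add: continuous_on_circle_iff continuous_on_eq_continuous_at)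
  with einterval_antiderivative[of "-\<infinity>" "\<infinity>" "\<lambda>x. \<phi> (to_circle x)"] obtain H where
    H: "\<And>x. (H has_real_derivative \<phi> (to_circle x)) (at x)"
    by (auto simp: has_real_derivative_iff_has_vector_derivative)
  have one: "to_circle 1 = 0"
    using to_circle_of_int[of 1] by simp
  have "H (x + 1) - H x = mean \<phi>" for x
  proof -
    have "\<forall>y. ((\<lambda>y. H (y + 1) - H y) has_real_derivative 0) (at y)"
      by (auto intro!: derivative_eq_intros DERIV_chain2[OF H] H simp: to_circle_add one)
    then have "H (x + 1) - H x = H (0 + 1) - H 0"
      by (rule DERIV_isconst_all)
    also have "\<dots> = integral {0..1} (\<lambda>x. \<phi> (to_circle x))"
      using fundamental_theorem_of_calculus[of 0 1 H "\<lambda>x. \<phi> (to_circle x)"] H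
      by (simp add: has_real_derivative_iff_has_vector_derivative[symmetric]
            has_field_derivative_at_within integral_unique)
    finally show ?thesis by (simp add: mean_eq_integral[OF assms])
  qed
  then have "H (x + 1) = H x + mean \<phi>" for x
    by (metis add.commute diff_add_cancel)
  with H that show ?thesis by blast
qed

lemma mean_shift:
  assumes "continuous_on UNIV \<phi>"
  shows "mean (\<lambda>x. \<phi> (x - c)) = mean \<phi>"
proof -
  obtain s where c: "c = to_circle s" by (metis surjD[OF surj_to_circle])
  obtain H where H: "\<And>x. (H has_real_derivative \<phi> (to_circle x)) (at x)"
    and H1: "\<And>x. H (x + 1) = H x + mean \<phi>"
    using circle_antiderivative[OF assms] by blast
  have "((\<lambda>x. H (x - s)) has_real_derivative \<phi> (to_circle x - c)) (at x within {0..1})" for x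
  proof -
    have "((\<lambda>x. x - s) has_real_derivative 1) (at x within {0..1})"
      by (auto intro!: derivative_eq_intros)
    from DERIV_chain2[OF H this] show ?thesis
      by (simp add: c to_circle_diff)
  qed
  then have "((\<lambda>x. \<phi> (to_circle x - c)) has_integral (H (1 - s) - H (0 - s))) {0..1}"
    by (intro fundamental_theorem_of_calculus)
       (auto simp: has_real_derivative_iff_has_vector_derivative[symmetric])
  then have "mean (\<lambda>x. \<phi> (x - c)) = H (1 - s) - H (0 - s)"
    by (subst mean_eq_integral[OF continuous_on_circle_shift(2)[OF assms]]) (rule integral_unique)
  also have "\<dots> = mean \<phi>"
    using H1[of "- s"] by (simp add: add.commute)
  finally show ?thesis .
qed

section \<open>Averages along an irrational rotation\<close>

definition rot_average :: "real \<Rightarrow> nat \<Rightarrow> (circle \<Rightarrow> real) \<Rightarrow> circle \<Rightarrow> real" where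
  "rot_average \<alpha> N \<phi> x = (\<Sum>j<N. \<phi> (x - to_circle (real j * \<alpha>))) / real N"

lemma continuous_on_rot_average:
  assumes "continuous_on UNIV \<phi>"
  shows "continuous_on UNIV (rot_average \<alpha> N \<phi>)"
  unfolding rot_average_def
  by (cases "N = 0") (auto intro!: continuous_intros continuous_on_circle_shift assms)

lemma mean_rot_average:
  assumes "continuous_on UNIV \<phi>" "0 < N"
  shows "mean (rot_average \<alpha> N \<phi>) = mean \<phi>"
proof -
  have "mean (rot_average \<alpha> N \<phi>) = (\<Sum>j<N. mean (\<lambda>x. \<phi> (x - to_circle (real j * \<alpha>)))) / real N"
    unfolding mean_def rot_average_def
    by (simp add: integrable_circle_lebesgue continuous_on_circle_shift assms)
  with \<open>0 < N\<close> show ?thesis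
    by (simp add: mean_shift[OF assms(1)])
qed

text \<open>
  By Kronecker's theorem the orbit of \<open>0\<close> is dense; compactness of \<open>[0, 1]\<close> leaves finitely many
  points of the orbit.
\<close>

lemma orbit_finitely_dense:
  assumes "\<alpha> \<notin> \<rat>" "0 < d"
  obtains K where "\<And>s. \<exists>k<K. \<exists>t. \<bar>t\<bar> < d \<and> to_circle s = to_circle (real k * \<alpha>) + to_circle t"
proof -
  have dense: "closure (range (\<lambda>n. frac (real n * \<alpha>))) = {0..1}"
    by (rule Kronecker_approx_1[OF assms(1)])
  have "{0..1} \<subseteq> (\<Union>n::nat. ball (frac (real n * \<alpha>)) d)"
  proof
    fix x :: real assume "x \<in> {0..1}"
    then have "\<exists>y\<in>range (\<lambda>n. frac (real n * \<alpha>)). dist y x < d"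
      using \<open>0 < d\<close> unfolding dense[symmetric] closure_approachable by blast
    then show "x \<in> (\<Union>n::nat. ball (frac (real n * \<alpha>)) d)" by auto
  qed
  then obtain I where I: "finite I" "{0..1} \<subseteq> (\<Union>n\<in>I. ball (frac (real (n::nat) * \<alpha>)) d)"
    using compactE_image[OF compact_Icc, of UNIV "\<lambda>n. ball (frac (real n * \<alpha>)) d" 0 1] by auto
  obtain K where K: "\<And>n. n \<in> I \<Longrightarrow> n < K"
    using I(1) by (metis finite_nat_set_iff_bounded)
  have "\<exists>k<K. \<exists>t. \<bar>t\<bar> < d \<and> to_circle s = to_circle (real k * \<alpha>) + to_circle t" for s
  proof -
    have "frac s \<in> {0..1}" using frac_lt_1[of s] by simp
    with I(2) have "frac s \<in> (\<Union>n\<in>I. ball (frac (real n * \<alpha>)) d)" by (rule subsetD)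
    then obtain k where "k \<in> I" and k: "\<bar>frac s - frac (real k * \<alpha>)\<bar> < d"
      by (auto simp: dist_real_def abs_minus_commute)
    have "to_circle s = to_circle (frac (real k * \<alpha>) + (frac s - frac (real k * \<alpha>)))"
      by (simp add: to_circle_frac)
    also have "\<dots> = to_circle (real k * \<alpha>) + to_circle (frac s - frac (real k * \<alpha>))"
      by (simp only: to_circle_add to_circle_frac)
    finally show ?thesis using k K[OF \<open>k \<in> I\<close>] by blast
  qed
  then show ?thesis by (rule that)
qed

text \<open>
  Moving the base point by one step of the rotation changes only the first and the last of the
  \<open>N\<close> summands.
\<close>

lemma rot_average_shift_orbit:
  assumes "\<And>x. \<bar>\<phi> x\<bar> \<le> C"
  shows "\<bar>rot_average \<alpha> N \<phi> (x + to_circle (real k * \<alpha>)) - rot_average \<alpha> N \<phi> x\<bar> \<le> 2 * C * real k / real N"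
proof (induction k)
  case 0
  then show ?case using to_circle_of_int[of 0] by simp
next
  case (Suc k)
  define b where "b j = \<phi> (x + to_circle (real (Suc k) * \<alpha>) - to_circle (real j * \<alpha>))" for j
  have b: "\<phi> (x + to_circle (real k * \<alpha>) - to_circle (real j * \<alpha>)) = b (Suc j)" for j
    unfolding b_def by (simp add: algebra_simps to_circle_add)
  have "rot_average \<alpha> N \<phi> (x + to_circle (real (Suc k) * \<alpha>)) - rot_average \<alpha> N \<phi> (x + to_circle (real k * \<alpha>))
      = (\<Sum>j<N. b j - b (Suc j)) / real N"
    unfolding rot_average_def b b_def[symmetric] by (simp add: sum_subtractf diff_divide_distrib)
  also have "\<dots> = (b 0 - b N) / real N"
    by (simp add: sum_lessThan_telescope')
  finally have "\<bar>rot_average \<alpha> N \<phi> (x + to_circle (real (Suc k) * \<alpha>)) -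
      rot_average \<alpha> N \<phi> (x + to_circle (real k * \<alpha>))\<bar> = \<bar>b 0 - b N\<bar> / real N"
    by simp
  also have "\<dots> \<le> 2 * C / real N"
  proof (rule divide_right_mono)
    have "\<bar>b 0\<bar> \<le> C" "\<bar>b N\<bar> \<le> C" unfolding b_def by (rule assms)+
    then show "\<bar>b 0 - b N\<bar> \<le> 2 * C" by linarith
  qed simp
  finally show ?case using Suc.IH by (simp add: algebra_simps add_divide_distrib)
qed

text \<open>
  Any \<open>y\<close> is within \<open>d\<close> of a point \<open>x + k \<alpha>\<close> with \<open>k < K\<close>,
  where \<open>K\<close> depends on \<open>d\<close> only; the averages inherit the modulus of continuity of \<open>\<phi>\<close> and change
  by \<open>O(K / N)\<close> along \<open>K\<close> steps of the orbit. So their oscillation tends to \<open>0\<close>, and their mean is that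
  of \<open>\<phi>\<close>. This is the unique ergodicity of the rotation.
\<close>

lemma rot_average_uniform:
  fixes \<phi> :: "circle \<Rightarrow> real"
  assumes \<alpha>: "\<alpha> \<notin> \<rat>" and \<phi>: "continuous_on UNIV \<phi>" and e: "0 < e"
  obtains N0 where "\<And>N x. N0 \<le> N \<Longrightarrow> \<bar>rot_average \<alpha> N \<phi> x - mean \<phi>\<bar> \<le> e"
proof -
  obtain C where C: "0 < C" "\<And>x. \<bar>\<phi> x\<bar> \<le> C" using continuous_circle_bounded[OF \<phi>] by blast
  obtain d where d: "0 < d" "\<And>x s. \<bar>s\<bar> < d \<Longrightarrow> \<bar>\<phi> (x + to_circle s) - \<phi> x\<bar> < e / 2"
    using continuous_circle_uniform[OF \<phi>, of "e / 2"] e by auto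
  obtain K where K: "\<And>s. \<exists>k<K. \<exists>t. \<bar>t\<bar> < d \<and> to_circle s = to_circle (real k * \<alpha>) + to_circle t"
    using orbit_finitely_dense[OF \<alpha> d(1)] by blast
  obtain N0 :: nat where N0: "4 * C * real K / e < real N0" using reals_Archimedean2 by blast
  have "\<bar>rot_average \<alpha> N \<phi> x - mean \<phi>\<bar> \<le> e" if N: "N0 \<le> N" for N x
  proof -
    let ?A = "rot_average \<alpha> N \<phi>"
    have "0 \<le> 4 * C * real K / e" using C(1) e by simp
    then have N': "0 < N" "4 * C * real K / e < real N" using N N0 by auto
    have "\<bar>?A y - ?A x\<bar> \<le> e" for y
    proof -
      obtain s where s: "y - x = to_circle s" by (metis surjD[OF surj_to_circle])
      obtain k t where k: "k < K" and t: "\<bar>t\<bar> < d"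
        and st: "to_circle s = to_circle (real k * \<alpha>) + to_circle t" using K by blast
      have y: "y = x + to_circle (real k * \<alpha>) + to_circle t"
        using s st by (simp add: algebra_simps)
      have "\<bar>?A y - ?A (x + to_circle (real k * \<alpha>))\<bar> =
          \<bar>\<Sum>j<N. \<phi> (y - to_circle (real j * \<alpha>)) - \<phi> (x + to_circle (real k * \<alpha>) - to_circle (real j * \<alpha>))\<bar> / real N"
        unfolding rot_average_def by (simp add: sum_subtractf diff_divide_distrib[symmetric])
      also have "\<dots> \<le> (\<Sum>j<N. e / 2) / real N"
      proof (intro divide_right_mono order_trans[OF sum_abs] sum_mono)
        fix j
        have "y - to_circle (real j * \<alpha>) = (x + to_circle (real k * \<alpha>) - to_circle (real j * \<alpha>)) + to_circle t"
          unfolding y by (simp add: algebra_simps)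
        then show "\<bar>\<phi> (y - to_circle (real j * \<alpha>)) -
            \<phi> (x + to_circle (real k * \<alpha>) - to_circle (real j * \<alpha>))\<bar> \<le> e / 2"
          by (metis d(2)[OF t] less_imp_le)
      qed simp
      also have "\<dots> = e / 2" using N'(1) by simp
      finally have 1: "\<bar>?A y - ?A (x + to_circle (real k * \<alpha>))\<bar> \<le> e / 2" .
      have "\<bar>?A (x + to_circle (real k * \<alpha>)) - ?A x\<bar> \<le> 2 * C * real k / real N"
        by (rule rot_average_shift_orbit[OF C(2)])
      also have "\<dots> \<le> 2 * C * real K / real N"
        using k C(1) by (intro divide_right_mono mult_left_mono) auto
      also have "\<dots> \<le> e / 2"
        using N' e by (simp add: field_simps)
      finally show ?thesis using 1 by linarith
    qed
    then have "\<bar>mean ?A - ?A x\<bar> \<le> e"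
      by (intro mean_near_const continuous_on_rot_average \<phi>)
    then show ?thesis
      by (simp add: mean_rot_average[OF \<phi> N'(1)] abs_minus_commute)
  qed
  then show ?thesis by (rule that)
qed

text \<open>
  Summation by parts: this exhibits \<open>\<phi>\<close> minus its average as a coboundary, with an explicit
  transfer function.
\<close>

lemma Cesaro_defect_telescopes:
  fixes b :: "nat \<Rightarrow> real"
  assumes "0 < N"
  shows "(\<Sum>j<N. (1 - real (Suc j) / real N) * (b j - b (Suc j))) = b 0 - (\<Sum>j<N. b j) / real N"
proof -
  have "(\<Sum>j<n. (real N - real (Suc j)) * (b j - b (Suc j))) =
      real N * b 0 - (\<Sum>j<n. b j) - (real N - real n) * b n" for n
    by (induction n) (simp_all add: algebra_simps)
  from this[of N] have *: "(\<Sum>j<N. (real N - real (Suc j)) * (b j - b (Suc j))) = real N * b 0 - (\<Sum>j<N. b j)"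
    by simp
  have "(\<Sum>j<N. (1 - real (Suc j) / real N) * (b j - b (Suc j))) =
      (\<Sum>j<N. (real N - real (Suc j)) * (b j - b (Suc j)) / real N)"
    using assms by (intro sum.cong) (auto simp: field_simps)
  also have "\<dots> = (real N * b 0 - (\<Sum>j<N. b j)) / real N"
    by (simp only: sum_divide_distrib[symmetric] *)
  finally show ?thesis using assms by (simp add: field_simps)
qed

lemma minus_rot_average_coboundary:
  fixes \<phi> :: "circle \<Rightarrow> real"
  assumes \<phi>: "continuous_on UNIV \<phi>" and "0 < N"
  obtains u where "continuous_on UNIV u"
    "\<And>x. \<phi> x - rot_average \<alpha> N \<phi> x = u x - u (x - to_circle \<alpha>)"
proof
  define u where "u x = (\<Sum>j<N. (1 - real (Suc j) / real N) * \<phi> (x - to_circle (real j * \<alpha>)))" for x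
  show "continuous_on UNIV u"
    unfolding u_def by (intro continuous_intros continuous_on_circle_shift \<phi>)
  fix x
  have step: "x - to_circle \<alpha> - to_circle (real j * \<alpha>) = x - to_circle (real (Suc j) * \<alpha>)" for j
    by (simp add: algebra_simps to_circle_add)
  have "u x - u (x - to_circle \<alpha>) = (\<Sum>j<N. (1 - real (Suc j) / real N) *
      (\<phi> (x - to_circle (real j * \<alpha>)) - \<phi> (x - to_circle (real (Suc j) * \<alpha>))))"
    unfolding u_def step by (simp add: sum_subtractf[symmetric] right_diff_distrib)
  also have "\<dots> = \<phi> x - rot_average \<alpha> N \<phi> x"
    using Cesaro_defect_telescopes[OF \<open>0 < N\<close>, of "\<lambda>j. \<phi> (x - to_circle (real j * \<alpha>))"] to_circle_of_int[of 0]
    by (simp add: rot_average_def)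
  finally show "\<phi> x - rot_average \<alpha> N \<phi> x = u x - u (x - to_circle \<alpha>)" by simp
qed

text \<open>
  Subtracting the average over the rotation leaves a coboundary, and the average is nearly constant.
\<close>

lemma approx_coboundary:
  fixes \<phi> :: "circle \<Rightarrow> real"
  assumes \<alpha>: "\<alpha> \<notin> \<rat>" and \<phi>: "continuous_on UNIV \<phi>" and e: "0 < e"
  obtains u where "continuous_on UNIV u"
    "\<And>x. \<bar>\<phi> x - mean \<phi> - (u x - u (x - to_circle \<alpha>))\<bar> \<le> e"
proof -
  obtain N0 where N0: "\<And>N x. N0 \<le> N \<Longrightarrow> \<bar>rot_average \<alpha> N \<phi> x - mean \<phi>\<bar> \<le> e"
    using rot_average_uniform[OF assms] by blast
  obtain u where u: "continuous_on UNIV u"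
    "\<And>x. \<phi> x - rot_average \<alpha> (Suc N0) \<phi> x = u x - u (x - to_circle \<alpha>)"
    using minus_rot_average_coboundary[OF \<phi>, of "Suc N0" \<alpha>] by auto
  have "\<bar>\<phi> x - mean \<phi> - (u x - u (x - to_circle \<alpha>))\<bar> \<le> e" for x
    using N0[of "Suc N0" x] u(2)[of x, symmetric] by simp
  with u(1) that show ?thesis by blast
qed

text \<open>
  The equation \<open>\<phi> = v + v \<circ> T\<^sup>-\<^sup>1\<close> has no mean value obstruction: a coboundary for \<open>T\<^sup>2\<close>, which is again
  an irrational rotation, has the form \<open>w + w \<circ> T\<^sup>-\<^sup>1\<close> with \<open>w = u - u \<circ> T\<^sup>-\<^sup>1\<close>, and constants have this
  form as well.
\<close>

lemma approx_anti_coboundary: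
  fixes \<phi> :: "circle \<Rightarrow> real"
  assumes \<alpha>: "\<alpha> \<notin> \<rat>" and \<phi>: "continuous_on UNIV \<phi>" and e: "0 < e"
  obtains v where "continuous_on UNIV v"
    "\<And>x. \<bar>\<phi> x - (v x + v (x - to_circle \<alpha>))\<bar> \<le> e"
proof -
  have "2 * \<alpha> \<notin> \<rat>"
  proof
    assume "2 * \<alpha> \<in> \<rat>"
    then have "2 * \<alpha> / 2 \<in> \<rat>" by (intro Rats_divide) auto
    with \<alpha> show False by simp
  qed
  then obtain u where u: "continuous_on UNIV u"
    "\<And>x. \<bar>\<phi> x - mean \<phi> - (u x - u (x - to_circle (2 * \<alpha>)))\<bar> \<le> e"
    using approx_coboundary[OF _ \<phi> e] by blast
  define v where "v x = u x - u (x - to_circle \<alpha>) + mean \<phi> / 2" for x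
  have "continuous_on UNIV v"
    unfolding v_def by (intro continuous_intros continuous_on_circle_shift u)
  moreover have "\<bar>\<phi> x - (v x + v (x - to_circle \<alpha>))\<bar> \<le> e" for x
  proof -
    have "x - to_circle \<alpha> - to_circle \<alpha> = x - to_circle (2 * \<alpha>)"
      using to_circle_add[of \<alpha> \<alpha>] by (simp add: algebra_simps)
    then have "u (x - to_circle \<alpha> - to_circle \<alpha>) = u (x - to_circle (2 * \<alpha>))"
      by (rule arg_cong)
    then have "v x + v (x - to_circle \<alpha>) = mean \<phi> + (u x - u (x - to_circle (2 * \<alpha>)))"
      unfolding v_def by linarith
    then show ?thesis using u(2)[of x] by (simp add: diff_diff_eq)
  qed
  ultimately show ?thesis by (rule that)
qed

section \<open>Absolute continuity and total variation\<close>

text \<open>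
  The inner clause of absolute continuity with \<open>\<epsilon>\<close> and \<open>\<delta>\<close> as parameters, so that the same \<open>\<delta>\<close> can
  be used for several families of intervals.
\<close>

definition ac_modulus :: "real set \<Rightarrow> (real \<Rightarrow> real) \<Rightarrow> real \<Rightarrow> real \<Rightarrow> bool" where
  "ac_modulus S g e d \<longleftrightarrow> (\<forall>n::nat. \<forall>a b :: nat \<Rightarrow> real.
        (\<forall>i<n. a i \<le> b i \<and> {a i..b i} \<subseteq> S) \<and>
        disjoint_family_on (\<lambda>i. {a i<..<b i}) {..<n} \<and>
        (\<Sum>i<n. b i - a i) < d \<longrightarrow>
        (\<Sum>i<n. \<bar>g (b i) - g (a i)\<bar>) < e)"

lemma absolutely_continuous_on_iff_ac_modulus:
  "absolutely_continuous_on S g \<longleftrightarrow> (\<forall>e>0. \<exists>d>0. ac_modulus S g e d)"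
  by (simp add: absolutely_continuous_on_def ac_modulus_def)

text \<open>
  Allowing an arbitrary finite index set saves renumbering for double families, such as the
  intervals of partitions of several intervals.
\<close>

lemma ac_modulusD:
  fixes I :: "'i set"
  assumes g: "ac_modulus S g e d" and I: "finite I"
    and le: "\<And>i. i \<in> I \<Longrightarrow> a i \<le> b i" and S: "\<And>i. i \<in> I \<Longrightarrow> {a i..b i} \<subseteq> S"
    and disj: "\<And>i j. i \<in> I \<Longrightarrow> j \<in> I \<Longrightarrow> i \<noteq> j \<Longrightarrow> {a i<..<b i} \<inter> {a j<..<b j} = {}"
    and d: "(\<Sum>i\<in>I. b i - a i) < d"
  shows "(\<Sum>i\<in>I. \<bar>g (b i) - g (a i)\<bar>) < e"
proof -
  obtain h where h: "bij_betw h {..<card I} I"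
    using ex_bij_betw_nat_finite[OF I] by (auto simp: atLeast0LessThan)
  have hI: "h i \<in> I" if "i < card I" for i
    using bij_betwE[OF h] that by blast
  have "(\<Sum>i<card I. \<bar>g (b (h i)) - g (a (h i))\<bar>) < e"
  proof (rule g[unfolded ac_modulus_def, rule_format], intro conjI allI impI)
    show "disjoint_family_on (\<lambda>i. {a (h i)<..<b (h i)}) {..<card I}"
      unfolding disjoint_family_on_def
      using disj hI bij_betw_imp_inj_on[OF h] by (metis inj_onD lessThan_iff)
    show "(\<Sum>i<card I. b (h i) - a (h i)) < d"
      using d sum.reindex_bij_betw[OF h, of "\<lambda>i. b i - a i"] by simp
  qed (use hI le S in auto)
  then show ?thesis
    using sum.reindex_bij_betw[OF h, of "\<lambda>i. \<bar>g (b i) - g (a i)\<bar>"] by simp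
qed

lemma absolutely_continuous_on_continuous:
  assumes "absolutely_continuous_on {0..1} g"
  shows "continuous_on {0..1} g"
  unfolding continuous_on_iff
proof (intro ballI allI impI)
  fix x e :: real assume x: "x \<in> {0..1}" and "0 < e"
  then obtain d where "0 < d" and d: "ac_modulus {0..1} g e d"
    using assms absolutely_continuous_on_iff_ac_modulus by blast
  have "dist (g y) (g x) < e" if y: "y \<in> {0..1}" "dist y x < d" for y
  proof -
    have "(\<Sum>i\<in>{()}. \<bar>g (max x y) - g (min x y)\<bar>) < e"
      by (rule ac_modulusD[OF d]) (use x y in \<open>auto simp: dist_real_def max_def min_def\<close>)
    then show ?thesis
      by (auto simp: dist_real_def max_def min_def abs_minus_commute split: if_splits)
  qed
  with \<open>0 < d\<close> show "\<exists>d>0. \<forall>y\<in>{0..1}. dist y x < d \<longrightarrow> dist (g y) (g x) < e" by blast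
qed

lemma absolutely_continuous_on_diff:
  assumes "absolutely_continuous_on S f" "absolutely_continuous_on S g"
  shows "absolutely_continuous_on S (\<lambda>x. f x - g x)"
  unfolding absolutely_continuous_on_iff_ac_modulus
proof (intro allI impI)
  fix e :: real assume "0 < e"
  then obtain d1 d2 where d: "0 < d1" "ac_modulus S f (e/2) d1" "0 < d2" "ac_modulus S g (e/2) d2"
    using assms unfolding absolutely_continuous_on_iff_ac_modulus by (meson half_gt_zero)
  have "ac_modulus S (\<lambda>x. f x - g x) e (min d1 d2)"
    unfolding ac_modulus_def
  proof (intro allI impI)
    fix n :: nat and a b :: "nat \<Rightarrow> real"
    assume *: "(\<forall>i<n. a i \<le> b i \<and> {a i..b i} \<subseteq> S) \<and> disjoint_family_on (\<lambda>i. {a i<..<b i}) {..<n} \<and>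
       (\<Sum>i<n. b i - a i) < min d1 d2"
    then have "(\<Sum>i<n. \<bar>f (b i) - f (a i)\<bar>) < e / 2" "(\<Sum>i<n. \<bar>g (b i) - g (a i)\<bar>) < e / 2"
      using d(2,4) unfolding ac_modulus_def by simp_all
    moreover have "(\<Sum>i<n. \<bar>f (b i) - g (b i) - (f (a i) - g (a i))\<bar>) \<le>
        (\<Sum>i<n. \<bar>f (b i) - f (a i)\<bar>) + (\<Sum>i<n. \<bar>g (b i) - g (a i)\<bar>)"
      unfolding sum.distrib[symmetric] by (rule sum_mono) linarith
    ultimately show "(\<Sum>i<n. \<bar>f (b i) - g (b i) - (f (a i) - g (a i))\<bar>) < e" by linarith
  qed
  with d show "\<exists>d>0. ac_modulus S (\<lambda>x. f x - g x) e d" by (metis min_less_iff_conj)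
qed

lemma Lipschitz_absolutely_continuous_on:
  assumes "\<And>x y. x \<in> S \<Longrightarrow> y \<in> S \<Longrightarrow> \<bar>g y - g x\<bar> \<le> L * \<bar>y - x\<bar>"
  shows "absolutely_continuous_on S g"
  unfolding absolutely_continuous_on_iff_ac_modulus
proof (intro allI impI)
  fix e :: real assume "0 < e"
  have "ac_modulus S g e (e / (\<bar>L\<bar> + 1))"
    unfolding ac_modulus_def
  proof (intro allI impI)
    fix n :: nat and a b :: "nat \<Rightarrow> real"
    assume *: "(\<forall>i<n. a i \<le> b i \<and> {a i..b i} \<subseteq> S) \<and> disjoint_family_on (\<lambda>i. {a i<..<b i}) {..<n} \<and>
       (\<Sum>i<n. b i - a i) < e / (\<bar>L\<bar> + 1)"
    have "(\<Sum>i<n. \<bar>g (b i) - g (a i)\<bar>) \<le> (\<Sum>i<n. (\<bar>L\<bar> + 1) * (b i - a i))"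
    proof (rule sum_mono)
      fix i assume i: "i \<in> {..<n}"
      then have "a i \<le> b i" "{a i..b i} \<subseteq> S" using * by auto
      then have "a i \<in> S" "b i \<in> S" by auto
      then have "\<bar>g (b i) - g (a i)\<bar> \<le> L * (b i - a i)"
        using assms[of "a i" "b i"] \<open>a i \<le> b i\<close> by simp
      also have "\<dots> \<le> (\<bar>L\<bar> + 1) * (b i - a i)"
        using \<open>a i \<le> b i\<close> by (intro mult_right_mono) auto
      finally show "\<bar>g (b i) - g (a i)\<bar> \<le> (\<bar>L\<bar> + 1) * (b i - a i)" .
    qed
    also have "\<dots> = (\<bar>L\<bar> + 1) * (\<Sum>i<n. b i - a i)" by (simp add: sum_distrib_left)
    also have "\<dots> < (\<bar>L\<bar> + 1) * (e / (\<bar>L\<bar> + 1))"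
      using * by (intro mult_strict_left_mono) auto
    finally show "(\<Sum>i<n. \<bar>g (b i) - g (a i)\<bar>) < e" by simp
  qed
  moreover have "0 < e / (\<bar>L\<bar> + 1)" using \<open>0 < e\<close> by simp
  ultimately show "\<exists>d>0. ac_modulus S g e d" by blast
qed

lemma variation_sumsI:
  assumes "\<And>i. i < n \<Longrightarrow> t i \<le> t (Suc i)" "\<And>i. i \<le> n \<Longrightarrow> u \<le> t i \<and> t i \<le> v"
  shows "(\<Sum>i<n. \<bar>g (t (Suc i)) - g (t i)\<bar>) \<in> variation_sums u v g"
  using assms unfolding variation_sums_def by blast

lemma variation_sumsE:
  assumes "s \<in> variation_sums u v g"
  obtains n t where "s = (\<Sum>i<n. \<bar>g (t (Suc i)) - g (t i)\<bar>)"
    "\<And>i. i < n \<Longrightarrow> t i \<le> t (Suc i)" "\<And>i. i \<le> n \<Longrightarrow> u \<le> t i \<and> t i \<le> v"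
  using assms unfolding variation_sums_def by blast

lemma variation_sums_nonempty: "u \<le> v \<Longrightarrow> variation_sums u v h \<noteq> {}"
  using abs_le_variation_sums[of u u v h] by auto

lemma variation_sums_subset:
  assumes "u' \<le> u" "v \<le> v'"
  shows "variation_sums u v g \<subseteq> variation_sums u' v' g"
proof
  fix s assume "s \<in> variation_sums u v g"
  then obtain n t where "s = (\<Sum>i<n. \<bar>g (t (Suc i)) - g (t i)\<bar>)"
    and t: "\<And>i. i < n \<Longrightarrow> t i \<le> t (Suc i)" "\<And>i. i \<le> n \<Longrightarrow> u \<le> t i \<and> t i \<le> v"
    by (rule variation_sumsE) blast
  moreover have "u' \<le> t i \<and> t i \<le> v'" if "i \<le> n" for i
    using t(2)[OF that] assms by simp
  ultimately show "s \<in> variation_sums u' v' g"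
    using variation_sumsI[of n t u' v' g, OF t(1)] by simp
qed

lemma variation_sums_append:
  assumes "s \<in> variation_sums u a g" "a \<le> b"
  shows "\<exists>s'\<in>variation_sums u b g. s + \<bar>g b - g a\<bar> \<le> s'"
proof -
  obtain n t where s: "s = (\<Sum>i<n. \<bar>g (t (Suc i)) - g (t i)\<bar>)"
    and t: "\<forall>i<n. t i \<le> t (Suc i)" "\<forall>i\<le>n. u \<le> t i \<and> t i \<le> a"
    using assms(1) unfolding variation_sums_def by blast
  define t' where "t' i = (if i \<le> n then t i else if i = Suc n then a else b)" for i
  have t': "\<forall>i<n. t' i = t i" "\<forall>i<n. t' (Suc i) = t (Suc i)" "t' n = t n" "t' (Suc n) = a" "t' (Suc (Suc n)) = b"
    by (auto simp: t'_def)
  have ua: "u \<le> a" using t(2)[rule_format, of n] by simp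
  have "(\<Sum>i<Suc (Suc n). \<bar>g (t' (Suc i)) - g (t' i)\<bar>) \<in> variation_sums u b g"
  proof (rule variation_sumsI)
    fix i assume "i < Suc (Suc n)"
    then consider "i < n" | "i = n" | "i = Suc n" by linarith
    then show "t' i \<le> t' (Suc i)"
      by cases (use t t' \<open>a \<le> b\<close> in auto)
  next
    fix i assume "i \<le> Suc (Suc n)"
    show "u \<le> t' i \<and> t' i \<le> b"
      using t(2) ua \<open>a \<le> b\<close> by (auto simp: t'_def intro: order_trans)
  qed
  moreover have "s + \<bar>g b - g a\<bar> \<le> (\<Sum>i<Suc (Suc n). \<bar>g (t' (Suc i)) - g (t' i)\<bar>)"
    using t' by (simp add: s)
  ultimately show ?thesis by blast
qed

text \<open>
  Insert \<open>b\<close> into the partition: \<open>min\<close> and \<open>max\<close> with \<open>b\<close> send the partition points to the left and to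
  the right part, and collapse the others.
\<close>

lemma variation_sums_split:
  assumes "s \<in> variation_sums u v g" "u \<le> b" "b \<le> v"
  shows "\<exists>s1\<in>variation_sums u b g. \<exists>s2\<in>variation_sums b v g. s \<le> s1 + s2"
proof -
  obtain n t where s: "s = (\<Sum>i<n. \<bar>g (t (Suc i)) - g (t i)\<bar>)"
    and t: "\<forall>i<n. t i \<le> t (Suc i)" "\<forall>i\<le>n. u \<le> t i \<and> t i \<le> v"
    using assms(1) unfolding variation_sums_def by blast
  have split: "g r = g (min r b) + g (max r b) - g b" for r
    by (simp add: min_def max_def)
  have "s \<le> (\<Sum>i<n. \<bar>g (min (t (Suc i)) b) - g (min (t i) b)\<bar>) +
      (\<Sum>i<n. \<bar>g (max (t (Suc i)) b) - g (max (t i) b)\<bar>)"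
    unfolding s sum.distrib[symmetric]
    by (rule sum_mono) (use split in \<open>smt (verit, best)\<close>)
  moreover have "(\<Sum>i<n. \<bar>g (min (t (Suc i)) b) - g (min (t i) b)\<bar>) \<in> variation_sums u b g"
    unfolding variation_sums_def
    by (rule CollectI, rule exI[of _ n], rule exI[of _ "\<lambda>i. min (t i) b"])
       (use t assms in \<open>auto simp: min_def intro: order_trans\<close>)
  moreover have "(\<Sum>i<n. \<bar>g (max (t (Suc i)) b) - g (max (t i) b)\<bar>) \<in> variation_sums b v g"
    unfolding variation_sums_def
    by (rule CollectI, rule exI[of _ n], rule exI[of _ "\<lambda>i. max (t i) b"])
       (use t assms in \<open>auto simp: max_def intro: order_trans\<close>)
  ultimately show ?thesis by blast
qed

lemma partition_mono:
  fixes t :: "nat \<Rightarrow> real"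
  assumes "\<forall>i<n. t i \<le> t (Suc i)" "i \<le> j" "j \<le> n"
  shows "t i \<le> t j"
  using assms(2,3)
proof (induction j rule: dec_induct)
  case (step k)
  then show ?case using assms(1)[rule_format, of k] by simp
qed simp

text \<open>
  The intervals of all the partitions together form one family of nonoverlapping intervals with
  the same total length at most, to which the modulus applies.
\<close>

lemma ac_modulus_variation_sums:
  assumes g: "ac_modulus {u..v} g e d"
    and ab: "\<And>i. i < n \<Longrightarrow> a i \<le> b i \<and> {a i..b i} \<subseteq> {u..v}"
    and disj: "\<And>i j. i < n \<Longrightarrow> j < n \<Longrightarrow> i \<noteq> j \<Longrightarrow> {a i<..<b i} \<inter> {a j<..<b j} = {}"
    and d: "(\<Sum>i<n. b i - a i) < d"
    and s: "\<And>i. i < n \<Longrightarrow> s i \<in> variation_sums (a i) (b i) g"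
  shows "(\<Sum>i<(n::nat). s i) < e"
proof -
  define Q where "Q i m t \<longleftrightarrow> s i = (\<Sum>k<m. \<bar>g (t (Suc k)) - g (t k)\<bar>) \<and>
      (\<forall>k<m. t k \<le> t (Suc k)) \<and> (\<forall>k\<le>m. a i \<le> t k \<and> t k \<le> b i)" for i m and t :: "nat \<Rightarrow> real"
  have "\<exists>p. i < n \<longrightarrow> Q i (fst p) (snd p)" for i
  proof (cases "i < n")
    case True
    from s[OF this] show ?thesis
      by (rule variation_sumsE) (auto simp: Q_def)
  qed simp
  then obtain p where p: "\<And>i. i < n \<Longrightarrow> Q i (fst (p i)) (snd (p i))" by metis
  define m t where "m i = fst (p i)" and "t i = snd (p i)" for i
  have mt: "s i = (\<Sum>k<m i. \<bar>g (t i (Suc k)) - g (t i k)\<bar>)" "\<forall>k<m i. t i k \<le> t i (Suc k)"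
    "k \<le> m i \<Longrightarrow> a i \<le> t i k \<and> t i k \<le> b i" if "i < n" for i k
    using p[OF that] by (auto simp: Q_def m_def t_def)
  let ?I = "Sigma {..<n} (\<lambda>i. {..<m i})"
  have "(\<Sum>(i, k)\<in>?I. \<bar>g (t i (Suc k)) - g (t i k)\<bar>) < e"
    unfolding case_prod_unfold
  proof (rule ac_modulusD[OF g])
    fix x assume "x \<in> ?I"
    then obtain i k where x: "x = (i, k)" "i < n" "k < m i" by auto
    then show "t (fst x) (snd x) \<le> t (fst x) (Suc (snd x))" using mt(2) by auto
    have "a i \<le> t i k" "t i (Suc k) \<le> b i" using mt(3)[OF x(2)] x(3) by auto
    then show "{t (fst x) (snd x)..t (fst x) (Suc (snd x))} \<subseteq> {u..v}"
      using ab[OF x(2)] x(1) by auto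
  next
    fix x y assume "x \<in> ?I" "y \<in> ?I" and "x \<noteq> y"
    then obtain i k j l where x: "x = (i, k)" "i < n" "k < m i" and y: "y = (j, l)" "j < n" "l < m j" by auto
    have sub: "{t i k<..<t i (Suc k)} \<subseteq> {a i<..<b i}" if "i < n" "k < m i" for i k
      using mt(3)[OF that(1), of k] mt(3)[OF that(1), of "Suc k"] that by auto
    have "{t i k<..<t i (Suc k)} \<inter> {t j l<..<t j (Suc l)} = {}"
    proof (cases "i = j")
      case False
      then show ?thesis using sub[OF x(2,3)] sub[OF y(2,3)] disj[OF x(2) y(2)] by blast
    next
      case True
      with \<open>x \<noteq> y\<close> x y consider "k < l" | "l < k" by force
      then show ?thesis
      proof cases
        case 1
        then have "t i (Suc k) \<le> t i l" using partition_mono[OF mt(2)[OF x(2)], of "Suc k" l] True y by simp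
        then show ?thesis using True by auto
      next
        case 2
        then have "t i (Suc l) \<le> t i k" using partition_mono[OF mt(2)[OF x(2)], of "Suc l" k] True x by simp
        then show ?thesis using True by auto
      qed
    qed
    then show "{t (fst x) (snd x)<..<t (fst x) (Suc (snd x))} \<inter> {t (fst y) (snd y)<..<t (fst y) (Suc (snd y))} = {}"
      using x y by simp
  next
    have "(\<Sum>x\<in>?I. t (fst x) (Suc (snd x)) - t (fst x) (snd x)) = (\<Sum>i<n. \<Sum>k<m i. t i (Suc k) - t i k)"
      by (subst sum.Sigma) (auto simp: case_prod_unfold)
    also have "\<dots> = (\<Sum>i<n. t i (m i) - t i 0)"
      by (simp add: sum_lessThan_telescope)
    also have "\<dots> \<le> (\<Sum>i<n. b i - a i)"
      using mt(3) by (intro sum_mono diff_mono) auto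
    finally show "(\<Sum>x\<in>?I. t (fst x) (Suc (snd x)) - t (fst x) (snd x)) < d" using d by simp
  qed auto
  also have "(\<Sum>(i, k)\<in>?I. \<bar>g (t i (Suc k)) - g (t i k)\<bar>) = (\<Sum>i<n. s i)"
    by (subst sum.Sigma[symmetric]) (auto simp: mt(1) intro!: sum.cong)
  finally show ?thesis .
qed

definition var_fun :: "(real \<Rightarrow> real) \<Rightarrow> real \<Rightarrow> real" where
  "var_fun g x = Sup (variation_sums 0 x g)"

context
  fixes g :: "real \<Rightarrow> real"
  assumes ac: "absolutely_continuous_on {0..1} g"
begin

lemma bdd_above_variation_sums_sub:
  assumes "0 \<le> u" "v \<le> 1"
  shows "bdd_above (variation_sums u v g)"
  using bdd_above_mono[OF bdd_above_variation_sums[OF ac] variation_sums_subset[OF assms]] .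

lemma abs_diff_le_var_fun:
  assumes "0 \<le> a" "a \<le> b" "b \<le> 1"
  shows "\<bar>g b - g a\<bar> \<le> var_fun g b - var_fun g a"
proof -
  have "var_fun g a \<le> var_fun g b - \<bar>g b - g a\<bar>"
    unfolding var_fun_def
  proof (rule cSup_least)
    show "variation_sums 0 a g \<noteq> {}" using assms by (intro variation_sums_nonempty)
    fix s assume "s \<in> variation_sums 0 a g"
    from variation_sums_append[OF this assms(2)] obtain s'
      where "s' \<in> variation_sums 0 b g" "s + \<bar>g b - g a\<bar> \<le> s'" by blast
    moreover from this(1) have "s' \<le> Sup (variation_sums 0 b g)"
      by (rule cSup_upper) (use bdd_above_variation_sums_sub assms in auto)
    ultimately show "s \<le> Sup (variation_sums 0 b g) - \<bar>g b - g a\<bar>" by simp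
  qed
  then show ?thesis by simp
qed

lemma var_fun_diff_le:
  assumes "0 \<le> a" "a \<le> b" "b \<le> 1"
  shows "var_fun g b - var_fun g a \<le> Sup (variation_sums a b g)"
proof -
  have "var_fun g b \<le> var_fun g a + Sup (variation_sums a b g)"
    unfolding var_fun_def
  proof (rule cSup_least)
    show "variation_sums 0 b g \<noteq> {}" using assms by (intro variation_sums_nonempty) auto
    fix s assume "s \<in> variation_sums 0 b g"
    from variation_sums_split[OF this assms(1,2)] obtain s1 s2
      where s: "s1 \<in> variation_sums 0 a g" "s2 \<in> variation_sums a b g" "s \<le> s1 + s2" by blast
    have "s1 \<le> Sup (variation_sums 0 a g)" "s2 \<le> Sup (variation_sums a b g)"
      using cSup_upper[OF s(1) bdd_above_variation_sums_sub] cSup_upper[OF s(2) bdd_above_variation_sums_sub]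
        assms by simp_all
    with s(3) show "s \<le> Sup (variation_sums 0 a g) + Sup (variation_sums a b g)" by simp
  qed
  then show ?thesis by simp
qed

text \<open>
  Makes \<open>g\<close> the difference of the monotone absolutely continuous functions \<open>var_fun g\<close> and
  \<open>var_fun g - g\<close>.
\<close>

lemma absolutely_continuous_on_var_fun: "absolutely_continuous_on {0..1} (var_fun g)"
  unfolding absolutely_continuous_on_iff_ac_modulus
proof (intro allI impI)
  fix e :: real assume "0 < e"
  then obtain d where "0 < d" and d: "ac_modulus {0..1} g (e / 2) d"
    using ac[unfolded absolutely_continuous_on_iff_ac_modulus, rule_format, of "e / 2"] by auto
  have "ac_modulus {0..1} (var_fun g) e d"
    unfolding ac_modulus_def
  proof (intro allI impI)
    fix n :: nat and a b :: "nat \<Rightarrow> real"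
    assume *: "(\<forall>i<n. a i \<le> b i \<and> {a i..b i} \<subseteq> {0..1}) \<and> disjoint_family_on (\<lambda>i. {a i<..<b i}) {..<n} \<and>
       (\<Sum>i<n. b i - a i) < d"
    then have ab: "0 \<le> a i" "a i \<le> b i" "b i \<le> 1" if "i < n" for i
      using that by auto
    \<comment> \<open>The suprema need not be attained; each of the \<open>n\<close> intervals may lose \<open>\<eta>\<close>.\<close>
    define \<eta> where "\<eta> = e / (2 * (real n + 1))"
    have \<eta>: "0 < \<eta>" "real n * \<eta> < e / 2" using \<open>0 < e\<close> by (auto simp: \<eta>_def field_simps)
    have ex_s: "\<exists>s. s \<in> variation_sums (a i) (b i) g \<and> \<bar>var_fun g (b i) - var_fun g (a i)\<bar> \<le> s + \<eta>" if i: "i < n" for i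
    proof -
      have "variation_sums (a i) (b i) g \<noteq> {}" using ab[OF i] by (intro variation_sums_nonempty)
      moreover have "Sup (variation_sums (a i) (b i) g) - \<eta> < Sup (variation_sums (a i) (b i) g)"
        using \<eta>(1) by simp
      ultimately obtain s where "s \<in> variation_sums (a i) (b i) g" "Sup (variation_sums (a i) (b i) g) - \<eta> < s"
        using less_cSupD by blast
      moreover have "\<bar>var_fun g (b i) - var_fun g (a i)\<bar> \<le> Sup (variation_sums (a i) (b i) g)"
        using var_fun_diff_le[OF ab[OF i]] abs_diff_le_var_fun[OF ab[OF i]] by simp
      ultimately show ?thesis by (intro exI[of _ s]) auto
    qed
    define s where "s i = (SOME s. s \<in> variation_sums (a i) (b i) g \<and>
      \<bar>var_fun g (b i) - var_fun g (a i)\<bar> \<le> s + \<eta>)" for i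
    have s: "s i \<in> variation_sums (a i) (b i) g" "\<bar>var_fun g (b i) - var_fun g (a i)\<bar> \<le> s i + \<eta>" if "i < n" for i
      using someI_ex[OF ex_s[OF that]] by (simp_all add: s_def)
    have "(\<Sum>i<n. \<bar>var_fun g (b i) - var_fun g (a i)\<bar>) \<le> (\<Sum>i<n. s i) + real n * \<eta>"
      using sum_mono[of "{..<n}" "\<lambda>i. \<bar>var_fun g (b i) - var_fun g (a i)\<bar>" "\<lambda>i. s i + \<eta>"] s(2)
      by (simp add: sum.distrib)
    moreover have "(\<Sum>i<n. s i) < e / 2"
      by (rule ac_modulus_variation_sums[OF d, of n a b]) (use * s(1) in \<open>auto simp: disjoint_family_on_def\<close>)
    ultimately show "(\<Sum>i<n. \<bar>var_fun g (b i) - var_fun g (a i)\<bar>) < e" using \<eta>(2) by linarith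
  qed
  with \<open>0 < d\<close> show "\<exists>d>0. ac_modulus {0..1} (var_fun g) e d" by blast
qed

end

section \<open>Densities of absolutely continuous functions\<close>

text \<open>
  A continuous monotone \<open>V\<close> is the distribution function of a measure. A Lebesgue null set is covered
  by countably many nonoverlapping intervals of small total length, so absolute continuity of
  \<open>V\<close> bounds its measure by any \<open>e > 0\<close>; hence the measure has a Radon-Nikodym density.
\<close>

lemma monotone_ac_density:
  assumes mono: "\<And>x y. 0 \<le> x \<Longrightarrow> x \<le> y \<Longrightarrow> y \<le> 1 \<Longrightarrow> V x \<le> V y"
    and ac: "absolutely_continuous_on {0..1} V"
  obtains g where "integrable lborel g"
    "\<And>x y. 0 \<le> x \<Longrightarrow> x \<le> y \<Longrightarrow> y \<le> 1 \<Longrightarrow> V y - V x = (LINT t:{x..y}|lborel. g t)"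
proof -
  \<comment> \<open>Constant continuation, as \<open>interval_measure\<close> expects a monotone function on the real line.\<close>
  define W where "W x = V (max 0 (min 1 x))" for x
  have W: "W x = V x" if "0 \<le> x" "x \<le> 1" for x using that by (simp add: W_def)
  have W_mono: "W x \<le> W y" if "x \<le> y" for x y
    unfolding W_def using that by (intro mono) auto
  have W_cont: "continuous_on UNIV W"
    unfolding W_def
    by (rule continuous_on_compose2[OF absolutely_continuous_on_continuous[OF ac]]) (auto intro!: continuous_intros)
  define M where "M = interval_measure W"
  have sets_M [measurable_cong]: "sets M = sets borel" by (simp add: M_def)
  have M_Icc: "emeasure M {x..y} = ennreal (W y - W x)" if "x \<le> y" for x y
    unfolding M_def using that W_mono W_cont by (rule emeasure_interval_measure_Icc)
  \<comment> \<open>Only the part of the measure on \<open>[0, 1]\<close> is related to \<open>V\<close>; outside, \<open>W\<close> is constant.\<close>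
  define M' where "M' = density M (indicator {0..1})"
  have M': "emeasure M' A = emeasure M ({0..1} \<inter> A)" if "A \<in> sets borel" for A
    unfolding M'_def using that by (subst emeasure_density) (auto simp: sets_M simp flip: indicator_inter_arith)
  have null: "emeasure M' N = 0" if N: "N \<in> null_sets lborel" for N
  proof -
    have N_sets: "N \<in> sets borel" using N by auto
    have "emeasure M ({0..1} \<inter> N) \<le> ennreal e" if "0 < e" for e
    proof -
      obtain d where "0 < d" and d: "ac_modulus {0..1} V e d"
        using ac \<open>0 < e\<close> unfolding absolutely_continuous_on_iff_ac_modulus by blast
      have neg: "negligible ({0..1} \<inter> N)"
        using null_sets_completionI[OF N] by (intro negligible_Int disjI2) (simp add: negligible_iff_null_sets)
      have lm: "{0..1} \<inter> N \<in> lmeasurable" using neg by (rule negligible_imp_measurable)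
      have sub: "{0..1} \<inter> N \<subseteq> cbox 0 1" by (auto simp: cbox_interval)
      obtain \<D> where \<D>: "countable \<D>" "\<And>K. K \<in> \<D> \<Longrightarrow> K \<subseteq> cbox 0 1 \<and> K \<noteq> {} \<and> (\<exists>c d. K = cbox c d)"
        "pairwise (\<lambda>A B. interior A \<inter> interior B = {}) \<D>" "{0..1} \<inter> N \<subseteq> \<Union>\<D>" "\<Union>\<D> \<in> lmeasurable"
        "measure lebesgue (\<Union>\<D>) \<le> measure lebesgue ({0..1} \<inter> N) + d / 2"
      proof (rule measurable_outer_intervals_bounded[OF lm sub half_gt_zero[OF \<open>0 < d\<close>]])
        fix \<D> :: "real set set"
        assume 1: "countable \<D>" and 2: "\<And>K. K \<in> \<D> \<Longrightarrow> K \<subseteq> cbox 0 1 \<and> K \<noteq> {} \<and> (\<exists>c d. K = cbox c d)"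
          and 3: "pairwise (\<lambda>A B. interior A \<inter> interior B = {}) \<D>" and 4: "{0..1} \<inter> N \<subseteq> \<Union>\<D>"
          and 5: "\<Union>\<D> \<in> lmeasurable" and 6: "measure lebesgue (\<Union>\<D>) \<le> measure lebesgue ({0..1} \<inter> N) + d / 2"
        show thesis by (rule that[OF 1 2 3 4 5 6])
      qed
      have K: "K = {Inf K..Sup K} \<and> Inf K \<le> Sup K \<and> 0 \<le> Inf K \<and> Sup K \<le> 1" if KD: "K \<in> \<D>" for K
      proof -
        obtain c d where "K = {c..d}" "K \<noteq> {}" "K \<subseteq> {0..1}"
          using \<D>(2)[OF KD] unfolding cbox_interval by blast
        then show ?thesis by simp
      qed
      have K_sets: "K \<in> sets borel" "K \<in> lmeasurable" "measure lebesgue K = Sup K - Inf K"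
        "interior K = {Inf K<..<Sup K}" "convex K" if KD: "K \<in> \<D>" for K
      proof -
        obtain c d where "K = {c..d}" "c \<le> d" using K[OF KD] by blast
        then show "K \<in> sets borel" "K \<in> lmeasurable" "measure lebesgue K = Sup K - Inf K"
          "interior K = {Inf K<..<Sup K}" "convex K"
          by (simp_all add: measure_completion)
      qed
      have disj: "interior S \<inter> interior T = {}" if "S \<in> \<D>" "T \<in> \<D>" "S \<noteq> T" for S T
        using pairwiseD[OF \<D>(3)] that by blast
      have fin: "emeasure M (\<Union>F) \<le> ennreal e" if F: "finite F" "F \<subseteq> \<D>" for F
      proof -
        have FD: "K \<in> \<D>" if "K \<in> F" for K using F that by blast
        have "measure lebesgue (\<Union>F) = (\<Sum>K\<in>F. measure lebesgue K)"
        proof (rule measure_negligible_finite_Union[OF F(1) K_sets(2)[OF FD]])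
          show "pairwise (\<lambda>S T. negligible (S \<inter> T)) F"
          proof (rule pairwiseI)
            fix S T assume "S \<in> F" "T \<in> F" "S \<noteq> T"
            then show "negligible (S \<inter> T)"
              using disj[of S T] K_sets(5)[of S] K_sets(5)[of T] FD
              by (simp add: negligible_convex_interior convex_Int)
          qed
        qed
        moreover have "measure lebesgue (\<Union>F) \<le> measure lebesgue (\<Union>\<D>)"
        proof (rule measure_mono_fmeasurable[OF Union_mono[OF F(2)] _ \<D>(5)])
          show "\<Union>F \<in> sets lebesgue"
            using F(1) K_sets(2)[OF FD] by (intro sets.finite_Union) (auto intro: fmeasurableD)
        qed
        moreover have "measure lebesgue ({0..1} \<inter> N) = 0" using neg by (rule negligible_imp_measure0)
        ultimately have "(\<Sum>K\<in>F. measure lebesgue K) < d"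
          using \<D>(6) \<open>0 < d\<close> by simp
        then have "(\<Sum>K\<in>F. Sup K - Inf K) < d"
          using K_sets(3)[OF FD] by simp
        then have lt: "(\<Sum>K\<in>F. \<bar>V (Sup K) - V (Inf K)\<bar>) < e"
        proof (rule ac_modulusD[OF d F(1), rotated 3])
          fix S assume S: "S \<in> F"
          show "Inf S \<le> Sup S" using K[OF FD[OF S]] by blast
          have "0 \<le> Inf S" "Sup S \<le> 1" using K[OF FD[OF S]] by blast+
          then show "{Inf S..Sup S} \<subseteq> {0..1}" by auto
          fix T assume T: "T \<in> F" "S \<noteq> T"
          show "{Inf S<..<Sup S} \<inter> {Inf T<..<Sup T} = {}"
            using disj[OF FD[OF S] FD[OF T(1)] T(2)] K_sets(4)[OF FD[OF S]] K_sets(4)[OF FD[OF T(1)]] by simp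
        qed
        have "emeasure M (\<Union>F) \<le> (\<Sum>K\<in>F. emeasure M K)"
          using emeasure_subadditive_finite[OF F(1), of "\<lambda>K. K" M] K_sets(1)[OF FD] by (simp add: sets_M subset_iff)
        also have "\<dots> = (\<Sum>K\<in>F. ennreal \<bar>V (Sup K) - V (Inf K)\<bar>)"
        proof (rule sum.cong[OF refl])
          fix K' assume "K' \<in> F"
          from K[OF FD[OF this]] have eq: "K' = {Inf K'..Sup K'}" and le: "Inf K' \<le> Sup K'" "0 \<le> Inf K'" "Sup K' \<le> 1"
            by blast+
          have "emeasure M K' = emeasure M {Inf K'..Sup K'}" by (rule arg_cong[OF eq])
          also have "\<dots> = ennreal \<bar>V (Sup K') - V (Inf K')\<bar>"
            using le mono[OF le(2,1,3)] by (simp add: M_Icc W)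
          finally show "emeasure M K' = ennreal \<bar>V (Sup K') - V (Inf K')\<bar>" .
        qed
        also have "\<dots> = ennreal (\<Sum>K\<in>F. \<bar>V (Sup K) - V (Inf K)\<bar>)"
          by (rule sum_ennreal) simp
        also have "\<dots> \<le> ennreal e"
          using lt by (intro ennreal_leI less_imp_le)
        finally show ?thesis .
      qed
      have "emeasure M (\<Union>\<D>) \<le> ennreal e"
      proof (cases "\<D> = {}")
        case False
        let ?K = "from_nat_into \<D>"
        have KD: "?K n \<in> \<D>" for n using from_nat_into[OF False] .
        have "\<Union>\<D> = (\<Union>n. \<Union>i\<in>{..<n}. ?K i)"
        proof -
          have "\<Union>\<D> = (\<Union>n. ?K n)" by (simp add: range_from_nat_into[OF False \<D>(1)])
          then show ?thesis by blast
        qed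
        also have "emeasure M \<dots> = (SUP n. emeasure M (\<Union>i\<in>{..<n}. ?K i))"
        proof (rule SUP_emeasure_incseq[symmetric])
          show "incseq (\<lambda>n. \<Union>i\<in>{..<n}. ?K i)" unfolding incseq_def by (intro allI impI UN_mono) auto
          have "(\<Union>i\<in>{..<n}. ?K i) \<in> sets M" for n
            unfolding sets_M by (intro sets.finite_UN K_sets(1) KD) simp
          then show "range (\<lambda>n. \<Union>i\<in>{..<n}. ?K i) \<subseteq> sets M" by blast
        qed
        also have "\<dots> \<le> ennreal e"
        proof (rule SUP_least)
          fix n show "emeasure M (\<Union>i\<in>{..<n}. ?K i) \<le> ennreal e"
            by (rule fin) (use KD in auto)
        qed
        finally show ?thesis .
      qed simp
      moreover have "emeasure M ({0..1} \<inter> N) \<le> emeasure M (\<Union>\<D>)"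
        unfolding sets_M by (rule emeasure_mono[OF \<D>(4)])
          (unfold sets_M, rule sets.countable_Union, use K_sets(1) \<D>(1) in auto)
      ultimately show ?thesis by (rule order_trans[rotated])
    qed
    then have "emeasure M ({0..1} \<inter> N) \<le> 0 + ennreal e" if "0 < e" for e
      using that by simp
    then have "emeasure M ({0..1} \<inter> N) \<le> 0"
      by (rule ennreal_le_epsilon)
    then show ?thesis using M'[OF N_sets] by simp
  qed
  have sets_M': "sets M' = sets lborel" by (simp add: M'_def sets_M)
  have "absolutely_continuous lborel M'"
    unfolding absolutely_continuous_def
  proof
    fix N :: "real set" assume N: "N \<in> null_sets lborel"
    then have "N \<in> sets M'" unfolding sets_M' by (rule null_setsD2)
    with null[OF N] show "N \<in> null_sets M'" by (rule null_setsI)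
  qed
  from sigma_finite_measure.Radon_Nikodym[OF sigma_finite_lborel this sets_M'] obtain g' where
    g' [measurable]: "g' \<in> borel_measurable lborel" and dens: "density lborel g' = M'" by blast
  have int_g': "(\<integral>\<^sup>+t. g' t * indicator {x..y} t \<partial>lborel) = ennreal (V y - V x)" if "0 \<le> x" "x \<le> y" "y \<le> 1" for x y
  proof -
    have "(\<integral>\<^sup>+t. g' t * indicator {x..y} t \<partial>lborel) = emeasure M' {x..y}"
      by (subst dens[symmetric], subst emeasure_density) auto
    also have "{0..1} \<inter> {x..y} = {x..y}" using that by auto
    then have "emeasure M' {x..y} = ennreal (V y - V x)"
      using that by (simp add: M' M_Icc W)
    finally show ?thesis .
  qed
  define g where "g t = indicator {0..1} t * enn2real (g' t)" for t
  have g [measurable]: "g \<in> borel_measurable lborel" and g0: "0 \<le> g t" for t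
    unfolding g_def by (auto split: split_indicator)
  have "(\<integral>\<^sup>+t. g' t * indicator {0..1} t \<partial>lborel) \<noteq> \<infinity>"
    by (subst int_g') auto
  then have "AE t in lborel. g' t * indicator {0..1} t \<noteq> \<infinity>"
    by (intro nn_integral_PInf_AE) auto
  then have g_eq: "AE t in lborel. ennreal (g t * indicator {x..y} t) = g' t * indicator {x..y} t"
    if "0 \<le> x" "y \<le> 1" for x y
    by eventually_elim (use that in \<open>auto simp: g_def less_top split: split_indicator\<close>)
  have nn: "(\<integral>\<^sup>+t. ennreal (g t * indicator {x..y} t) \<partial>lborel) = ennreal (V y - V x)" if "0 \<le> x" "x \<le> y" "y \<le> 1" for x y
    using nn_integral_cong_AE[OF g_eq[of x y]] int_g'[OF that] that by simp
  have g_supp: "g t * indicator {0..1} t = g t" for t by (auto simp: g_def split: split_indicator)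
  have "(\<integral>\<^sup>+t. ennreal (g t) \<partial>lborel) = ennreal (V 1 - V 0)"
    using nn[of 0 1] unfolding g_supp by simp
  then have "integrable lborel g"
    using g0 by (intro integrableI_nonneg) auto
  moreover have "V y - V x = (LINT t:{x..y}|lborel. g t)" if "0 \<le> x" "x \<le> y" "y \<le> 1" for x y
  proof -
    have "(LINT t:{x..y}|lborel. g t) = (\<integral>t. g t * indicator {x..y} t \<partial>lborel)"
      by (simp add: set_lebesgue_integral_def mult.commute)
    also have "\<dots> = enn2real (\<integral>\<^sup>+t. ennreal (g t * indicator {x..y} t) \<partial>lborel)"
      by (rule integral_eq_nn_integral) (auto simp: g0)
    also have "\<dots> = V y - V x" using nn[OF that] mono[OF that] by simp
    finally show ?thesis by simp
  qed
  ultimately show ?thesis by (rule that)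
qed

text \<open>
  The fundamental theorem of calculus for Lebesgue integrals, with the density in place of the
  derivative almost everywhere.
\<close>

lemma ac_density:
  assumes ac: "absolutely_continuous_on {0..1} F"
  obtains g where "integrable lborel g"
    "\<And>x y. 0 \<le> x \<Longrightarrow> x \<le> y \<Longrightarrow> y \<le> 1 \<Longrightarrow> F y - F x = (LINT t:{x..y}|lborel. g t)"
proof -
  note V = absolutely_continuous_on_var_fun[OF ac] and le = abs_diff_le_var_fun[OF ac]
  have "var_fun F x \<le> var_fun F y" if "0 \<le> x" "x \<le> y" "y \<le> 1" for x y
    using le[OF that] by linarith
  from monotone_ac_density[OF this V] obtain g1 where g1: "integrable lborel g1"
    "\<And>x y. 0 \<le> x \<Longrightarrow> x \<le> y \<Longrightarrow> y \<le> 1 \<Longrightarrow> var_fun F y - var_fun F x = (LINT t:{x..y}|lborel. g1 t)"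
    by blast
  have "var_fun F x - F x \<le> var_fun F y - F y" if "0 \<le> x" "x \<le> y" "y \<le> 1" for x y
    using le[OF that] by linarith
  from monotone_ac_density[OF this absolutely_continuous_on_diff[OF V ac]] obtain g2 where g2: "integrable lborel g2"
    "\<And>x y. 0 \<le> x \<Longrightarrow> x \<le> y \<Longrightarrow> y \<le> 1 \<Longrightarrow>
      (var_fun F y - F y) - (var_fun F x - F x) = (LINT t:{x..y}|lborel. g2 t)"
    by blast
  have si: "set_integrable lborel {x..y} g1" "set_integrable lborel {x..y} g2" for x y
    unfolding set_integrable_def by (intro integrable_mult_indicator g1(1) g2(1); simp)+
  have "F y - F x = (LINT t:{x..y}|lborel. g1 t - g2 t)" if "0 \<le> x" "x \<le> y" "y \<le> 1" for x y
    unfolding set_integral_diff(2)[OF si] using g1(2)[OF that] g2(2)[OF that] by linarith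
  with g1(1) g2(1) show ?thesis by (intro that[of "\<lambda>t. g1 t - g2 t"]) auto
qed

text \<open>
  A measurable function is almost everywhere a pointwise limit of continuous functions. Truncation
  at \<open>\<plusminus>K\<close> provides the dominating constant for passing to the limit in mean, and the cutoff
  makes the approximating functions vanish at the ends of \<open>[0, 1]\<close>, so that they extend
  continuously to the circle.
\<close>

lemma L1_approx_continuous:
  fixes g :: "real \<Rightarrow> real"
  assumes g: "integrable lborel g" and e: "0 < e"
  obtains h where "continuous_on UNIV h" "\<And>x. x \<notin> {0<..<1} \<Longrightarrow> h x = 0"
    "(LINT t:{0..1}|lborel. \<bar>g t - h t\<bar>) < e"
proof -
  have [measurable]: "g \<in> borel_measurable borel" using g by auto
  define clip where "clip K t = max (- real K) (min (real K) t)" for K :: nat and t :: real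
  have clip_cont: "continuous_on UNIV (clip K)" for K
    unfolding clip_def by (intro continuous_intros)
  have clip_bound: "\<bar>clip K t\<bar> \<le> real K" for K t unfolding clip_def by auto
  have [measurable]: "clip K \<in> borel_measurable borel" for K
    using clip_cont by (rule borel_measurable_continuous_onI)
  have "(\<lambda>K. LINT t:{0..1}|lborel. \<bar>g t - clip K (g t)\<bar>) \<longlonglongrightarrow> (LINT t:{0..1::real}|lborel. (0::real))"
    unfolding set_lebesgue_integral_def
  proof (rule integral_dominated_convergence[where w = "\<lambda>t. \<bar>g t\<bar>"])
    show "integrable lborel (\<lambda>t. \<bar>g t\<bar>)" using g by simp
    show "AE t in lborel. (\<lambda>K. indicator {0..1} t *\<^sub>R \<bar>g t - clip K (g t)\<bar>) \<longlonglongrightarrow> indicator {0..1} t *\<^sub>R 0"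
    proof (rule AE_I2)
      fix t
      obtain K0 :: nat where "\<bar>g t\<bar> \<le> real K0" using real_arch_simple by blast
      then have "\<forall>K\<ge>K0. clip K (g t) = g t" by (auto simp: clip_def max_def min_def)
      then have "eventually (\<lambda>K. indicator {0..1} t *\<^sub>R \<bar>g t - clip K (g t)\<bar> = indicator {0..1} t *\<^sub>R 0) sequentially"
        unfolding eventually_sequentially by (intro exI[of _ K0]) auto
      then show "(\<lambda>K. indicator {0..1} t *\<^sub>R \<bar>g t - clip K (g t)\<bar>) \<longlonglongrightarrow> indicator {0..1} t *\<^sub>R 0"
        by (rule tendsto_eventually)
    qed
    show "AE t in lborel. norm (indicator {0..1} t *\<^sub>R \<bar>g t - clip K (g t)\<bar>) \<le> \<bar>g t\<bar>" for K
      by (rule AE_I2) (auto simp: clip_def max_def min_def split: split_indicator)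
  qed auto
  from order_tendstoD(2)[OF this, of "e / 2"] e obtain K where
    K: "(LINT t:{0..1}|lborel. \<bar>g t - clip K (g t)\<bar>) < e / 2"
    by (auto simp: eventually_sequentially set_lebesgue_integral_def)
  have "g \<in> borel_measurable lebesgue" by (intro measurable_completion) simp
  then have "g measurable_on UNIV" by (intro lebesgue_measurable_imp_measurable_on_real) auto
  then obtain N G where N: "negligible N" and G: "\<And>n. continuous_on UNIV (G n)"
    "\<And>x. x \<notin> N \<Longrightarrow> (\<lambda>n. G n x) \<longlonglongrightarrow> g x"
    unfolding measurable_on_def by auto
  define cut where "cut n t = max 0 (min 1 (real n * (t * (1 - t))))" for n :: nat and t :: real
  have cut_cont: "continuous_on UNIV (cut n)" for n
    unfolding cut_def by (intro continuous_intros)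
  have cut_0: "cut n t = 0" if "t \<notin> {0<..<1}" for n t
  proof -
    have "t * (1 - t) \<le> 0" using that by (auto simp: mult_le_0_iff)
    then have "real n * (t * (1 - t)) \<le> 0" by (simp add: mult_nonneg_nonpos)
    then show ?thesis by (simp add: cut_def)
  qed
  have cut_lim: "(\<lambda>n. cut n t) \<longlonglongrightarrow> 1" if "t \<in> {0<..<1}" for t
  proof -
    have "0 < t * (1 - t)" using that by simp
    then obtain n0 :: nat where "1 < real n0 * (t * (1 - t))" using reals_Archimedean3 by blast
    moreover have "real n0 * (t * (1 - t)) \<le> real n * (t * (1 - t))" if "n0 \<le> n" for n
      using that \<open>0 < t * (1 - t)\<close> by (intro mult_right_mono) auto
    ultimately have "cut n t = 1" if "n0 \<le> n" for n
      using that by (fastforce simp: cut_def)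
    then show ?thesis by (intro tendsto_eventually) (auto simp: eventually_sequentially)
  qed
  define h where "h n t = cut n t * clip K (G n t)" for n t
  have h_cont: "continuous_on UNIV (h n)" for n
    unfolding h_def
    by (intro continuous_on_mult cut_cont continuous_on_compose2[OF clip_cont G(1)]) auto
  then have [measurable]: "h n \<in> borel_measurable borel" for n
    by (rule borel_measurable_continuous_onI)
  have h_bound: "\<bar>h n t\<bar> \<le> real K" for n t
    unfolding h_def abs_mult using clip_bound[of K "G n t"]
    by (intro order_trans[OF mult_left_le_one_le]) (auto simp: cut_def)
  have AE_N: "AE t in lborel. t \<notin> N"
    using N AE_completion_iff[of "\<lambda>t. t \<notin> N" lborel] by (simp add: negligible_iff_null_sets AE_not_in)
  have "(\<lambda>n. LINT t:{0..1}|lborel. \<bar>clip K (g t) - h n t\<bar>) \<longlonglongrightarrow> (LINT t:{0..1::real}|lborel. (0::real))"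
    unfolding set_lebesgue_integral_def
  proof (rule integral_dominated_convergence[where w = "\<lambda>t. indicator {0..1} t * (2 * real K)"])
    show "integrable lborel (\<lambda>t::real. indicator {0..1} t * (2 * real K))" by simp
    show "AE t in lborel. (\<lambda>n. indicator {0..1} t *\<^sub>R \<bar>clip K (g t) - h n t\<bar>) \<longlonglongrightarrow> indicator {0..1} t *\<^sub>R 0"
      using AE_N AE_lborel_singleton[of 0] AE_lborel_singleton[of 1]
    proof eventually_elim
      case (elim t)
      show ?case
      proof (cases "t \<in> {0<..<1}")
        case True
        have "isCont (clip K) (g t)" using clip_cont by (simp add: continuous_on_eq_continuous_at)
        then have "(\<lambda>n. clip K (G n t)) \<longlonglongrightarrow> clip K (g t)"
          by (rule isCont_tendsto_compose) (rule G(2)[OF elim(1)])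
        from tendsto_mult[OF cut_lim[OF True] this] have "(\<lambda>n. h n t) \<longlonglongrightarrow> clip K (g t)"
          by (simp add: h_def)
        then have "(\<lambda>n. \<bar>clip K (g t) - h n t\<bar>) \<longlonglongrightarrow> \<bar>clip K (g t) - clip K (g t)\<bar>"
          by (intro tendsto_intros)
        then show ?thesis by (intro tendsto_scaleR tendsto_const) simp
      next
        case False
        with elim have "t \<notin> {0..1}" by auto
        then show ?thesis by simp
      qed
    qed
    show "AE t in lborel. norm (indicator {0..1} t *\<^sub>R \<bar>clip K (g t) - h n t\<bar>) \<le> indicator {0..1} t * (2 * real K)" for n
    proof (rule AE_I2)
      fix t show "norm (indicator {0..1} t *\<^sub>R \<bar>clip K (g t) - h n t\<bar>) \<le> indicator {0..1} t * (2 * real K)"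
        using clip_bound[of K "g t"] h_bound[of n t] by (auto split: split_indicator)
    qed
  qed auto
  from order_tendstoD(2)[OF this, of "e / 2"] e obtain n where
    n: "(LINT t:{0..1}|lborel. \<bar>clip K (g t) - h n t\<bar>) < e / 2"
    by (auto simp: eventually_sequentially set_lebesgue_integral_def)
  have bdd: "set_integrable lborel {0..1} k" if [measurable]: "k \<in> borel_measurable borel"
    and "\<And>t. \<bar>k t\<bar> \<le> C" for k :: "real \<Rightarrow> real" and C
    unfolding set_integrable_def
    by (rule integrableI_bounded_set[where A = "{0..1}" and B = C]) (use that(2) in \<open>auto split: split_indicator\<close>)
  have si: "set_integrable lborel {0..1} g" "set_integrable lborel {0..1} (\<lambda>t. clip K (g t))"
    "set_integrable lborel {0..1} (h n)"
    using integrable_mult_indicator[OF _ g, of "{0..1}"] bdd[of "\<lambda>t. clip K (g t)" "real K"]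
      bdd[of "h n" "real K"] clip_bound h_bound
    by (simp_all add: set_integrable_def)
  have "(LINT t:{0..1}|lborel. \<bar>g t - h n t\<bar>) \<le>
      (LINT t:{0..1}|lborel. \<bar>g t - clip K (g t)\<bar> + \<bar>clip K (g t) - h n t\<bar>)"
    by (intro set_integral_mono set_integral_add set_integrable_abs set_integral_diff si) auto
  also have "\<dots> = (LINT t:{0..1}|lborel. \<bar>g t - clip K (g t)\<bar>) + (LINT t:{0..1}|lborel. \<bar>clip K (g t) - h n t\<bar>)"
    by (intro set_integral_add set_integrable_abs set_integral_diff si)
  finally have "(LINT t:{0..1}|lborel. \<bar>g t - h n t\<bar>) < e" using K n by linarith
  with h_cont cut_0 show ?thesis by (intro that[of "h n"]) (auto simp: h_def)
qed

section \<open>Smooth approximation in the bounded variation norm\<close>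

text \<open>
  \<open>H\<close> is the primitive of a continuous approximation of the density of \<open>f\<close>. The variation of \<open>f - H\<close>
  is at most the integral of the absolute value of the difference of the densities.
\<close>

lemma abs_cont_circle_smooth_approx:
  fixes f :: "circle \<Rightarrow> real"
  assumes f: "abs_cont_circle f" and e: "0 < e"
  obtains H h :: "circle \<Rightarrow> real" where "continuous_on UNIV h" "mean h = 0"
    "\<And>x. ((\<lambda>x. H (to_circle x)) has_real_derivative h (to_circle x)) (at x)"
    "\<And>x. \<bar>f x - H x\<bar> \<le> e"
    "\<And>s. s \<in> variation_sums 0 1 ((\<lambda>x. f x - H x) \<circ> to_circle) \<Longrightarrow> s \<le> e"
proof -
  define F where "F = f \<circ> to_circle"
  have F01: "F 1 = F 0" using to_circle_of_int[of 1] to_circle_of_int[of 0] by (simp add: F_def)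
  have "absolutely_continuous_on {0..1} F" using f by (simp add: abs_cont_circle_def F_def)
  then obtain g where g: "integrable lborel g"
    "\<And>x y. 0 \<le> x \<Longrightarrow> x \<le> y \<Longrightarrow> y \<le> 1 \<Longrightarrow> F y - F x = (LINT t:{x..y}|lborel. g t)"
    using ac_density by blast
  obtain h0 where h0: "continuous_on UNIV h0" "\<And>x. x \<notin> {0<..<1} \<Longrightarrow> h0 x = 0"
    "(LINT t:{0..1}|lborel. \<bar>g t - h0 t\<bar>) < e / 2"
    using L1_approx_continuous[OF g(1), of "e / 2"] e by auto
  define hc where "hc = periodization h0"
  have hc: "continuous_on UNIV hc"
    unfolding hc_def by (rule continuous_on_periodization) (use h0 in \<open>auto intro: continuous_on_subset\<close>)
  have hc_eq: "hc (to_circle t) = h0 t" if "0 \<le> t" "t \<le> 1" for t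
  proof (cases "t = 1")
    case True
    then show ?thesis using h0(2)[of 0] h0(2)[of 1] by (simp add: hc_def periodization_to_circle frac_def)
  next
    case False
    with that have "frac t = t" by (simp add: frac_eq)
    then show ?thesis by (simp add: hc_def periodization_to_circle)
  qed
  \<comment> \<open>The mean of \<open>hc\<close> is small, since the density of the periodic function \<open>f\<close> has mean zero.\<close>
  define \<mu> where "\<mu> = mean hc"
  define h where "h x = hc x - \<mu>" for x
  have h: "continuous_on UNIV h" unfolding h_def by (intro continuous_intros hc)
  have mean_h: "mean h = 0"
    unfolding h_def \<mu>_def using mean_diff[OF hc continuous_on_const] by (simp add: mean_const)
  obtain A where A: "\<And>x. (A has_real_derivative h (to_circle x)) (at x)" "\<And>x. A (x + 1) = A x"
    using circle_antiderivative[OF h] mean_h by auto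
  have A_int: "A (x + of_int k) = A x" for x k
  proof (induction k rule: int_induct[where k = 0])
    case (step1 i)
    have "A (x + of_int (i + 1)) = A ((x + of_int i) + 1)" by (simp add: add.assoc)
    then show ?case using A(2) step1 by simp
  next
    case (step2 i)
    have "A ((x + of_int (i - 1)) + 1) = A (x + of_int (i - 1))" by (rule A(2))
    moreover have "(x + of_int (i - 1)) + 1 = x + of_int i" by simp
    ultimately show ?case using step2 by (simp only:)
  qed simp
  define H where "H x = periodization A x - A 0 + f 0" for x
  have H_eq: "H (to_circle x) = A x - A 0 + f 0" for x
    using A_int[of "frac x" "\<lfloor>x\<rfloor>"] by (simp add: H_def periodization_to_circle frac_def)
  have deriv: "((\<lambda>x. H (to_circle x)) has_real_derivative h (to_circle x)) (at x)" for x
    unfolding H_eq by (auto intro!: derivative_eq_intros A(1))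
  have si_h: "set_integrable lborel {x..y} h0" for x y
    using h0(1) by (intro borel_integrable_atLeastAtMost') (auto intro: continuous_on_subset)
  have si_g: "set_integrable lborel {x..y} g" for x y
    unfolding set_integrable_def by (intro integrable_mult_indicator g(1)) simp
  have si_c: "set_integrable lborel {x..y} (\<lambda>_. c)" for x y c :: real
    by (intro borel_integrable_atLeastAtMost') (auto intro: continuous_intros)
  have A_diff: "A y - A x = (LINT t:{x..y}|lborel. h0 t - \<mu>)" if "0 \<le> x" "x \<le> y" "y \<le> 1" for x y
  proof -
    have "continuous_on {x..y} (\<lambda>t. h (to_circle t))"
      using h continuous_on_circle_iff continuous_on_subset by blast
    then have "A y - A x = (LINT t:{x..y}|lborel. h (to_circle t))"
      unfolding set_lebesgue_integral_def using that A(1)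
      by (intro integral_FTC_Icc[symmetric])
         (auto simp: has_real_derivative_iff_has_vector_derivative[symmetric] has_field_derivative_at_within)
    also have "\<dots> = (LINT t:{x..y}|lborel. h0 t - \<mu>)"
      by (intro set_lebesgue_integral_cong) (use that in \<open>auto simp: h_def hc_eq\<close>)
    finally show ?thesis .
  qed
  have Leb_one: "(LINT t:{0..1::real}|lborel. c) = c" for c :: real
    by (simp add: set_lebesgue_integral_def)
  have \<mu>: "\<bar>\<mu>\<bar> \<le> e / 2"
  proof -
    have "(LINT t:{0..1}|lborel. h0 t - \<mu>) = (LINT t:{0..1}|lborel. h0 t) - \<mu>"
      by (subst set_integral_diff(2)[OF si_h si_c]) (simp add: Leb_one)
    then have "\<mu> = - (LINT t:{0..1}|lborel. g t - h0 t)"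
      using A_diff[of 0 1] A(2)[of 0] g(2)[of 0 1] F01 by (simp add: set_integral_diff(2)[OF si_g si_h])
    also have "\<bar>\<dots>\<bar> \<le> (LINT t:{0..1}|lborel. \<bar>g t - h0 t\<bar>)"
      using set_integral_norm_bound[OF set_integral_diff(1)[OF si_g si_h]] by simp
    finally show ?thesis using h0(3) by linarith
  qed
  define k where "k t = \<bar>g t - h0 t\<bar> + \<bar>\<mu>\<bar>" for t
  have si_k: "set_integrable lborel {x..y} k" for x y
    unfolding k_def by (intro set_integral_add set_integrable_abs set_integral_diff si_g si_h si_c)
  define Q where "Q x = (LINT t:{0..x}|lborel. k t)" for x
  have Q_diff: "Q y - Q x = (LINT t:{x..y}|lborel. k t)" if "0 \<le> x" "x \<le> y" for x y
  proof -
    have "{0..y} = {0..x} \<union> {x..y}" using that by auto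
    moreover have "AE t in lborel. \<not> (t \<in> {0..x} \<and> t \<in> {x..y})"
      using AE_lborel_singleton[of x] by eventually_elim auto
    ultimately show ?thesis
      unfolding Q_def by (simp add: set_integral_Un_AE si_k)
  qed
  have k_nonneg: "0 \<le> (LINT t:{x..y}|lborel. k t)" for x y
    unfolding set_lebesgue_integral_def by (intro Bochner_Integration.integral_nonneg) (simp add: k_def)
  have Q_nonneg: "0 \<le> Q x" for x
    unfolding Q_def by (rule k_nonneg)
  have "Q 1 = (LINT t:{0..1}|lborel. \<bar>g t - h0 t\<bar>) + \<bar>\<mu>\<bar>"
    unfolding Q_def k_def
    by (subst set_integral_add(2)) (auto intro!: set_integrable_abs set_integral_diff si_g si_h si_c simp: Leb_one)
  then have Q1: "Q 1 \<le> e" using h0(3) \<mu> by linarith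
  have Q_le: "Q x \<le> e" if "0 \<le> x" "x \<le> 1" for x
    using Q_diff[OF that] k_nonneg[of x 1] Q1 by linarith
  define E where "E x = f (to_circle x) - H (to_circle x)" for x
  have E_diff: "\<bar>E y - E x\<bar> \<le> Q y - Q x" if "0 \<le> x" "x \<le> y" "y \<le> 1" for x y
  proof -
    have si: "set_integrable lborel {x..y} (\<lambda>t. h0 t - \<mu>)"
      by (intro set_integral_diff si_h si_c)
    have "E y - E x = (F y - F x) - (A y - A x)"
      by (simp add: E_def H_eq F_def)
    also have "\<dots> = (LINT t:{x..y}|lborel. g t - (h0 t - \<mu>))"
      by (subst set_integral_diff(2)[OF si_g si]) (simp add: g(2)[OF that] A_diff[OF that])
    also have "\<bar>\<dots>\<bar> \<le> (LINT t:{x..y}|lborel. \<bar>g t - (h0 t - \<mu>)\<bar>)"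
      using set_integral_norm_bound[OF set_integral_diff(1)[OF si_g si]] by simp
    also have "\<dots> \<le> (LINT t:{x..y}|lborel. k t)"
      by (intro set_integral_mono si_k set_integrable_abs set_integral_diff si_g si) (simp add: k_def)
    finally show ?thesis using Q_diff that by simp
  qed
  have "E 0 = 0" unfolding E_def H_eq using to_circle_of_int[of 0] by simp
  have "\<bar>f x - H x\<bar> \<le> e" for x
  proof (cases x rule: to_circle_cases)
    case (1 r)
    then have "\<bar>E r - E 0\<bar> \<le> Q r - Q 0" by (intro E_diff) auto
    then show ?thesis using 1 Q_le[of r] Q_nonneg[of 0] \<open>E 0 = 0\<close> by (simp add: E_def)
  qed
  moreover have "s \<le> e" if s: "s \<in> variation_sums 0 1 ((\<lambda>x. f x - H x) \<circ> to_circle)" for s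
  proof -
    have "(\<lambda>x. f x - H x) \<circ> to_circle = E" by (simp add: E_def fun_eq_iff)
    with s have "s \<in> variation_sums 0 1 E" by simp
    then obtain n t where s: "s = (\<Sum>i<n. \<bar>E (t (Suc i)) - E (t i)\<bar>)"
      and t: "\<And>i. i < n \<Longrightarrow> t i \<le> t (Suc i)" "\<And>i. i \<le> n \<Longrightarrow> 0 \<le> t i \<and> t i \<le> 1"
      by (rule variation_sumsE) (rule that)
    have "s \<le> (\<Sum>i<n. Q (t (Suc i)) - Q (t i))"
      unfolding s by (intro sum_mono E_diff) (use t in auto)
    also have "\<dots> = Q (t n) - Q (t 0)" by (rule sum_lessThan_telescope)
    also have "\<dots> \<le> e" using Q_le[of "t n"] Q_nonneg[of "t 0"] t(2)[of n] by simp
    finally show ?thesis .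
  qed
  ultimately show ?thesis using that[of h H] h mean_h deriv by blast
qed

section \<open>Coboundaries are dense\<close>

lemma abs_cont_circle_continuous:
  assumes "abs_cont_circle f"
  shows "continuous_on UNIV f"
  unfolding continuous_on_circle_iff
proof (rule continuous_on_eq)
  have "continuous_on {0..1} (f \<circ> to_circle)"
    using assms unfolding abs_cont_circle_def by (rule absolutely_continuous_on_continuous)
  then show "continuous_on UNIV (\<lambda>x. (f \<circ> to_circle) (frac x))"
    by (rule continuous_on_frac_periodic) (use to_circle_of_int[of 0] to_circle_of_int[of 1] in simp)
qed (simp add: to_circle_frac)

lemma rot_average_has_derivative:
  assumes "\<And>x. ((\<lambda>x. H (to_circle x)) has_real_derivative h (to_circle x)) (at x)"
  shows "((\<lambda>x. rot_average \<alpha> N H (to_circle x)) has_real_derivative rot_average \<alpha> N h (to_circle x)) (at x)"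
proof -
  have shift: "((\<lambda>x. H (to_circle x - to_circle s)) has_real_derivative h (to_circle x - to_circle s)) (at x)" for s
  proof -
    have "((\<lambda>x. x - s) has_real_derivative 1) (at x)"
      by (auto intro!: derivative_eq_intros)
    from DERIV_chain2[OF assms this] show ?thesis by (simp add: to_circle_diff)
  qed
  show ?thesis
    unfolding rot_average_def by (intro DERIV_cdivide DERIV_sum shift)
qed

lemma derivative_bound_Lipschitz:
  fixes G :: "real \<Rightarrow> real"
  assumes "\<And>x. (G has_real_derivative g x) (at x)" "\<And>x. \<bar>g x\<bar> \<le> B"
  shows "\<bar>G y - G x\<bar> \<le> B * \<bar>y - x\<bar>"
  using field_differentiable_bound[of UNIV G g B y x] assms by (simp add: has_field_derivative_at_within)

text \<open>
  With \<open>H\<close> and its derivative \<open>h\<close> from the smooth approximation, the coboundary is \<open>H\<close> minus its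
  average over the rotation. The average is uniformly close to the mean of \<open>H\<close>, which is small as
  the mean of \<open>f\<close> vanishes, and its variation is at most the supremum of the average of \<open>h\<close>, which is
  close to the mean of \<open>h\<close>, namely \<open>0\<close>.
\<close>

lemma coboundaries_dense:
  assumes \<alpha>: "\<alpha> \<notin> \<rat>" and f: "f \<in> AC0" and e: "0 < e"
  obtains u where "continuous_on UNIV u" "(\<lambda>x. u x - u (x - to_circle \<alpha>)) \<in> AC0"
    "bv_dist f (\<lambda>x. u x - u (x - to_circle \<alpha>)) < e"
proof -
  \<comment> \<open>The supremum norm of the error is at most \<open>3 d\<close>, its variation at most \<open>2 d\<close>.\<close>
  define d where "d = e / 6"
  have d: "0 < d" using e by (simp add: d_def)
  have ac_f: "abs_cont_circle f" and mean_f: "mean f = 0" using f by (auto simp: AC0_def mean_def)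
  have cont_f: "continuous_on UNIV f" by (rule abs_cont_circle_continuous[OF ac_f])
  obtain H h where h: "continuous_on UNIV h" "mean h = 0"
    and deriv: "\<And>x. ((\<lambda>x. H (to_circle x)) has_real_derivative h (to_circle x)) (at x)"
    and fH: "\<And>x. \<bar>f x - H x\<bar> \<le> d"
    and var: "\<And>s. s \<in> variation_sums 0 1 ((\<lambda>x. f x - H x) \<circ> to_circle) \<Longrightarrow> s \<le> d"
    by (rule abs_cont_circle_smooth_approx[OF ac_f d]) (rule that)
  have H: "continuous_on UNIV H"
    unfolding continuous_on_circle_iff using deriv DERIV_isCont by (intro continuous_at_imp_continuous_on) blast
  have mean_H: "\<bar>mean H\<bar> \<le> d"
    using mean_near_const[of "\<lambda>x. f x - H x" 0 d] fH mean_diff[OF cont_f H] mean_f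
    by (auto intro!: continuous_intros cont_f H)
  obtain N1 where N1: "\<And>N x. N1 \<le> N \<Longrightarrow> \<bar>rot_average \<alpha> N H x - mean H\<bar> \<le> d"
    using rot_average_uniform[OF \<alpha> H d] by blast
  obtain N2 where N2: "\<And>N x. N2 \<le> N \<Longrightarrow> \<bar>rot_average \<alpha> N h x - mean h\<bar> \<le> d"
    using rot_average_uniform[OF \<alpha> h(1) d] by blast
  define N where "N = Suc (max N1 N2)"
  have N: "N1 \<le> N" "N2 \<le> N" by (simp_all add: N_def)
  let ?A = "rot_average \<alpha> N H"
  have AH: "\<bar>?A x\<bar> \<le> 2 * d" for x
    using N1[OF N(1), of x] mean_H by linarith
  have Ah: "\<bar>rot_average \<alpha> N h x\<bar> \<le> d" for x
    using N2[OF N(2), of x] h(2) by simp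
  have A_Lip: "\<bar>?A (to_circle y) - ?A (to_circle x)\<bar> \<le> d * \<bar>y - x\<bar>" for x y
    by (rule derivative_bound_Lipschitz[OF rot_average_has_derivative[OF deriv] Ah])
  obtain u where u: "continuous_on UNIV u" "\<And>x. H x - ?A x = u x - u (x - to_circle \<alpha>)"
    using minus_rot_average_coboundary[OF H, of N \<alpha>] by (auto simp: N_def)
  define w where "w x = u x - u (x - to_circle \<alpha>)" for x
  have w: "w x = H x - ?A x" for x using u(2) by (simp add: w_def)
  have cont_A: "continuous_on UNIV ?A" by (rule continuous_on_rot_average[OF H])
  obtain C where C: "\<And>x. \<bar>h x\<bar> \<le> C" using continuous_circle_bounded[OF h(1)] by blast
  have "mean w = 0"
    unfolding w by (subst mean_diff[OF H cont_A]) (simp add: mean_rot_average[OF H] N_def)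
  moreover have "abs_cont_circle w"
    unfolding abs_cont_circle_def
  proof (rule Lipschitz_absolutely_continuous_on)
    fix x y :: real
    have "\<bar>H (to_circle y) - H (to_circle x)\<bar> \<le> C * \<bar>y - x\<bar>"
      by (rule derivative_bound_Lipschitz[OF deriv C])
    then show "\<bar>(w \<circ> to_circle) y - (w \<circ> to_circle) x\<bar> \<le> (C + d) * \<bar>y - x\<bar>"
      using A_Lip[of y x] unfolding comp_def w distrib_right by linarith
  qed
  ultimately have w_AC0: "w \<in> AC0" by (simp add: AC0_def mean_def)
  have "(SUP x. \<bar>f x - w x\<bar>) \<le> 3 * d"
  proof (rule cSUP_least)
    fix x show "\<bar>f x - w x\<bar> \<le> 3 * d" using fH[of x] AH[of x] unfolding w by linarith
  qed simp
  moreover have "var_circle (\<lambda>x. f x - w x) \<le> 2 * d"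
    unfolding var_circle_def
  proof (rule cSup_least)
    show "variation_sums 0 1 ((\<lambda>x. f x - w x) \<circ> to_circle) \<noteq> {}"
      by (rule variation_sums_nonempty) simp
    fix s assume "s \<in> variation_sums 0 1 ((\<lambda>x. f x - w x) \<circ> to_circle)"
    then obtain n t where s: "s = (\<Sum>i<n. \<bar>((\<lambda>x. f x - w x) \<circ> to_circle) (t (Suc i)) - ((\<lambda>x. f x - w x) \<circ> to_circle) (t i)\<bar>)"
      and t: "\<And>i. i < n \<Longrightarrow> t i \<le> t (Suc i)" "\<And>i. i \<le> n \<Longrightarrow> 0 \<le> t i \<and> t i \<le> 1"
      by (rule variation_sumsE) (rule that)
    let ?E = "(\<lambda>x. f x - H x) \<circ> to_circle"
    have "s \<le> (\<Sum>i<n. \<bar>?E (t (Suc i)) - ?E (t i)\<bar> + d * (t (Suc i) - t i))"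
      unfolding s
    proof (rule sum_mono)
      fix i assume "i \<in> {..<n}"
      then have "\<bar>?A (to_circle (t (Suc i))) - ?A (to_circle (t i))\<bar> \<le> d * (t (Suc i) - t i)"
        using A_Lip[of "t (Suc i)" "t i"] t(1)[of i] by simp
      then show "\<bar>((\<lambda>x. f x - w x) \<circ> to_circle) (t (Suc i)) - ((\<lambda>x. f x - w x) \<circ> to_circle) (t i)\<bar>
          \<le> \<bar>?E (t (Suc i)) - ?E (t i)\<bar> + d * (t (Suc i) - t i)"
        unfolding comp_def w by linarith
    qed
    also have "\<dots> = (\<Sum>i<n. \<bar>?E (t (Suc i)) - ?E (t i)\<bar>) + d * (t n - t 0)"
      by (simp only: sum.distrib sum_distrib_left[symmetric] sum_lessThan_telescope)
    also have "\<dots> \<le> d + d * 1"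
    proof (rule add_mono)
      show "(\<Sum>i<n. \<bar>?E (t (Suc i)) - ?E (t i)\<bar>) \<le> d"
        by (rule var[OF variation_sumsI]) (use t in auto)
      show "d * (t n - t 0) \<le> d * 1"
        using d t(2)[of n] t(2)[of 0] by (intro mult_left_mono) auto
    qed
    finally show "s \<le> 2 * d" by simp
  qed
  ultimately have "bv_dist f w < e"
    using f w_AC0 e by (simp add: bv_dist_def bv_norm_def d_def)
  with u(1) w_AC0 show ?thesis by (intro that[of u]) (auto simp: w_def[abs_def])
qed

section \<open>The transition operator of the walk\<close>

definition walk_op :: "real \<Rightarrow> (circle \<Rightarrow> real) \<Rightarrow> (circle \<Rightarrow> real) \<Rightarrow> circle \<Rightarrow> real" where
  "walk_op \<alpha> f \<phi> x =
     step_prob f x * \<phi> (x + to_circle \<alpha>) + (1 - step_prob f x) * \<phi> (x - to_circle \<alpha>)"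

lemma continuous_on_walk_op_iter:
  assumes "continuous_on UNIV f" "continuous_on UNIV \<phi>"
  shows "continuous_on UNIV ((walk_op \<alpha> f ^^ n) \<phi>)"
proof (induction n)
  case (Suc n)
  have "1 + exp (f x) \<noteq> 0" for x by (simp add: add_pos_pos less_imp_neq[symmetric])
  with Suc show ?case
    unfolding funpow.simps comp_def walk_op_def[abs_def] step_prob_def
    by (intro continuous_intros continuous_on_circle_shift assms(1)) auto
qed (simp add: assms)

lemma walk_op_iter_diff:
  "(walk_op \<alpha> f ^^ n) (\<lambda>x. \<phi> x - \<psi> x) =
     (\<lambda>x. (walk_op \<alpha> f ^^ n) \<phi> x - (walk_op \<alpha> f ^^ n) \<psi> x)"
  by (induction n) (auto simp: walk_op_def algebra_simps)

lemma walk_op_iter_add: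
  "(walk_op \<alpha> f ^^ n) (\<lambda>x. \<phi> x + \<psi> x) =
     (\<lambda>x. (walk_op \<alpha> f ^^ n) \<phi> x + (walk_op \<alpha> f ^^ n) \<psi> x)"
  by (induction n) (auto simp: walk_op_def algebra_simps)

lemma walk_op_iter_cmult:
  "(walk_op \<alpha> f ^^ n) (\<lambda>x. c * \<phi> x) = (\<lambda>x. c * (walk_op \<alpha> f ^^ n) \<phi> x)"
  by (induction n) (auto simp: walk_op_def algebra_simps)

lemma walk_op_near_const:
  assumes "\<And>x. \<bar>\<phi> x - v\<bar> \<le> e"
  shows "\<bar>walk_op \<alpha> f \<phi> x - v\<bar> \<le> e"
proof -
  let ?p = "step_prob f x"
  have "walk_op \<alpha> f \<phi> x - v =
      ?p * (\<phi> (x + to_circle \<alpha>) - v) + (1 - ?p) * (\<phi> (x - to_circle \<alpha>) - v)"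
    by (simp add: walk_op_def algebra_simps)
  also have "\<bar>\<dots>\<bar> \<le> ?p * e + (1 - ?p) * e"
    using step_prob_bounds[of f x] assms
    by (intro order_trans[OF abs_triangle_ineq] add_mono) (auto simp: abs_mult intro!: mult_left_mono)
  also have "\<dots> = e" by (simp add: algebra_simps)
  finally show ?thesis .
qed

lemma walk_op_iter_near_const:
  assumes "\<And>x. \<bar>\<phi> x - v\<bar> \<le> e"
  shows "\<bar>(walk_op \<alpha> f ^^ n) \<phi> x - v\<bar> \<le> e"
  by (induction n arbitrary: x) (auto simp: assms intro!: walk_op_near_const)

lemma walk_op_iter_near_const_mono:
  assumes "\<And>x. \<bar>(walk_op \<alpha> f ^^ n) \<phi> x - v\<bar> \<le> e" "n \<le> m"
  shows "\<bar>(walk_op \<alpha> f ^^ m) \<phi> x - v\<bar> \<le> e"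
proof -
  have "(walk_op \<alpha> f ^^ (m - n + n)) \<phi> = (walk_op \<alpha> f ^^ (m - n)) ((walk_op \<alpha> f ^^ n) \<phi>)"
    unfolding funpow_add by simp
  then have "(walk_op \<alpha> f ^^ m) \<phi> = (walk_op \<alpha> f ^^ (m - n)) ((walk_op \<alpha> f ^^ n) \<phi>)"
    using \<open>n \<le> m\<close> by simp
  with walk_op_iter_near_const[OF assms(1)] show ?thesis by simp
qed

lemma logistic_Lipschitz: "\<bar>step_prob f x - step_prob g x\<bar> \<le> \<bar>f x - g x\<bar>"
proof -
  have "exp a / (1 + exp a) - exp b / (1 + exp b) \<le> a - b \<and>
      exp b / (1 + exp b) \<le> exp a / (1 + exp a)" if "b \<le> a" for a b :: real
  proof -
    have pos: "0 < 1 + exp a" "0 < 1 + exp b" by (simp_all add: add_pos_pos)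
    have eq: "exp a / (1 + exp a) - exp b / (1 + exp b) = (exp a - exp b) / ((1 + exp a) * (1 + exp b))"
      using pos by (simp add: field_simps)
    have "\<dots> \<le> (exp a - exp b) / exp a"
      using that pos by (intro divide_left_mono mult_pos_pos) (simp_all add: algebra_simps)
    also have "\<dots> = 1 - exp (b - a)" by (simp add: exp_diff field_simps)
    also have "\<dots> \<le> a - b" using exp_ge_add_one_self[of "b - a"] by linarith
    finally have "exp a / (1 + exp a) - exp b / (1 + exp b) \<le> a - b" using eq by simp
    moreover have "0 \<le> exp a / (1 + exp a) - exp b / (1 + exp b)"
      unfolding eq using that pos by simp
    ultimately show ?thesis by simp
  qed
  from this[of "f x" "g x"] this[of "g x" "f x"] show ?thesis
    unfolding step_prob_def by (cases "f x \<le> g x") auto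
qed

text \<open>
  Each step contributes the change of the transition probabilities, and later steps do not
  amplify it.
\<close>

lemma walk_op_iter_Lipschitz:
  assumes d: "\<And>x. \<bar>f x - g x\<bar> \<le> d" and C: "\<And>x. \<bar>\<phi> x\<bar> \<le> C"
  shows "\<bar>(walk_op \<alpha> f ^^ n) \<phi> x - (walk_op \<alpha> g ^^ n) \<phi> x\<bar> \<le> real n * (2 * C * d)"
proof (induction n arbitrary: x)
  case (Suc n)
  let ?F = "(walk_op \<alpha> f ^^ n) \<phi>" and ?G = "(walk_op \<alpha> g ^^ n) \<phi>"
  have G: "\<bar>?G y\<bar> \<le> C" for y
    using walk_op_iter_near_const[of \<phi> 0 C] C by simp
  have "\<bar>walk_op \<alpha> f (\<lambda>x. ?F x - ?G x) x - 0\<bar> \<le> real n * (2 * C * d)"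
    by (rule walk_op_near_const) (use Suc.IH in simp)
  moreover have "\<bar>(step_prob f x - step_prob g x) * (?G (x + to_circle \<alpha>) - ?G (x - to_circle \<alpha>))\<bar> \<le> d * (2 * C)"
    unfolding abs_mult
  proof (rule mult_mono)
    show "\<bar>step_prob f x - step_prob g x\<bar> \<le> d" using logistic_Lipschitz d order_trans by blast
    show "\<bar>?G (x + to_circle \<alpha>) - ?G (x - to_circle \<alpha>)\<bar> \<le> 2 * C"
      using G[of "x + to_circle \<alpha>"] G[of "x - to_circle \<alpha>"] by linarith
    show "0 \<le> d" using d[of x] by linarith
  qed simp
  moreover have "(walk_op \<alpha> f ^^ Suc n) \<phi> x - (walk_op \<alpha> g ^^ Suc n) \<phi> x =
      walk_op \<alpha> f (\<lambda>x. ?F x - ?G x) x +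
      (step_prob f x - step_prob g x) * (?G (x + to_circle \<alpha>) - ?G (x - to_circle \<alpha>))"
    by (simp add: walk_op_def algebra_simps)
  ultimately show ?case by (simp add: algebra_simps)
qed simp

section \<open>Asymptotic regularity of the two-step walk\<close>

lemma step_prob_away_from_0_1:
  assumes "\<And>x. \<bar>f x\<bar> \<le> C"
  obtains \<kappa> where "0 < \<kappa>" "\<And>x. \<kappa> \<le> step_prob f x \<and> step_prob f x \<le> 1 - \<kappa>"
proof
  show "0 < 1 / (1 + exp C)" by (simp add: add_pos_pos)
  fix x
  have "f x \<le> C" "- C \<le> f x" using assms[of x] by linarith+
  then have "exp (f x) \<le> exp C" "exp (- f x) \<le> exp C" by simp_all
  moreover have "step_prob f x = 1 / (1 + exp (- f x))" "1 - step_prob f x = 1 / (1 + exp (f x))"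
    by (simp_all add: step_prob_def exp_minus field_simps add_pos_pos add_nonneg_eq_0_iff)
  ultimately have "1 / (1 + exp C) \<le> step_prob f x" "1 / (1 + exp C) \<le> 1 - step_prob f x"
    by (auto intro!: divide_left_mono simp: add_pos_pos mult_pos_pos)
  then show "1 / (1 + exp C) \<le> step_prob f x \<and> step_prob f x \<le> 1 - 1 / (1 + exp C)" by simp
qed

text \<open>
  Two steps of the walk are a mixture, with weights \<open>\<kappa>\<close> and \<open>1 - \<kappa>\<close>, of staying put and of some other
  Markov transition.
\<close>

lemma walk_op_twice_holds:
  assumes \<kappa>: "\<And>x. \<kappa> \<le> step_prob f x \<and> step_prob f x \<le> 1 - \<kappa>" and S: "\<And>z. \<bar>\<psi> z\<bar> \<le> S"
  shows "\<bar>walk_op \<alpha> f (walk_op \<alpha> f \<psi>) x - \<kappa> * \<psi> x\<bar> \<le> (1 - \<kappa>) * S"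
proof -
  let ?a = "to_circle \<alpha>"
  define p q q' where "p = step_prob f x" and "q = step_prob f (x + ?a)" and "q' = step_prob f (x - ?a)"
  define w where "w = p * (1 - q) + (1 - p) * q' - \<kappa>"
  have p: "0 < p" "p < 1" "0 < q" "q < 1" "0 < q'" "q' < 1"
    by (simp_all add: p_def q_def q'_def step_prob_bounds)
  have "p * \<kappa> + (1 - p) * \<kappa> \<le> p * (1 - q) + (1 - p) * q'"
    using p \<kappa>[of "x + ?a"] \<kappa>[of "x - ?a"] unfolding q_def[symmetric] q'_def[symmetric]
    by (intro add_mono mult_left_mono) auto
  then have w: "0 \<le> w" by (simp add: w_def algebra_simps)
  have "walk_op \<alpha> f (walk_op \<alpha> f \<psi>) x - \<kappa> * \<psi> x =
      p * q * \<psi> (x + ?a + ?a) + w * \<psi> x + (1 - p) * (1 - q') * \<psi> (x - ?a - ?a)"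
    by (simp add: walk_op_def p_def[symmetric] q_def[symmetric] q'_def[symmetric] w_def algebra_simps)
  also have "\<bar>\<dots>\<bar> \<le> p * q * S + w * S + (1 - p) * (1 - q') * S"
    using p w S
    by (intro order_trans[OF abs_triangle_ineq] add_mono) (auto simp: abs_mult intro!: mult_left_mono)
  also have "\<dots> = (1 - \<kappa>) * S" by (simp add: w_def algebra_simps)
  finally show ?thesis .
qed

text \<open>
  Ishikawa's argument for the iterates \<open>y (n + 1) = A (y n)\<close> of an operator \<open>A = \<kappa> I + (1 - \<kappa>) Q\<close>, where \<open>Q\<close>
  does not increase the supremum norm. The norms of the increments decrease to some \<open>r\<close>. If \<open>r > 0\<close>, an increment which is late enough and nearly equal to \<open>r\<close> at
  some point \<open>x\<close> forces its predecessor to be nearly \<open>r\<close> at \<open>x\<close> as well, because the part coming from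
  \<open>Q\<close> cannot exceed \<open>r\<close> by much. Going back \<open>L\<close> steps, \<open>L\<close> consecutive increments at \<open>x\<close> are at least
  \<open>r / 2\<close> with a common sign, which contradicts the boundedness of \<open>y\<close> when \<open>L\<close> is large.
\<close>

lemma asymptotic_regularity:
  fixes y :: "nat \<Rightarrow> 'a \<Rightarrow> real" and \<kappa> C e :: real
  defines "d n x \<equiv> y n x - y (Suc n) x"
  assumes \<kappa>: "0 < \<kappa>" "\<kappa> \<le> 1" and C: "\<And>n x. \<bar>y n x\<bar> \<le> C" and e: "0 < e"
    and step: "\<And>n S x. (\<And>z. \<bar>d n z\<bar> \<le> S) \<Longrightarrow> \<bar>d (Suc n) x - \<kappa> * d n x\<bar> \<le> (1 - \<kappa>) * S"
  shows "\<exists>n. \<forall>x. \<bar>d n x\<bar> \<le> e"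
proof (rule ccontr)
  assume contra: "\<nexists>n. \<forall>x. \<bar>d n x\<bar> \<le> e"
  define R where "R = {S. \<exists>n. \<forall>x. \<bar>d n x\<bar> \<le> S}"
  define r where "r = Inf R"
  have "\<bar>d 0 x\<bar> \<le> 2 * C" for x
    unfolding d_def using C[of 0 x] C[of "Suc 0" x] by linarith
  then have "2 * C \<in> R" by (auto simp: R_def)
  have eR: "e \<le> S" if "S \<in> R" for S
  proof (rule ccontr)
    assume "\<not> e \<le> S"
    moreover from that obtain n where "\<And>x. \<bar>d n x\<bar> \<le> S" by (auto simp: R_def)
    ultimately have "\<bar>d n x\<bar> \<le> e" for x by (metis linear order_trans)
    with contra show False by blast
  qed
  then have bdd: "bdd_below R" unfolding bdd_below_def by blast
  have "e \<le> r" unfolding r_def using \<open>2 * C \<in> R\<close> eR by (intro cInf_greatest) blast+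
  with e have "0 < r" by simp
  obtain L :: nat where L: "2 * C < real L * (r / 2)"
    using reals_Archimedean3[of "r / 2"] \<open>0 < r\<close> half_gt_zero by blast
  \<comment> \<open>The loss grows by a factor \<open>1 / \<kappa>\<close> with every step back and has to stay below \<open>r / 2\<close> for \<open>L\<close> steps.\<close>
  define \<eta> where "\<eta> = r * \<kappa> ^ L / 4"
  have "0 < \<eta>" using \<open>0 < r\<close> \<kappa> by (simp add: \<eta>_def)
  obtain S where S: "S \<in> R" "S < r + \<eta>"
    using cInf_lessD[of R "r + \<eta>"] \<open>2 * C \<in> R\<close> \<open>0 < \<eta>\<close> r_def by (metis empty_iff less_add_same_cancel1)
  then obtain N where N: "\<And>x. \<bar>d N x\<bar> \<le> S" by (auto simp: R_def)
  have dS: "\<bar>d (N + n) x\<bar> \<le> S" for n x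
  proof (induction n arbitrary: x)
    case (Suc n)
    have "\<bar>d (Suc (N + n)) x - \<kappa> * d (N + n) x\<bar> \<le> (1 - \<kappa>) * S" by (rule step) (rule Suc.IH)
    moreover have "\<bar>\<kappa> * d (N + n) x\<bar> \<le> \<kappa> * S"
      using \<kappa> Suc.IH by (simp add: abs_mult)
    ultimately show ?case by (simp add: algebra_simps)
  qed (simp add: N)
  have "r - \<eta> \<notin> R"
  proof
    assume "r - \<eta> \<in> R"
    from cInf_lower[OF this bdd] \<open>0 < \<eta>\<close> show False by (simp add: r_def)
  qed
  then obtain x where "\<not> \<bar>d (N + L) x\<bar> \<le> r - \<eta>" by (auto simp: R_def)
  then have x: "r - \<eta> < \<bar>d (N + L) x\<bar>" by simp
  then obtain \<sigma> :: real where \<sigma>: "\<sigma> = 1 \<or> \<sigma> = -1" and top: "r - \<eta> < \<sigma> * d (N + L) x"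
  proof (cases "0 \<le> d (N + L) x")
    case True
    with x that[of 1] show ?thesis by simp
  next
    case False
    with x that[of "-1"] show ?thesis by simp
  qed
  \<comment> \<open>The loss \<open>e\<^sub>i\<close> after \<open>i\<close> steps back satisfies \<open>\<kappa> e\<^sub>i\<^sub>+\<^sub>1 = e\<^sub>i + (1 - \<kappa>) \<eta>\<close> with \<open>e\<^sub>0 = \<eta>\<close>.\<close>
  have down: "r - \<eta> * (2 / \<kappa> ^ i - 1) \<le> \<sigma> * d (N + (L - i)) x" if "i \<le> L" for i
    using that
  proof (induction i)
    case 0
    then show ?case using top by simp
  next
    case (Suc i)
    let ?k = "N + (L - Suc i)"
    have k: "N + (L - i) = Suc ?k" using Suc.prems by simp
    have "\<bar>d (Suc ?k) x - \<kappa> * d ?k x\<bar> \<le> (1 - \<kappa>) * S" by (rule step) (rule dS)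
    then have "\<sigma> * d (Suc ?k) x - \<kappa> * (\<sigma> * d ?k x) \<le> (1 - \<kappa>) * S"
      using \<sigma> by auto
    also have "\<dots> \<le> (1 - \<kappa>) * (r + \<eta>)"
      using S \<kappa> by (intro mult_left_mono) auto
    finally have "r - \<eta> * (2 / \<kappa> ^ i - 1) - (1 - \<kappa>) * (r + \<eta>) \<le> \<kappa> * (\<sigma> * d ?k x)"
      using Suc k by simp
    moreover have "r - \<eta> * (2 / \<kappa> ^ i - 1) - (1 - \<kappa>) * (r + \<eta>) = \<kappa> * (r - \<eta> * (2 / \<kappa> ^ Suc i - 1))"
      using \<kappa> by (simp add: field_simps)
    ultimately show ?case using \<kappa> by simp
  qed
  have low: "r / 2 \<le> \<sigma> * d (N + j) x" if "j < L" for j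
  proof -
    have "\<kappa> ^ L \<le> \<kappa> ^ (L - j)" using \<kappa> by (intro power_decreasing) auto
    then have "\<eta> * (2 / \<kappa> ^ (L - j)) \<le> r / 2"
      using \<kappa> \<open>0 < r\<close> by (simp add: \<eta>_def field_simps)
    moreover have "r - (\<eta> * (2 / \<kappa> ^ (L - j)) - \<eta>) \<le> \<sigma> * d (N + j) x"
      using down[of "L - j"] that by (simp add: right_diff_distrib)
    ultimately show ?thesis using \<open>0 < \<eta>\<close> by linarith
  qed
  have "real L * (r / 2) \<le> (\<Sum>j<L. \<sigma> * d (N + j) x)"
    using sum_mono[of "{..<L}" "\<lambda>_. r / 2", OF low] by simp
  also have "\<dots> = \<sigma> * (\<Sum>j<L. y (N + j) x - y (N + Suc j) x)"
    by (simp add: d_def sum_distrib_left)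
  also have "\<dots> = \<sigma> * (y N x - y (N + L) x)"
    using sum_lessThan_telescope'[of "\<lambda>j. y (N + j) x" L] by simp
  also have "\<dots> \<le> 2 * C"
    using \<sigma> C[of N x] C[of "N + L" x] by auto
  finally show False using L by simp
qed

section \<open>Walks with coboundary drift\<close>

text \<open>
  The walk with conductance \<open>c x\<close> on the edge from \<open>x\<close> to \<open>x + \<alpha>\<close>.
\<close>

lemma walk_op_coboundary:
  fixes u :: "circle \<Rightarrow> real" and \<alpha> :: real
  defines "c x \<equiv> exp (u x)"
  shows "walk_op \<alpha> (\<lambda>x. u x - u (x - to_circle \<alpha>)) \<phi> x =
    (c x * \<phi> (x + to_circle \<alpha>) + c (x - to_circle \<alpha>) * \<phi> (x - to_circle \<alpha>)) / (c x + c (x - to_circle \<alpha>))"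
proof -
  have "0 < c x" "0 < c (x - to_circle \<alpha>)" by (simp_all add: c_def)
  moreover have "exp (u x - u (x - to_circle \<alpha>)) = c x / c (x - to_circle \<alpha>)"
    by (simp add: c_def exp_diff)
  ultimately show ?thesis
    unfolding walk_op_def step_prob_def
    by (simp add: divide_simps add_pos_pos add_nonneg_eq_0_iff) (simp add: algebra_simps)
qed

text \<open>
  Common algebra of the two equations \<open>(I - P) g = \<psi>\<close> (\<open>\<sigma> = -1\<close>) and \<open>(I + P) g = \<psi>\<close> (\<open>\<sigma> = 1\<close>). For
  \<open>g(x) = \<sigma> k(x - \<alpha>)\<close> and \<open>W(x) = c(x) (k(x) + \<sigma> k(x - \<alpha>))\<close> one has
  \<open>m(x) (g(x) + \<sigma> P g(x)) = W(x) + \<sigma> W(x - \<alpha>)\<close> with \<open>m(x) = c(x) + c(x - \<alpha>)\<close>. So it suffices to solve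
  first \<open>G + \<sigma> G \<circ> T\<^sup>-\<^sup>1 = m \<psi>\<close> and then \<open>k + \<sigma> k \<circ> T\<^sup>-\<^sup>1 = G / c\<close>. The error bounds in the assumptions are
  chosen to add up to \<open>e\<close> when \<open>c\<close> ranges between \<open>exp (- C)\<close> and \<open>exp C\<close>.
\<close>

lemma coboundary_walk_range:
  fixes u :: "circle \<Rightarrow> real" and \<alpha> \<sigma> :: real
  defines "f \<equiv> \<lambda>x. u x - u (x - to_circle \<alpha>)" and "c \<equiv> \<lambda>x. exp (u x)"
  assumes C: "\<And>x. \<bar>u x\<bar> \<le> C" and \<sigma>: "\<sigma> = 1 \<or> \<sigma> = -1"
    and G: "\<And>x. \<bar>(c x + c (x - to_circle \<alpha>)) * \<psi> x - (G x + \<sigma> * G (x - to_circle \<alpha>))\<bar> \<le> e * exp (- C)"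
    and k: "\<And>x. \<bar>G x / c x - (k x + \<sigma> * k (x - to_circle \<alpha>))\<bar> \<le> e * exp (- 2 * C) / 2"
  shows "\<bar>\<psi> x - (\<sigma> * k (x - to_circle \<alpha>) + \<sigma> * walk_op \<alpha> f (\<lambda>x. \<sigma> * k (x - to_circle \<alpha>)) x)\<bar> \<le> e"
proof -
  let ?a = "to_circle \<alpha>"
  define m where "m = c x + c (x - ?a)"
  define W where "W x = c x * (k x + \<sigma> * k (x - ?a))" for x
  have c: "exp (- C) \<le> c z" "c z \<le> exp C" "0 < c z" for z
    using C[of z] by (auto simp: c_def)
  have m: "2 * exp (- C) \<le> m" "0 < m"
    using c[of x] c[of "x - ?a"] by (auto simp: m_def)
  have e: "0 \<le> e"
    using G[of x] by (metis abs_ge_zero exp_gt_zero order_trans zero_le_mult_iff not_less)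
  have W: "\<bar>G z - W z\<bar> \<le> e * exp (- C) / 2" for z
  proof -
    have "G z - W z = c z * (G z / c z - (k z + \<sigma> * k (z - ?a)))"
      using c(3)[of z] by (simp add: W_def field_simps)
    also have "\<bar>\<dots>\<bar> \<le> exp C * (e * exp (- 2 * C) / 2)"
      unfolding abs_mult using k[of z] c[of z] by (intro mult_mono) auto
    also have "\<dots> = e * (exp C * exp (- 2 * C)) / 2" by simp
    also have "exp C * exp (- 2 * C) = exp (- C)" by (simp add: exp_add[symmetric])
    finally show ?thesis .
  qed
  have W2: "\<bar>(G x + \<sigma> * G (x - ?a)) - (W x + \<sigma> * W (x - ?a))\<bar> \<le> e * exp (- C)"
    using W[of x] W[of "x - ?a"] \<sigma> by (elim disjE; simp only: mult_1 mult_minus_left; linarith)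
  have op: "walk_op \<alpha> f (\<lambda>x. \<sigma> * k (x - ?a)) x =
      (c x * (\<sigma> * k x) + c (x - ?a) * (\<sigma> * k (x - ?a - ?a))) / m"
    unfolding f_def by (subst walk_op_coboundary) (simp add: c_def m_def)
  have "\<sigma> * k (x - ?a) + \<sigma> * walk_op \<alpha> f (\<lambda>x. \<sigma> * k (x - ?a)) x =
      (m * (\<sigma> * k (x - ?a)) + \<sigma> * (c x * (\<sigma> * k x) + c (x - ?a) * (\<sigma> * k (x - ?a - ?a)))) / m"
    unfolding op using m by (simp add: field_simps)
  also have "\<dots> = (W x + \<sigma> * W (x - ?a)) / m"
    using \<sigma> by (auto simp: W_def m_def algebra_simps)
  finally have main: "\<psi> x - (\<sigma> * k (x - ?a) + \<sigma> * walk_op \<alpha> f (\<lambda>x. \<sigma> * k (x - ?a)) x) =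
      (m * \<psi> x - (W x + \<sigma> * W (x - ?a))) / m"
    using m by (simp add: field_simps)
  have "\<bar>m * \<psi> x - (W x + \<sigma> * W (x - ?a))\<bar> \<le> e * exp (- C) + e * exp (- C)"
    using G[of x] W2 unfolding m_def by linarith
  also have "\<dots> = e * (2 * exp (- C))" by simp
  also have "\<dots> \<le> e * m"
    using m e by (intro mult_left_mono)
  finally show ?thesis
    unfolding main using m by (simp add: field_simps)
qed

lemma mean_zero_correction:
  fixes \<phi> w :: "circle \<Rightarrow> real"
  assumes "continuous_on UNIV \<phi>" "continuous_on UNIV w" "0 < mean w"
  obtains b where "mean (\<lambda>x. \<phi> x - b * w x) = 0"
proof
  show "mean (\<lambda>x. \<phi> x - (mean \<phi> / mean w) * w x) = 0"
    using assms mean_cmult[OF assms(2,2), of "mean \<phi> / mean w"]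
    by (subst mean_diff) (auto intro!: continuous_intros)
qed

text \<open>
  Each of the two cohomological equations needs a right-hand side of mean zero. For the first one
  this is arranged by the constant \<open>v\<close>, for the second one by the constant of integration \<open>b\<close>, which
  may be subtracted from \<open>G\<close>.
\<close>

lemma coboundary_walk_approx_minus:
  fixes u \<psi> :: "circle \<Rightarrow> real" and \<alpha> :: real
  defines "f \<equiv> \<lambda>x. u x - u (x - to_circle \<alpha>)"
  assumes \<alpha>: "\<alpha> \<notin> \<rat>" and u: "continuous_on UNIV u" and \<psi>: "continuous_on UNIV \<psi>" and e: "0 < e"
  obtains v g where "continuous_on UNIV g" "\<And>x. \<bar>\<psi> x - v - (g x - walk_op \<alpha> f g x)\<bar> \<le> e"
proof -
  let ?a = "to_circle \<alpha>"
  define c where "c x = exp (u x)" for x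
  obtain C where C: "\<And>x. \<bar>u x\<bar> \<le> C" using continuous_circle_bounded[OF u] by blast
  have c: "exp (- C) \<le> c x" "0 < c x" "exp (- C) \<le> 1 / c x" for x
    using C[of x] by (auto simp: c_def exp_minus[symmetric] inverse_eq_divide[symmetric])
  have cont_c: "continuous_on UNIV c" and cont_c': "continuous_on UNIV (\<lambda>x. 1 / c x)"
    unfolding c_def by (auto intro!: continuous_intros u)
  define m where "m x = c x + c (x - ?a)" for x
  have cont_m: "continuous_on UNIV m"
    unfolding m_def by (intro continuous_intros continuous_on_circle_shift cont_c)
  have "exp (- C) \<le> m x" for x
    using c[of x] c[of "x - ?a"] by (simp add: m_def)
  then have "0 < mean m" by (intro mean_pos[OF cont_m, of "exp (- C)"]) auto
  then obtain v where v: "mean (\<lambda>x. m x * \<psi> x - v * m x) = 0"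
    using mean_zero_correction[of "\<lambda>x. m x * \<psi> x" m] cont_m \<psi> by (auto intro!: continuous_intros)
  have "continuous_on UNIV (\<lambda>x. m x * \<psi> x - v * m x)"
    by (intro continuous_intros cont_m \<psi>)
  then obtain G0 where G0: "continuous_on UNIV G0"
    "\<And>x. \<bar>m x * \<psi> x - v * m x - (G0 x - G0 (x - ?a))\<bar> \<le> e * exp (- C)"
    using approx_coboundary[OF \<alpha>, of "\<lambda>x. m x * \<psi> x - v * m x" "e * exp (- C)"] e v by auto
  have "0 < mean (\<lambda>x. 1 / c x)"
    by (rule mean_pos[OF cont_c', of "exp (- C)"]) (auto simp: c)
  then obtain b where b: "mean (\<lambda>x. G0 x * (1 / c x) - b * (1 / c x)) = 0"
    using mean_zero_correction[OF continuous_on_mult[OF G0(1) cont_c'] cont_c'] by blast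
  define G where "G x = G0 x - b" for x
  have cont_G: "continuous_on UNIV (\<lambda>x. G x / c x)"
    unfolding G_def using c(2) by (intro continuous_intros G0 cont_c) (simp add: less_imp_neq[symmetric])
  have "mean (\<lambda>x. G x / c x) = 0"
    using b by (simp add: G_def diff_divide_distrib)
  then obtain k where k: "continuous_on UNIV k"
    "\<And>x. \<bar>G x / c x - (k x - k (x - ?a))\<bar> \<le> e * exp (- 2 * C) / 2"
    using approx_coboundary[OF \<alpha> cont_G, of "e * exp (- 2 * C) / 2"] e by auto
  have "\<bar>(\<psi> x - v) - (-1 * k (x - ?a) + -1 * walk_op \<alpha> f (\<lambda>x. -1 * k (x - ?a)) x)\<bar> \<le> e" for x
    unfolding f_def
  proof (rule coboundary_walk_range)
    show "\<bar>u x\<bar> \<le> C" for x by (rule C)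
    show "\<bar>(exp (u x) + exp (u (x - ?a))) * (\<psi> x - v) - (G x + - 1 * G (x - ?a))\<bar> \<le> e * exp (- C)" for x
      using G0(2)[of x] by (simp add: m_def c_def G_def algebra_simps)
    show "\<bar>G x / exp (u x) - (k x + - 1 * k (x - ?a))\<bar> \<le> e * exp (- 2 * C) / 2" for x
      using k(2)[of x] by (simp add: c_def)
  qed simp
  moreover have "continuous_on UNIV (\<lambda>x. -1 * k (x - ?a))"
    by (intro continuous_intros continuous_on_circle_shift k)
  ultimately show ?thesis
    by (intro that[of "\<lambda>x. -1 * k (x - ?a)" v]) auto
qed

lemma coboundary_walk_approx_plus:
  fixes u \<psi> :: "circle \<Rightarrow> real" and \<alpha> :: real
  defines "f \<equiv> \<lambda>x. u x - u (x - to_circle \<alpha>)"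
  assumes \<alpha>: "\<alpha> \<notin> \<rat>" and u: "continuous_on UNIV u" and \<psi>: "continuous_on UNIV \<psi>" and e: "0 < e"
  obtains g where "continuous_on UNIV g" "\<And>x. \<bar>\<psi> x - (g x + walk_op \<alpha> f g x)\<bar> \<le> e"
proof -
  let ?a = "to_circle \<alpha>"
  obtain C where C: "\<And>x. \<bar>u x\<bar> \<le> C" using continuous_circle_bounded[OF u] by blast
  have "continuous_on UNIV (\<lambda>x. (exp (u x) + exp (u (x - ?a))) * \<psi> x)"
    by (intro continuous_intros continuous_on_circle_shift u \<psi>)
  then obtain G where G: "continuous_on UNIV G"
    "\<And>x. \<bar>(exp (u x) + exp (u (x - ?a))) * \<psi> x - (G x + G (x - ?a))\<bar> \<le> e * exp (- C)"
    using approx_anti_coboundary[OF \<alpha>, of _ "e * exp (- C)"] e by auto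
  have "continuous_on UNIV (\<lambda>x. G x / exp (u x))"
    by (intro continuous_intros u G) simp
  then obtain k where k: "continuous_on UNIV k"
    "\<And>x. \<bar>G x / exp (u x) - (k x + k (x - ?a))\<bar> \<le> e * exp (- 2 * C) / 2"
    using approx_anti_coboundary[OF \<alpha>, of _ "e * exp (- 2 * C) / 2"] e by auto
  have "\<bar>\<psi> x - (1 * k (x - ?a) + 1 * walk_op \<alpha> f (\<lambda>x. 1 * k (x - ?a)) x)\<bar> \<le> e" for x
    unfolding f_def
    by (rule coboundary_walk_range[where C = C and G = G]) (use C G(2) k(2) in auto)
  moreover have "continuous_on UNIV (\<lambda>x. k (x - ?a))"
    by (intro continuous_on_circle_shift k)
  ultimately show ?thesis
    by (intro that[of "\<lambda>x. k (x - ?a)"]) auto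
qed

text \<open>
  Solve \<open>\<phi> = v + (I - P) g\<close> and then \<open>g = (I + P) h\<close>, both approximately, to get
  \<open>\<phi> = v + (I - P\<^sup>2) h\<close> up to a small error; then apply the asymptotic regularity of \<open>P\<^sup>2\<close>. The detour
  through two steps is due to the fact that the walk never stays put in a single step.
\<close>

lemma coboundary_walk_contracts:
  fixes u \<phi> :: "circle \<Rightarrow> real" and \<alpha> :: real
  defines "f \<equiv> \<lambda>x. u x - u (x - to_circle \<alpha>)"
  assumes \<alpha>: "\<alpha> \<notin> \<rat>" and u: "continuous_on UNIV u" and \<phi>: "continuous_on UNIV \<phi>" and e: "0 < e"
  obtains n v where "\<And>x. \<bar>(walk_op \<alpha> f ^^ n) \<phi> x - v\<bar> \<le> e"
proof -
  let ?P = "walk_op \<alpha> f"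
  have f: "continuous_on UNIV f"
    unfolding f_def by (intro continuous_intros continuous_on_circle_shift u)
  obtain v g where g: "continuous_on UNIV g" "\<And>x. \<bar>\<phi> x - v - (g x - ?P g x)\<bar> \<le> e / 4"
    using coboundary_walk_approx_minus[OF \<alpha> u \<phi>, of "e / 4"] e unfolding f_def by (metis zero_less_divide_iff zero_less_numeral)
  obtain h where h: "continuous_on UNIV h" "\<And>x. \<bar>g x - (h x + ?P h x)\<bar> \<le> e / 8"
    using coboundary_walk_approx_plus[OF \<alpha> u g(1), of "e / 8"] e unfolding f_def by (metis zero_less_divide_iff zero_less_numeral)
  define \<theta> where "\<theta> x = \<phi> x - (h x - ?P (?P h) x)" for x
  have \<theta>: "\<bar>\<theta> x - v\<bar> \<le> e / 2" for x
  proof -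
    define r where "r x = g x - (h x + ?P h x)" for x
    have "\<bar>?P r x - 0\<bar> \<le> e / 8" by (rule walk_op_near_const) (use h in \<open>simp add: r_def\<close>)
    moreover have "\<bar>r x\<bar> \<le> e / 8" using h by (simp add: r_def)
    moreover have "?P r x = ?P g x - (?P h x + ?P (?P h) x)"
      by (simp add: r_def walk_op_def algebra_simps)
    ultimately show ?thesis using g(2)[of x] unfolding \<theta>_def r_def by linarith
  qed
  define y where "y n = (?P ^^ (2 * n)) h" for n
  obtain C where C: "\<And>x. \<bar>h x\<bar> \<le> C" using continuous_circle_bounded[OF h(1)] by blast
  obtain Cf where "\<And>x. \<bar>f x\<bar> \<le> Cf" using continuous_circle_bounded[OF f] by blast
  then obtain \<kappa> where \<kappa>: "0 < \<kappa>" "\<And>x. \<kappa> \<le> step_prob f x \<and> step_prob f x \<le> 1 - \<kappa>"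
    using step_prob_away_from_0_1 by blast
  have "\<exists>n. \<forall>x. \<bar>y n x - y (Suc n) x\<bar> \<le> e / 2"
  proof (rule asymptotic_regularity[where \<kappa> = \<kappa> and C = C])
    show "\<kappa> \<le> 1" using \<kappa>(2)[of 0] step_prob_bounds[of f 0] by linarith
    show "\<bar>y n x\<bar> \<le> C" for n x
      using walk_op_iter_near_const[of h 0 C] C by (simp add: y_def)
    fix n S x assume S: "\<And>z. \<bar>y n z - y (Suc n) z\<bar> \<le> S"
    have "y (Suc n) x - y (Suc (Suc n)) x = ?P (?P (\<lambda>z. y n z - y (Suc n) z)) x"
      by (simp add: y_def walk_op_def algebra_simps)
    then show "\<bar>y (Suc n) x - y (Suc (Suc n)) x - \<kappa> * (y n x - y (Suc n) x)\<bar> \<le> (1 - \<kappa>) * S"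
      using walk_op_twice_holds[OF \<kappa>(2) S] by simp
  qed (use \<kappa> e in auto)
  then obtain n where n: "\<And>x. \<bar>y n x - y (Suc n) x\<bar> \<le> e / 2" by blast
  have \<phi>_eq: "\<phi> = (\<lambda>x. \<theta> x + (h x - ?P (?P h) x))" by (simp add: \<theta>_def)
  have "(?P ^^ (2 * n)) \<phi> x = (?P ^^ (2 * n)) \<theta> x + (y n x - y (Suc n) x)" for x
    by (subst \<phi>_eq) (simp add: walk_op_iter_add walk_op_iter_diff y_def funpow_swap1)
  moreover have "\<bar>(?P ^^ (2 * n)) \<theta> x - v\<bar> \<le> e / 2" for x
    by (rule walk_op_iter_near_const) (rule \<theta>)
  ultimately have "\<bar>(?P ^^ (2 * n)) \<phi> x - v\<bar> \<le> e" for x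
    using n[of x] by (smt (verit) field_sum_of_halves)
  then show ?thesis by (rule that)
qed

section \<open>Expectations along the walk\<close>

lemma measurable_circle_shift: "(\<lambda>x. x + c) \<in> borel \<rightarrow>\<^sub>M (borel :: circle measure)"
  "(\<lambda>x. x - c) \<in> borel \<rightarrow>\<^sub>M (borel :: circle measure)"
  using continuous_on_circle_shift[OF continuous_on_id]
  by (auto intro!: borel_measurable_continuous_onI)

lemma measurable_walk_kernel:
  assumes "continuous_on UNIV f"
  shows "walk_kernel \<alpha> f \<in> borel \<rightarrow>\<^sub>M subprob_algebra borel"
proof (rule measurable_subprob_algebra)
  show "subprob_space (walk_kernel \<alpha> f x)" for x
    by (rule prob_space_imp_subprob_space) (rule prob_space_walk_kernel)
  show "sets (walk_kernel \<alpha> f x) = sets borel" for x by simp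
  fix A :: "circle set" assume A [measurable]: "A \<in> sets borel"
  note [measurable] = measurable_circle_shift
  have [measurable]: "f \<in> borel_measurable borel" by (rule borel_measurable_circle[OF assms])
  have [measurable]: "step_prob f \<in> borel_measurable borel"
    unfolding step_prob_def[abs_def] by measurable
  show "(\<lambda>x. emeasure (walk_kernel \<alpha> f x) A) \<in> borel_measurable borel"
    unfolding emeasure_walk_kernel[OF A] by measurable
qed

lemma integral_walk_kernel:
  assumes "continuous_on UNIV \<phi>"
  shows "(\<integral>y. \<phi> y \<partial>walk_kernel \<alpha> f x) = walk_op \<alpha> f \<phi> x"
proof -
  have "(\<integral>y. \<phi> y \<partial>walk_kernel \<alpha> f x) =
      (\<integral>b. \<phi> (if b then x + to_circle \<alpha> else x - to_circle \<alpha>) \<partial>measure_pmf (bernoulli_pmf (step_prob f x)))"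
    unfolding walk_kernel_eq_distr
    by (rule integral_distr) (auto intro!: borel_measurable_circle[OF assms])
  also have "\<dots> = walk_op \<alpha> f \<phi> x"
    using step_prob_bounds[of f x] by (simp add: walk_op_def)
  finally show ?thesis .
qed

lemma measurable_coordinate_markov_law:
  assumes "continuous_on UNIV f"
  shows "(\<lambda>\<omega>. \<omega> n) \<in> markov_law (walk_kernel \<alpha> f) x \<rightarrow>\<^sub>M borel"
  unfolding measurable_cong_sets[OF sets_markov_law[OF measurable_walk_kernel[OF assms] prob_space_walk_kernel] refl]
  by (rule measurable_component_singleton) simp

text \<open>
  The recursion for the law of \<open>X\<^sub>n\<close> peels off the last step of the walk, whence the induction
  with \<open>\<phi>\<close> replaced by \<open>P \<phi>\<close>.
\<close>

lemma expectation_walk: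
  assumes f: "continuous_on UNIV f" and \<phi>: "continuous_on UNIV \<phi>"
  shows "(\<integral>\<omega>. \<phi> (\<omega> n) \<partial>markov_law (walk_kernel \<alpha> f) x) = (walk_op \<alpha> f ^^ n) \<phi> x"
proof -
  let ?K = "walk_kernel \<alpha> f"
  note K = measurable_walk_kernel[OF f, of \<alpha>]
  define D where "D n = distr (markov_law ?K x) borel (\<lambda>\<omega>. \<omega> n)" for n
  have "(\<integral>y. \<phi> y \<partial>D n) = (walk_op \<alpha> f ^^ n) \<phi> x"
    using \<phi>
  proof (induction n arbitrary: \<phi>)
    case 0
    have "D 0 = return borel x"
      unfolding D_def by (rule distr_markov_law_0[OF K prob_space_walk_kernel])
    then show ?case
      using borel_measurable_circle[OF "0.prems"] by (simp add: integral_return)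
  next
    case (Suc n)
    obtain C where C: "\<And>y. \<bar>\<phi> y\<bar> \<le> C" using continuous_circle_bounded[OF Suc.prems] by blast
    interpret D: prob_space "D n"
      unfolding D_def
      by (rule prob_space.prob_space_distr[OF prob_space_markov_law[OF K prob_space_walk_kernel]])
         (rule measurable_coordinate_markov_law[OF f])
    have "(\<integral>y. \<phi> y \<partial>D (Suc n)) = (\<integral>y. \<phi> y \<partial>(D n \<bind> ?K))"
      unfolding D_def by (simp add: distr_markov_law_Suc[OF K prob_space_walk_kernel])
    also have "\<dots> = (\<integral>y. (\<integral>z. \<phi> z \<partial>?K y) \<partial>D n)"
    proof (rule integral_bind)
      show "\<phi> \<in> borel_measurable borel" by (rule borel_measurable_circle[OF Suc.prems])
      show "?K \<in> D n \<rightarrow>\<^sub>M subprob_algebra borel"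
        using K by (simp add: D_def cong: measurable_cong_sets)
      show "finite_measure (D n)" by unfold_locales
      show "AE y in D n. emeasure (?K y) (space (?K y)) \<le> ennreal 1"
        using prob_space.emeasure_space_1[OF prob_space_walk_kernel] by (intro AE_I2) simp
    qed (rule C)
    also have "\<dots> = (\<integral>y. walk_op \<alpha> f \<phi> y \<partial>D n)"
      by (simp add: integral_walk_kernel[OF Suc.prems])
    also have "\<dots> = (walk_op \<alpha> f ^^ n) (walk_op \<alpha> f \<phi>) x"
      using continuous_on_walk_op_iter[OF f Suc.prems, where \<alpha> = \<alpha> and n = 1] by (intro Suc.IH) simp
    finally show ?case by (simp add: funpow_swap1)
  qed
  moreover have "(\<integral>y. \<phi> y \<partial>D n) = (\<integral>\<omega>. \<phi> (\<omega> n) \<partial>markov_law ?K x)"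
    unfolding D_def
    by (rule integral_distr[OF measurable_coordinate_markov_law[OF f] borel_measurable_circle[OF \<phi>]])
  ultimately show ?thesis by simp
qed

section \<open>Uniform contraction implies mixing\<close>

definition contracts :: "real \<Rightarrow> (circle \<Rightarrow> real) \<Rightarrow> (circle \<Rightarrow> real) \<Rightarrow> bool" where
  "contracts \<alpha> f \<phi> \<longleftrightarrow> (\<forall>e>0. \<exists>n v. \<forall>x. \<bar>(walk_op \<alpha> f ^^ n) \<phi> x - v\<bar> \<le> e)"

text \<open>
  The section of the quotient map with values in \<open>[0, 1)\<close> jumps at one point of the circle, but it
  is a pointwise limit of continuous functions which descend to \<open>0\<close> just before the end of the
  period.
\<close>

lemma measurable_fundamental_domain: "periodization (\<lambda>t. t) \<in> borel_measurable borel"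
proof (rule borel_measurable_LIMSEQ_real)
  fix x :: circle
  obtain r where x: "x = to_circle r" by (metis surjD[OF surj_to_circle])
  have "0 < 1 - frac r" using frac_lt_1[of r] by simp
  then obtain n0 :: nat where n0: "1 < real n0 * (1 - frac r)" using reals_Archimedean3 by blast
  have "min (frac r) (real n * (1 - frac r)) = frac r" if "n0 \<le> n" for n
  proof -
    have "real n0 * (1 - frac r) \<le> real n * (1 - frac r)"
      using that \<open>0 < 1 - frac r\<close> by (intro mult_right_mono) auto
    then have "frac r \<le> real n * (1 - frac r)" using n0 frac_lt_1[of r] by linarith
    then show ?thesis by (rule min_absorb1)
  qed
  then show "(\<lambda>n. periodization (\<lambda>t. min t (real n * (1 - t))) x) \<longlonglongrightarrow> periodization (\<lambda>t. t) x"
    unfolding x periodization_to_circle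
    by (intro tendsto_eventually) (auto simp: eventually_sequentially)
next
  fix n
  show "periodization (\<lambda>t. min t (real n * (1 - t))) \<in> borel_measurable borel"
    by (intro borel_measurable_circle continuous_on_periodization) (auto intro!: continuous_intros)
qed

lemma to_circle_fundamental_domain: "to_circle (periodization (\<lambda>t. t) x) = x"
  by (metis surjD[OF surj_to_circle] periodization_to_circle to_circle_frac)

text \<open>
  The limit measure comes from Helly's selection theorem: lift the laws of \<open>X\<^sub>n\<close>, started at \<open>0\<close>, to
  \<open>[0, 1)\<close>, where they are tight, and push a weak limit forward to the circle. Contraction
  upgrades convergence along the subsequence from one starting point to convergence of the whole
  sequence from every starting point.
\<close>

lemma mixing_if_contracts:
  assumes f: "continuous_on UNIV f"
    and contr: "\<And>\<phi>. continuous_on UNIV \<phi> \<Longrightarrow> contracts \<alpha> f \<phi>"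
  shows "mixing (walk_kernel \<alpha> f)"
proof -
  let ?K = "walk_kernel \<alpha> f" and ?L = "markov_law (walk_kernel \<alpha> f)"
  let ?P = "walk_op \<alpha> f"
  define s where "s = periodization (\<lambda>t. t)"
  have s [measurable]: "s \<in> borel_measurable borel" unfolding s_def by (rule measurable_fundamental_domain)
  note coord [measurable] = measurable_coordinate_markov_law[OF f, of _ \<alpha>]
  interpret L: prob_space "?L x" for x
    by (rule prob_space_markov_law[OF measurable_walk_kernel[OF f] prob_space_walk_kernel])
  define \<nu> where "\<nu> n = distr (?L 0) borel (\<lambda>\<omega>. s (\<omega> n))" for n
  have \<nu>_dist: "real_distribution (\<nu> n)" for n
    unfolding \<nu>_def by (rule L.real_distribution_distr) measurable
  have s_range: "0 \<le> s y" "s y < 1" for y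
    by (auto simp: s_def periodization_def frac_lt_1)
  have "tight \<nu>"
    unfolding tight_def
  proof (intro conjI allI impI)
    fix e :: real assume "0 < e"
    have "measure (\<nu> n) {-1<..1} = 1" for n
    proof -
      have "measure (\<nu> n) {-1<..1} = measure (?L 0) ((\<lambda>\<omega>. s (\<omega> n)) -` {-1<..1} \<inter> space (?L 0))"
        unfolding \<nu>_def by (rule measure_distr) auto
      also have "(\<lambda>\<omega>. s (\<omega> n)) -` {-1<..1} \<inter> space (?L 0) = space (?L 0)"
        using s_range(1)[THEN less_le_trans[of "-1" 0, rotated]] s_range(2)[THEN less_imp_le] by auto
      finally show ?thesis by (simp add: L.prob_space)
    qed
    with \<open>0 < e\<close> show "\<exists>a b. a < b \<and> (\<forall>n. 1 - e < measure (\<nu> n) {a<..b})"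
      by (intro exI[of _ "-1"] exI[of _ 1]) auto
  qed (rule \<nu>_dist)
  then obtain r M where r: "strict_mono (r :: nat \<Rightarrow> nat)" and M: "real_distribution M"
    and conv: "weak_conv_m (\<nu> \<circ> id \<circ> r) M"
    using tight_imp_convergent_subsubsequence[of \<nu> id] by (auto simp: strict_mono_def)
  interpret M: real_distribution M by (rule M)
  define \<mu> where "\<mu> = distr M borel to_circle"
  have to_circle_M: "to_circle \<in> M \<rightarrow>\<^sub>M borel"
    using measurable_to_circle by (simp cong: measurable_cong_sets)
  have sub: "(\<lambda>k. (?P ^^ r k) \<phi> 0) \<longlonglongrightarrow> (\<integral>y. \<phi> y \<partial>\<mu>)" if \<phi>: "continuous_on UNIV \<phi>" for \<phi>
  proof -
    obtain C where C: "\<And>y. \<bar>\<phi> y\<bar> \<le> C" using continuous_circle_bounded[OF \<phi>] by blast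
    have [measurable]: "\<phi> \<in> borel_measurable borel" by (rule borel_measurable_circle[OF \<phi>])
    have cont: "isCont (\<lambda>t. \<phi> (to_circle t)) t" for t
      using \<phi> by (simp add: continuous_on_circle_iff continuous_on_eq_continuous_at)
    have "(\<lambda>k. \<integral>t. \<phi> (to_circle t) \<partial>(\<nu> \<circ> id \<circ> r) k) \<longlonglongrightarrow> (\<integral>t. \<phi> (to_circle t) \<partial>M)"
      by (rule weak_conv_imp_integral_bdd_continuous_conv[OF _ M conv cont, of C])
         (use \<nu>_dist C in auto)
    moreover have "(\<integral>t. \<phi> (to_circle t) \<partial>(\<nu> \<circ> id \<circ> r) k) = (?P ^^ r k) \<phi> 0" for k
    proof -
      have "(\<integral>t. \<phi> (to_circle t) \<partial>\<nu> (r k)) = (\<integral>\<omega>. \<phi> (to_circle (s (\<omega> (r k)))) \<partial>?L 0)"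
        unfolding \<nu>_def by (rule integral_distr) measurable
      also have "\<dots> = (\<integral>\<omega>. \<phi> (\<omega> (r k)) \<partial>?L 0)"
        by (simp add: s_def to_circle_fundamental_domain)
      finally show ?thesis by (simp add: expectation_walk[OF f \<phi>])
    qed
    moreover have "(\<integral>t. \<phi> (to_circle t) \<partial>M) = (\<integral>y. \<phi> y \<partial>\<mu>)"
      unfolding \<mu>_def by (rule integral_distr[symmetric, OF to_circle_M]) simp
    ultimately show ?thesis by simp
  qed
  have lim: "(\<lambda>n. (?P ^^ n) \<phi> x) \<longlonglongrightarrow> (\<integral>y. \<phi> y \<partial>\<mu>)" if \<phi>: "continuous_on UNIV \<phi>" for \<phi> x
  proof (rule LIMSEQ_I)
    fix e :: real assume "0 < e"
    then obtain n v where nv: "\<And>y. \<bar>(?P ^^ n) \<phi> y - v\<bar> \<le> e / 3"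
      using contr[OF \<phi>] unfolding contracts_def by (meson divide_pos_pos zero_less_numeral)
    have near: "\<bar>(?P ^^ m) \<phi> y - v\<bar> \<le> e / 3" if "n \<le> m" for m y
      by (rule walk_op_iter_near_const_mono[OF nv that])
    have lim: "(\<lambda>k. \<bar>(?P ^^ r k) \<phi> 0 - v\<bar>) \<longlonglongrightarrow> \<bar>(\<integral>y. \<phi> y \<partial>\<mu>) - v\<bar>"
      by (intro tendsto_intros sub \<phi>)
    have "\<bar>(\<integral>y. \<phi> y \<partial>\<mu>) - v\<bar> \<le> e / 3"
    proof (rule LIMSEQ_le_const2[OF lim], intro exI[of _ n] allI impI near)
      fix k assume "n \<le> k"
      then show "n \<le> r k" using strict_mono_imp_increasing[OF r, of k] by simp
    qed
    then have "norm ((?P ^^ m) \<phi> x - (\<integral>y. \<phi> y \<partial>\<mu>)) < e" if "n \<le> m" for m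
      using near[OF that, of x] \<open>0 < e\<close> unfolding real_norm_def by linarith
    then show "\<exists>no. \<forall>n\<ge>no. norm ((?P ^^ n) \<phi> x - (\<integral>y. \<phi> y \<partial>\<mu>)) < e" by blast
  qed
  have "(\<lambda>n. \<integral>\<omega>. \<phi> (\<omega> n) \<partial>?L x) \<longlonglongrightarrow> (\<integral>y. \<phi> y \<partial>\<mu>)" if "continuous_on UNIV \<phi>"
    for x and \<phi> :: "circle \<Rightarrow> real"
    unfolding expectation_walk[OF f that] by (rule lim[OF that])
  moreover have "prob_space \<mu>" unfolding \<mu>_def by (rule M.prob_space_distr[OF to_circle_M])
  moreover have "sets \<mu> = sets borel" by (simp add: \<mu>_def)
  ultimately show ?thesis unfolding mixing_def by blast
qed

section \<open>Countably many test functions\<close>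

text \<open>
  Among the Bernstein polynomials of degree \<open>n\<close> only those with \<open>k = 0\<close> and \<open>k = n\<close> do not vanish at both
  ends of \<open>[0, 1]\<close>. Their sum takes the value \<open>1\<close> at both ends, so it is continuous on the circle.
\<close>

definition circle_Bernstein :: "nat \<Rightarrow> nat \<Rightarrow> circle \<Rightarrow> real" where
  "circle_Bernstein n k = periodization
     (\<lambda>t. if k = 0 then Bernstein n 0 t + Bernstein n n t else Bernstein n k t)"

lemma continuous_on_circle_Bernstein:
  assumes "k < n"
  shows "continuous_on UNIV (circle_Bernstein n k)"
  unfolding circle_Bernstein_def
proof (rule continuous_on_periodization)
  show "continuous_on {0..1} (\<lambda>t. if k = 0 then Bernstein n 0 t + Bernstein n n t else Bernstein n k t)"
    by (cases "k = 0") (auto simp: Bernstein_def intro!: continuous_intros)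
qed (use assms in \<open>auto simp: Bernstein_def power_0_left\<close>)

lemma contracts_add:
  assumes "contracts \<alpha> f \<phi>" "contracts \<alpha> f \<psi>"
  shows "contracts \<alpha> f (\<lambda>x. \<phi> x + \<psi> x)"
  unfolding contracts_def
proof (intro allI impI)
  fix e :: real assume "0 < e"
  then obtain n v m w where *: "\<And>x. \<bar>(walk_op \<alpha> f ^^ n) \<phi> x - v\<bar> \<le> e / 2" "\<And>x. \<bar>(walk_op \<alpha> f ^^ m) \<psi> x - w\<bar> \<le> e / 2"
    using assms unfolding contracts_def by (meson half_gt_zero)
  have b: "\<bar>(walk_op \<alpha> f ^^ max n m) \<phi> x - v\<bar> \<le> e / 2" "\<bar>(walk_op \<alpha> f ^^ max n m) \<psi> x - w\<bar> \<le> e / 2" for x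
    by (rule walk_op_iter_near_const_mono[OF *(1)], simp) (rule walk_op_iter_near_const_mono[OF *(2)], simp)
  have "\<bar>(walk_op \<alpha> f ^^ max n m) (\<lambda>x. \<phi> x + \<psi> x) x - (v + w)\<bar> \<le> e" for x
    unfolding walk_op_iter_add using b(1)[of x] b(2)[of x] by linarith
  then show "\<exists>n v. \<forall>x. \<bar>(walk_op \<alpha> f ^^ n) (\<lambda>x. \<phi> x + \<psi> x) x - v\<bar> \<le> e" by blast
qed

lemma contracts_cmult:
  assumes "contracts \<alpha> f \<phi>"
  shows "contracts \<alpha> f (\<lambda>x. c * \<phi> x)"
  unfolding contracts_def
proof (intro allI impI)
  fix e :: real assume "0 < e"
  then have "0 < e / (\<bar>c\<bar> + 1)" by simp
  then obtain n v where *: "\<And>x. \<bar>(walk_op \<alpha> f ^^ n) \<phi> x - v\<bar> \<le> e / (\<bar>c\<bar> + 1)"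
    using assms unfolding contracts_def by blast
  have "\<bar>(walk_op \<alpha> f ^^ n) (\<lambda>x. c * \<phi> x) x - c * v\<bar> \<le> e" for x
  proof -
    have "\<bar>(walk_op \<alpha> f ^^ n) (\<lambda>x. c * \<phi> x) x - c * v\<bar> = \<bar>c\<bar> * \<bar>(walk_op \<alpha> f ^^ n) \<phi> x - v\<bar>"
      unfolding walk_op_iter_cmult by (simp add: abs_mult[symmetric] right_diff_distrib)
    also have "\<dots> \<le> (\<bar>c\<bar> + 1) * (e / (\<bar>c\<bar> + 1))"
      using *[of x] by (intro mult_mono) auto
    finally show ?thesis by simp
  qed
  then show "\<exists>n v. \<forall>x. \<bar>(walk_op \<alpha> f ^^ n) (\<lambda>x. c * \<phi> x) x - v\<bar> \<le> e" by blast
qed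

lemma contracts_sum:
  assumes "finite I" "\<And>i. i \<in> I \<Longrightarrow> contracts \<alpha> f (\<phi> i)"
  shows "contracts \<alpha> f (\<lambda>x. \<Sum>i\<in>I. \<phi> i x)"
  using assms
proof (induction I rule: finite_induct)
  case empty
  have "\<bar>(walk_op \<alpha> f ^^ 0) (\<lambda>x. 0) x - 0\<bar> \<le> e" if "0 < e" for e x
    using that by simp
  then show ?case unfolding contracts_def sum.empty by blast
qed (simp add: contracts_add)

lemma contracts_uniform_limit:
  assumes "\<And>e. 0 < e \<Longrightarrow> \<exists>\<psi>. contracts \<alpha> f \<psi> \<and> (\<forall>x. \<bar>\<phi> x - \<psi> x\<bar> \<le> e)"
  shows "contracts \<alpha> f \<phi>"
  unfolding contracts_def
proof (intro allI impI)
  fix e :: real assume "0 < e"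
  then have e2: "0 < e / 2" by simp
  from assms[OF e2] obtain \<psi> where \<psi>: "contracts \<alpha> f \<psi>" "\<And>x. \<bar>\<phi> x - \<psi> x\<bar> \<le> e / 2" by blast
  from \<psi>(1) e2 obtain n v where n: "\<And>x. \<bar>(walk_op \<alpha> f ^^ n) \<psi> x - v\<bar> \<le> e / 2"
    unfolding contracts_def by blast
  have "\<bar>(walk_op \<alpha> f ^^ n) \<phi> x - v\<bar> \<le> e" for x
  proof -
    have "\<bar>(walk_op \<alpha> f ^^ n) (\<lambda>x. \<phi> x - \<psi> x) x - 0\<bar> \<le> e / 2"
      by (rule walk_op_iter_near_const) (use \<psi>(2) in simp)
    then show ?thesis using n[of x] unfolding walk_op_iter_diff by linarith
  qed
  then show "\<exists>n v. \<forall>x. \<bar>(walk_op \<alpha> f ^^ n) \<phi> x - v\<bar> \<le> e" by blast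
qed

text \<open>
  In the Bernstein approximation of a function on the circle the coefficients for \<open>k = 0\<close> and \<open>k = n\<close>
  agree, so the approximating polynomial is a combination of the functions \<open>circle_Bernstein n k\<close>.
\<close>

lemma contracts_if_circle_Bernstein:
  assumes B: "\<And>n k. k < n \<Longrightarrow> contracts \<alpha> f (circle_Bernstein n k)"
    and \<phi>: "continuous_on UNIV \<phi>"
  shows "contracts \<alpha> f \<phi>"
proof (rule contracts_uniform_limit)
  fix e :: real assume "0 < e"
  define F where "F t = \<phi> (to_circle t)" for t
  have "continuous_on {0..1} F"
    unfolding F_def using \<phi> continuous_on_circle_iff continuous_on_subset by blast
  from Bernstein_Weierstrass[OF this \<open>0 < e\<close>] obtain N where
    N: "\<And>n t. N \<le> n \<Longrightarrow> t \<in> {0..1} \<Longrightarrow> \<bar>F t - (\<Sum>k\<le>n. F (k / n) * Bernstein n k t)\<bar> < e" by blast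
  define n where "n = Suc N"
  define \<psi> where "\<psi> x = (\<Sum>k<n. F (k / n) * circle_Bernstein n k x)" for x
  have "contracts \<alpha> f \<psi>"
    unfolding \<psi>_def by (intro contracts_sum contracts_cmult B) auto
  moreover have "\<bar>\<phi> x - \<psi> x\<bar> \<le> e" for x
  proof -
    obtain r where x: "x = to_circle r" by (metis surjD[OF surj_to_circle])
    define t where "t = frac r"
    have t: "t \<in> {0..1}" using frac_lt_1[of r] by (simp add: t_def)
    have xt: "x = to_circle t" by (simp add: x t_def to_circle_frac)
    have F01: "F 1 = F 0" using to_circle_of_int[of 1] to_circle_of_int[of 0] by (simp add: F_def)
    have B_eq: "circle_Bernstein n k x = (if k = 0 then Bernstein n 0 t + Bernstein n n t else Bernstein n k t)" for k
      by (simp add: circle_Bernstein_def x periodization_to_circle t_def)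
    have "\<psi> x = F 0 * (Bernstein n 0 t + Bernstein n n t) + (\<Sum>k<N. F (Suc k / n) * Bernstein n (Suc k) t)"
      unfolding \<psi>_def B_eq by (simp add: n_def sum.lessThan_Suc_shift del: sum.lessThan_Suc)
    also have "\<dots> = (\<Sum>k\<le>n. F (k / n) * Bernstein n k t)"
    proof -
      have "(\<Sum>k\<le>n. F (k / n) * Bernstein n k t) =
          (\<Sum>k<n. F (k / n) * Bernstein n k t) + F 1 * Bernstein n n t"
        unfolding lessThan_Suc_atMost[symmetric] by (simp add: n_def)
      also have "(\<Sum>k<n. F (k / n) * Bernstein n k t) =
          F 0 * Bernstein n 0 t + (\<Sum>k<N. F (Suc k / n) * Bernstein n (Suc k) t)"
        by (simp add: n_def sum.lessThan_Suc_shift del: sum.lessThan_Suc)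
      finally show ?thesis by (simp add: F01 algebra_simps)
    qed
    finally show ?thesis
      using N[of n t] t by (simp add: n_def xt F_def)
  qed
  ultimately show "\<exists>\<psi>. contracts \<alpha> f \<psi> \<and> (\<forall>x. \<bar>\<phi> x - \<psi> x\<bar> \<le> e)" by blast
qed

section \<open>The generic set\<close>

lemma abs_diff_le_bv_dist:
  assumes "f \<in> AC0" "g \<in> AC0"
  shows "\<bar>f x - g x\<bar> \<le> bv_dist f g"
proof -
  have ac: "abs_cont_circle (\<lambda>x. f x - g x)"
    using assms absolutely_continuous_on_diff[of "{0..1}" "f \<circ> to_circle" "g \<circ> to_circle"]
    by (simp add: AC0_def abs_cont_circle_def comp_def)
  have "\<bar>f x - g x\<bar> \<le> (SUP x. \<bar>f x - g x\<bar>)"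
    by (rule cSUP_upper) (use abs_cont_circle_bdd_above(2)[OF ac] in auto)
  moreover have "0 \<le> var_circle (\<lambda>x. f x - g x)"
    unfolding var_circle_def
  proof (rule cSup_upper2)
    show "0 \<in> variation_sums 0 1 ((\<lambda>x. f x - g x) \<circ> to_circle)"
      using abs_le_variation_sums[of 0 0 1 "(\<lambda>x. f x - g x) \<circ> to_circle"] by simp
  qed (use abs_cont_circle_bdd_above(1)[OF ac] in auto)
  ultimately show ?thesis using assms by (simp add: bv_dist_def bv_norm_def)
qed

text \<open>
  The bound \<open>r\<close> strictly below \<open>\<epsilon>\<close> leaves room for perturbing \<open>f\<close>, which makes the set open.
\<close>

definition contracting_set :: "real \<Rightarrow> (circle \<Rightarrow> real) \<Rightarrow> real \<Rightarrow> (circle \<Rightarrow> real) set" where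
  "contracting_set \<alpha> \<phi> \<epsilon> = {f \<in> AC0. \<exists>n v r. r < \<epsilon> \<and> (\<forall>x. \<bar>(walk_op \<alpha> f ^^ n) \<phi> x - v\<bar> \<le> r)}"

text \<open>
  \<open>P\<^sup>n \<phi>\<close> is a Lipschitz function of \<open>f\<close> for the supremum norm, which the bounded variation distance
  dominates.
\<close>

lemma openin_contracting_set:
  assumes \<phi>: "continuous_on UNIV \<phi>"
  shows "openin AC0_topology (contracting_set \<alpha> \<phi> \<epsilon>)"
proof -
  interpret Metric_space AC0 bv_dist by (rule Metric_space_AC0)
  obtain C where C: "0 < C" "\<And>x. \<bar>\<phi> x\<bar> \<le> C" using continuous_circle_bounded[OF \<phi>] by blast
  show ?thesis
    unfolding AC0_topology_def openin_mtopology
  proof (intro conjI allI impI)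
    show "contracting_set \<alpha> \<phi> \<epsilon> \<subseteq> AC0" by (auto simp: contracting_set_def)
    fix f assume "f \<in> contracting_set \<alpha> \<phi> \<epsilon>"
    then obtain n v r where f: "f \<in> AC0" and r: "r < \<epsilon>" "\<And>x. \<bar>(walk_op \<alpha> f ^^ n) \<phi> x - v\<bar> \<le> r"
      unfolding contracting_set_def by blast
    define K where "K = (real n + 1) * (2 * C)"
    have K: "0 < K" using C(1) by (simp add: K_def)
    define d where "d = (\<epsilon> - r) / (2 * K)"
    have d: "0 < d" using r(1) K by (simp add: d_def)
    have nd: "real n * (2 * C * d) \<le> (\<epsilon> - r) / 2"
    proof -
      have "real n * (2 * C * d) \<le> (real n + 1) * (2 * C * d)"
        using C(1) d by (intro mult_right_mono) auto
      also have "\<dots> = K * d" by (simp add: K_def)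
      also have "\<dots> = (\<epsilon> - r) / 2" using K by (simp add: d_def)
      finally show ?thesis .
    qed
    have "mball f d \<subseteq> contracting_set \<alpha> \<phi> \<epsilon>"
    proof
      fix g assume "g \<in> mball f d"
      then have g: "g \<in> AC0" "bv_dist f g < d" by auto
      have fg: "\<bar>g x - f x\<bar> \<le> d" for x
        using abs_diff_le_bv_dist[OF f g(1), of x] g(2) by linarith
      have "\<bar>(walk_op \<alpha> g ^^ n) \<phi> x - v\<bar> \<le> r + (\<epsilon> - r) / 2" for x
      proof -
        have "\<bar>(walk_op \<alpha> g ^^ n) \<phi> x - (walk_op \<alpha> f ^^ n) \<phi> x\<bar> \<le> real n * (2 * C * d)"
          by (rule walk_op_iter_Lipschitz) (rule fg C(2))+
        then show ?thesis using nd r(2)[of x] by linarith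
      qed
      moreover have "r + (\<epsilon> - r) / 2 < \<epsilon>" using r(1) by (simp add: field_simps)
      ultimately show "g \<in> contracting_set \<alpha> \<phi> \<epsilon>"
        using g(1) unfolding contracting_set_def by blast
    qed
    with d show "\<exists>r>0. mball f r \<subseteq> contracting_set \<alpha> \<phi> \<epsilon>" by blast
  qed
qed

theorem theorem3:
  fixes \<alpha> :: real
  assumes "\<alpha> \<notin> \<rat>"
  shows "\<exists>G. gdelta_in AC0_topology G \<and>
             AC0_topology closure_of G = topspace AC0_topology \<and>
             (\<forall>f\<in>G. mixing (walk_kernel \<alpha> f))"
proof -
  interpret Metric_space AC0 bv_dist by (rule Metric_space_AC0)
  define J :: "(nat \<times> nat \<times> nat) set" where "J = {(n, k, j). k < n}"
  define U where "U = (\<lambda>(n, k, j). contracting_set \<alpha> (circle_Bernstein n k) (1 / real (Suc j)))"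
  define G where "G = \<Inter>(U ` J)"
  have J: "(1, 0, 0) \<in> J" by (simp add: J_def)
  have "gdelta_in AC0_topology G"
    unfolding G_def
  proof (rule gdelta_in_Inter)
    show "countable (U ` J)" by (rule countable_image) (rule countableI_type)
    show "U ` J \<noteq> {}" using J by blast
    show "gdelta_in AC0_topology S" if "S \<in> U ` J" for S
      using that
      by (auto simp: U_def J_def intro!: open_imp_gdelta_in openin_contracting_set continuous_on_circle_Bernstein)
  qed
  moreover have coboundary_in_G: "(\<lambda>x. u x - u (x - to_circle \<alpha>)) \<in> G"
    if u: "continuous_on UNIV u" and AC0: "(\<lambda>x. u x - u (x - to_circle \<alpha>)) \<in> AC0" for u
    unfolding G_def
  proof (rule INT_I)
    fix p assume "p \<in> J"
    then obtain n k j where p: "p = (n, k, j)" "k < n" by (auto simp: J_def)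
    define \<epsilon> where "\<epsilon> = 1 / real (Suc j)"
    have \<epsilon>: "0 < \<epsilon> / 2" "\<epsilon> / 2 < \<epsilon>"
    proof -
      have "0 < \<epsilon>" by (simp add: \<epsilon>_def)
      then show "0 < \<epsilon> / 2" "\<epsilon> / 2 < \<epsilon>" by simp_all
    qed
    obtain m v where "\<And>x. \<bar>(walk_op \<alpha> (\<lambda>x. u x - u (x - to_circle \<alpha>)) ^^ m) (circle_Bernstein n k) x - v\<bar> \<le> \<epsilon> / 2"
      by (rule coboundary_walk_contracts[OF assms u continuous_on_circle_Bernstein[OF p(2)] \<epsilon>(1)]) (rule that)
    with \<epsilon>(2) show "(\<lambda>x. u x - u (x - to_circle \<alpha>)) \<in> U p"
      using AC0 unfolding p(1) U_def contracting_set_def \<epsilon>_def[symmetric] prod.case by blast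
  qed
  have "AC0_topology closure_of G = topspace AC0_topology"
  proof -
    have "f \<in> mtopology closure_of G" if f: "f \<in> AC0" for f
      unfolding metric_closure_of
    proof (intro CollectI conjI allI impI f)
      fix e :: real assume "0 < e"
      obtain u where "continuous_on UNIV u" "(\<lambda>x. u x - u (x - to_circle \<alpha>)) \<in> AC0"
        "bv_dist f (\<lambda>x. u x - u (x - to_circle \<alpha>)) < e"
        by (rule coboundaries_dense[OF assms f \<open>0 < e\<close>]) (rule that)
      with coboundary_in_G f show "\<exists>g\<in>G. g \<in> mball f e" by auto
    qed
    moreover have "mtopology closure_of G \<subseteq> AC0" using closure_of_subset_topspace by fastforce
    ultimately show ?thesis unfolding topspace_AC0_topology unfolding AC0_topology_def by blast
  qed
  moreover have "mixing (walk_kernel \<alpha> f)" if "f \<in> G" for f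
  proof -
    have inU: "f \<in> contracting_set \<alpha> (circle_Bernstein n k) (1 / real (Suc j))" if "k < n" for n k j
      using \<open>f \<in> G\<close> that by (auto simp: G_def U_def J_def)
    have "f \<in> AC0" using inU[of 0 1] by (simp add: contracting_set_def)
    then have cont: "continuous_on UNIV f"
      by (auto simp: AC0_def intro: abs_cont_circle_continuous)
    have "contracts \<alpha> f (circle_Bernstein n k)" if "k < n" for n k
      unfolding contracts_def
    proof (intro allI impI)
      fix e :: real assume "0 < e"
      then obtain j where "1 / real (Suc j) < e" by (rule nat_approx_posE)
      from inU[OF that, of j] obtain m v r where "r < 1 / real (Suc j)"
        and m: "\<And>x. \<bar>(walk_op \<alpha> f ^^ m) (circle_Bernstein n k) x - v\<bar> \<le> r"
        unfolding contracting_set_def by blast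
      then have "r \<le> e" using \<open>1 / real (Suc j) < e\<close> by linarith
      with m have "\<bar>(walk_op \<alpha> f ^^ m) (circle_Bernstein n k) x - v\<bar> \<le> e" for x
        using order_trans by blast
      then show "\<exists>m v. \<forall>x. \<bar>(walk_op \<alpha> f ^^ m) (circle_Bernstein n k) x - v\<bar> \<le> e" by blast
    qed
    then have "contracts \<alpha> f \<phi>" if "continuous_on UNIV \<phi>" for \<phi>
      using that by (rule contracts_if_circle_Bernstein)
    then show ?thesis by (rule mixing_if_contracts[OF cont])
  qed
  ultimately show ?thesis by blast
qed

end
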